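(* Let $\lambda\in\mathbb{R}$. For odd $a\ge 3$, let $d(a)$ be the dimension of the $\mathbb{Q}$-vector space spanned by the real numbers $$1,\quad \lambda,\quad \zeta(i)+\binom{i+1}{2}\lambda\,\zeta(i+2)\ \text{ for odd } i\in\{3,5,\ldots,a\}$$ (i.e. $\zeta(3)+6\lambda\zeta(5)$, $\zeta(5)+15\lambda\zeta(7)$, \ldots, $\zeta(a)+\binom{a+1}{2}\lambda\zeta(a+2)$). Then $d(a)\ge \frac{\log a}{1+\log 2}(1+o(1))$ as $a\to\infty$ with $a$ odd.
   Context: $\zeta$ is the Riemann zeta function. The $o(1)$ denotes a quantity depending on $a$ (and possibly $\lambda$) that tends to $0$ as $a\to\infty$. *)

theory Defs
  imports "HOL-Analysis.Analysis"
begin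

(* The reals as a vector space over the rationals.  The qualifier is needed: the unqualified
   constants span and dim are the real-linear ones. *)
global_interpretation rat_real: vector_space "\<lambda>(q::rat) (x::real). of_rat q * x"
  by unfold_locales (simp_all add: algebra_simps of_rat_add of_rat_mult)

(* Dirichlet series of the Riemann zeta function at natural arguments.  It converges exactly for
   k > 1; for k \<le> 1 the value carries no meaning. *)
definition zeta :: "nat \<Rightarrow> real" where
  "zeta k = (\<Sum>n. 1 / real (Suc n) ^ k)"

lemma zeta_sums:
  assumes "k > 1"
  shows "(\<lambda>n. 1 / real (Suc n) ^ k) sums zeta k"
proof -
  have "summable (\<lambda>n. inverse (real n ^ k))"
    using assms by (intro inverse_power_summable) auto
  hence "summable (\<lambda>n. 1 / real (Suc n) ^ k)"
    by (subst (asm) summable_Suc_iff [symmetric]) (simp add: inverse_eq_divide)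
  thus ?thesis
    unfolding zeta_def by (rule summable_sums)
qed

definition zeta_generators :: "real \<Rightarrow> nat \<Rightarrow> real set" where
  "zeta_generators lam a =
     {1, lam} \<union>
     {zeta i + real ((i + 1) choose 2) * lam * zeta (i + 2) | i. odd i \<and> 3 \<le> i \<and> i \<le> a}"

(* rat_real.dim is 0 by convention on infinite-dimensional subspaces. *)
lemma finite_zeta_generators: "finite (zeta_generators lam a)"
proof -
  have "finite {i. odd i \<and> 3 \<le> i \<and> i \<le> a}"
    by (rule finite_subset [of _ "{..a}"]) auto
  thus ?thesis
    by (simp add: zeta_generators_def)
qed

definition zeta_span_dim :: "real \<Rightarrow> nat \<Rightarrow> nat" where
  "zeta_span_dim lam a = rat_real.dim (rat_real.span (zeta_generators lam a))"

end

theory Submission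
  imports Defs
    "HOL-Complex_Analysis.Complex_Analysis"
    "HOL-Number_Theory.Prime_Powers"
    "HOL-Real_Asymp.Real_Asymp"
begin

text \<open>
  For odd \<open>a\<close>, even \<open>n\<close> and \<open>6 r < a\<close>, the rational function
  \<open>R(t) = n!\<^sup>a\<^sup>-\<^sup>6\<^sup>r ((t - rn)\<^sub>r\<^sub>n)\<^sup>3 ((t + n + 1)\<^sub>r\<^sub>n)\<^sup>3 / ((t)\<^sub>n\<^sub>+\<^sub>1)\<^sup>a\<close> satisfies \<open>R(-n - t) = -R(t)\<close>. Expanding it into partial
  fractions writes \<open>\<Sum> R(k)\<close> as a rational combination of \<open>1, \<zeta>(3), \<zeta>(5), \<dots>, \<zeta>(a)\<close>, and
  \<open>\<Sum> R''(k) / 2\<close>, up to the rational constant, as the same combination with \<open>\<zeta>(i)\<close> replaced by \<open>(i+1 choose 2) \<zeta>(i + 2)\<close>. Hence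
  \<open>\<Sum> R(k) + \<lambda> \<Sum> R''(k) / 2\<close>, multiplied by \<open>2 d\<^sub>n\<^sup>a\<^sup>+\<^sup>2\<close> for a common denominator \<open>d\<^sub>n\<close> of \<open>1, 1/2, \<dots>, 1/n\<close>, is an integer
  linear form in the given numbers. The second sum is \<open>o(\<Sum> R(k))\<close>, since \<open>R\<close> concentrates where
  \<open>R'/R\<close> is small. The forms have size at most about \<open>r\<^sup>-\<^sup>(\<^sup>a\<^sup>-\<^sup>6\<^sup>r\<^sup>)\<^sup>n d\<^sub>n\<^sup>a\<^sup>+\<^sup>2\<close>, their coefficients at most about
  \<open>(2\<^sup>a (e (r + 1))\<^sup>6\<^sup>r)\<^sup>n d\<^sub>n\<^sup>a\<^sup>+\<^sup>2\<close>, and \<open>d\<^sub>n \<le> e\<^sup>(\<^sup>1\<^sup>+\<^sup>o\<^sup>(\<^sup>1\<^sup>)\<^sup>)\<^sup>n\<close> by the prime number theorem, of which the upper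
  bound \<open>\<psi>(n) \<le> (1 + o(1)) n\<close> is proved by Newman's method. Nesterenko's
  criterion and the choice \<open>r = \<lfloor>a / (ln a)\<^sup>2\<rfloor>\<close> give the bound.
\<close>

section \<open>The Chebyshev function and common denominators\<close>

text \<open>The constants of the theorem can be read off per unit of n. The 1 in 1 + ln 2 is the
  price of the common denominator, whose power of order a costs e^(a n); a weaker bound \<psi>(n)
  \<le> c n would put c in its place. The ln 2 comes from the a elementary factors of R, each of
  which has residues with absolute sum of order 2^n up to the binomials of the 6r numerator blocks,
  and these blocks cost only 6r ln r. The gain is a ln r, from the a - 6r factors that carry n!. The
  obstacle is that \<lambda> is an arbitrary real number, so nothing arithmetic excludes that a form
  vanishes or that consecutive forms differ wildly. Positivity settles both: the sum of R has
  nonnegative terms, and once the second sum is a small enough multiple of it, the form lies between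
  two fixed multiples of one positive quantity. Comparing that quantity at n and at n + 2 term by
  term gives the polynomial regularity that the criterion asks for, so crude inequalities take the
  place of asymptotics of the sums.\<close>

definition cheb_psi :: "nat \<Rightarrow> real" where
  "cheb_psi n = (\<Sum>m\<in>{1..n}. mangoldt m)"

lemma cheb_psi_0 [simp]: "cheb_psi 0 = 0"
  by (simp add: cheb_psi_def)

lemma cheb_psi_Suc: "cheb_psi (Suc n) = cheb_psi n + mangoldt (Suc n)"
  by (simp add: cheb_psi_def)

lemma cheb_psi_nonneg: "cheb_psi n \<ge> 0"
  by (simp add: cheb_psi_def sum_nonneg mangoldt_nonneg)

lemma cheb_psi_mono: "m \<le> n \<Longrightarrow> cheb_psi m \<le> cheb_psi n"
  unfolding cheb_psi_def by (intro sum_mono2) (auto simp: mangoldt_nonneg)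

text \<open>Passing from \<open>n\<close> to \<open>n + 1\<close> raises \<open>n div d\<close> by
  one exactly when \<open>d\<close> divides \<open>n + 1\<close>, and the Mangoldt values of these
  divisors add up to ln (n + 1).\<close>

lemma ln_fact_eq_sum_mangoldt:
  "ln (fact n) = (\<Sum>d\<in>{1..n}. mangoldt d * real (n div d))"
proof (induction n)
  case (Suc n)
  have "(\<Sum>d\<in>{1..Suc n}. mangoldt d * real (Suc n div d)) =
        (\<Sum>d\<in>{1..Suc n}. mangoldt d * real (n div d) + (if d dvd Suc n then mangoldt d else 0))"
    by (intro sum.cong) (auto simp: div_Suc algebra_simps mod_eq_0_iff_dvd)
  also have "\<dots> = (\<Sum>d\<in>{1..Suc n}. mangoldt d * real (n div d)) +
                 (\<Sum>d\<in>{1..Suc n}. if d dvd Suc n then mangoldt d else 0)"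
    by (rule sum.distrib)
  also have "(\<Sum>d\<in>{1..Suc n}. mangoldt d * real (n div d)) = (\<Sum>d\<in>{1..n}. mangoldt d * real (n div d))"
    by simp
  also have "(\<Sum>d\<in>{1..Suc n}. if d dvd Suc n then mangoldt d else 0) = (\<Sum>d | d dvd Suc n. mangoldt d :: real)"
  proof (intro sum.mono_neutral_cong_right)
    show "{d. d dvd Suc n} \<subseteq> {1..Suc n}"
      using dvd_imp_le[of _ "Suc n"] by (force intro: Suc_leI dvd_pos_nat)
  qed auto
  also have "\<dots> = ln (real (Suc n))"
    using mangoldt_sum[of "Suc n", where ?'a = real] by simp
  finally show ?case
    using Suc by (simp add: ln_mult)
qed auto

text \<open>Chebyshev's argument: in the logarithm of the central binomial coefficient,
  \<open>mangoldt d\<close> has the weight \<open>2 * n div d - 2 * (n div d)\<close>, which is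
  never negative and is at least 1 for n < d \<le> 2n.\<close>

lemma cheb_psi_double_le: "cheb_psi (2 * n) - cheb_psi n \<le> 2 * real n * ln 2"
proof -
  have "cheb_psi (2*n) - cheb_psi n = (\<Sum>d\<in>{n<..2*n}. mangoldt d)"
  proof -
    have "{1..2*n} = {1..n} \<union> {n<..2*n}" by auto
    show ?thesis
      unfolding cheb_psi_def \<open>{1..2*n} = _\<close> by (subst sum.union_disjoint) auto
  qed
  also have "\<dots> \<le> (\<Sum>d\<in>{1..2*n}. mangoldt d * (real (2 * n div d) - 2 * real (n div d)))"
  proof -
    have "(\<Sum>d\<in>{n<..2*n}. mangoldt d) = (\<Sum>d\<in>{1..2*n}. if d \<in> {n<..2*n} then mangoldt d else 0 :: real)"
      by (rule sum.mono_neutral_cong_left) auto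
    also have "\<dots> \<le> (\<Sum>d\<in>{1..2*n}. mangoldt d * (real (2 * n div d) - 2 * real (n div d)))"
    proof (rule sum_mono)
      fix d assume d: "d \<in> {1..2*n}"
      have "2 * (n div d) \<le> 2 * n div d"
        using d by (simp add: less_eq_div_iff_mult_less_eq mult.assoc)
      then have 1: "2 * real (n div d) \<le> real (2 * n div d)"
        by (metis of_nat_le_iff of_nat_mult of_nat_numeral)
      have 2: "1 \<le> 2 * n div d" "n div d = 0" if "d \<in> {n<..2*n}"
        using that d by (auto simp: Suc_le_eq div_greater_zero_iff)
      show "(if d \<in> {n<..2*n} then mangoldt d else 0) \<le> mangoldt d * (real (2 * n div d) - 2 * real (n div d))"
      proof (cases "d \<in> {n<..2*n}")
        case True
        have "mangoldt d * 1 \<le> mangoldt d * (real (2 * n div d) - 2 * real (n div d))"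
          using 2[OF True] by (intro mult_left_mono mangoldt_nonneg) simp
        then show ?thesis using True by simp
      next
        case False
        show ?thesis unfolding if_not_P[OF False]
          using 1 by (intro mult_nonneg_nonneg mangoldt_nonneg) simp
      qed
    qed
    finally show ?thesis .
  qed
  also have "\<dots> = ln (fact (2 * n)) - 2 * ln (fact n)"
  proof -
    have "ln (fact n) = (\<Sum>d\<in>{1..2*n}. mangoldt d * real (n div d))"
      unfolding ln_fact_eq_sum_mangoldt by (intro sum.mono_neutral_left) auto
    then show ?thesis
      by (simp add: ln_fact_eq_sum_mangoldt sum_subtractf sum_distrib_left algebra_simps)
  qed
  also have "\<dots> = ln (real ((2 * n) choose n))"
    by (simp add: binomial_fact ln_div ln_mult)
  also have "\<dots> \<le> ln (2 ^ (2 * n))"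
  proof (rule ln_mono)
    show "0 < real (2 * n choose n)" by (simp add: zero_less_binomial)
    show "real (2 * n choose n) \<le> 2 ^ (2 * n)"
      using binomial_le_pow2[of "2*n" n] by (metis of_nat_le_iff of_nat_numeral of_nat_power)
  qed
  also have "\<dots> = 2 * real n * ln 2"
    by (simp add: ln_realpow)
  finally show ?thesis .
qed

lemma cheb_psi_le: "cheb_psi n \<le> 4 * real n"
proof (induction n rule: less_induct)
  case (less n)
  have l2: "ln 2 \<le> (1::real)" using ln_le_minus_one[of 2] by simp
  define m where "m = n div 2"
  show ?case
  proof (cases "n = 0")
    case False
    have IH: "cheb_psi m \<le> 4 * real m" using False by (intro less) (auto simp: m_def)
    \<comment> \<open>The constant 4 leaves a margin of 2m below 8m, which pays for the odd case:
      there the extra term is at most ln (2m + 1) \<le> 2m.\<close>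
    have *: "cheb_psi (2*m) \<le> 6 * real m"
    proof -
      have "2 * real m * ln 2 \<le> 2 * real m * 1" by (intro mult_left_mono l2) auto
      then show ?thesis using IH cheb_psi_double_le[of m] by simp
    qed
    show ?thesis
    proof (cases "even n")
      case True
      then have "n = 2 * m" by (auto simp: m_def)
      then show ?thesis using * by simp
    next
      case False
      then have n: "n = Suc (2 * m)" by (auto simp: m_def elim: oddE)
      have "mangoldt (Suc (2 * m)) \<le> ln (real (Suc (2 * m)))"
        by (rule mangoldt_le) auto
      also have "\<dots> \<le> real (Suc (2*m)) - 1" by (rule ln_le_minus_one) auto
      finally show ?thesis using * by (simp add: n cheb_psi_Suc)
    qed
  qed auto
qed

text \<open>
  A stand-in for \<open>lcm(1, \<dots>, n)\<close>: one factor \<open>p\<close> for every power \<open>p\<^sup>k \<le> n\<close> of a prime. Only the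
  divisibility below and the logarithm \<open>cheb_psi n\<close> matter.
\<close>

definition common_denom :: "nat \<Rightarrow> nat" where
  "common_denom n = (\<Prod>m\<in>{1..n}. if primepow m then aprimedivisor m else 1)"

lemma common_denom_pos: "common_denom n > 0"
  unfolding common_denom_def
  by (intro prod_pos) (auto intro!: aprimedivisor_pos_nat primepow_gt_Suc_0)

lemma of_nat_common_denom: "real (common_denom n) = exp (cheb_psi n)"
proof -
  have "real (if primepow m then aprimedivisor m else 1) = exp (mangoldt m)" for m
  proof (cases "primepow m")
    case True
    then have "aprimedivisor m > 0"
      by (auto intro!: aprimedivisor_pos_nat primepow_gt_Suc_0)
    then show ?thesis using True by (simp add: mangoldt_def)
  qed (auto simp: mangoldt_def)
  then show ?thesis
    by (simp add: common_denom_def cheb_psi_def exp_sum)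
qed

lemma common_denom_mono: "m \<le> n \<Longrightarrow> common_denom m \<le> common_denom n"
  using cheb_psi_mono[of m n] of_nat_common_denom by (metis exp_le_cancel_iff of_nat_le_iff)

text \<open>If p^e is the exact power of p in \<open>k\<close>, then p, ..., p^e are e different
  prime powers up to \<open>n\<close>, and each contributes one factor p to the product.\<close>

lemma dvd_common_denom:
  assumes "1 \<le> k" "k \<le> n"
  shows "k dvd common_denom n"
proof (rule multiplicity_le_imp_dvd)
  fix p :: nat assume p: "prime p"
  define e where "e = multiplicity p k"
  have pe: "p ^ e \<le> n"
    using assms multiplicity_dvd[of p k] by (auto simp: e_def dest!: dvd_imp_le)
  have p1: "p > 1" using p prime_gt_1_nat by blast
  have inj: "inj_on (\<lambda>i. p ^ i) {1..e}"
    using p1 by (auto simp: inj_on_def)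
  have sub: "(\<lambda>i. p ^ i) ` {1..e} \<subseteq> {1..n}"
  proof safe
    fix i assume "i \<in> {1..e}"
    then have "p ^ i \<le> p ^ e" using p1 by (intro power_increasing) auto
    also note pe
    finally show "p ^ i \<in> {1..n}" using p1 by auto
  qed
  have "p ^ e = (\<Prod>i\<in>{1..e}. p)" by simp
  also have "\<dots> = (\<Prod>i\<in>{1..e}. if primepow (p ^ i) then aprimedivisor (p ^ i) else 1)"
    using p by (intro prod.cong) (auto simp: aprimedivisor_prime_power primepow_prime_power)
  also have "\<dots> = (\<Prod>m\<in>(\<lambda>i. p ^ i) ` {1..e}. if primepow m then aprimedivisor m else 1)"
    using inj by (simp add: prod.reindex)
  also have "\<dots> dvd common_denom n"
    unfolding common_denom_def by (rule prod_dvd_prod_subset) (use sub in auto)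
  finally show "multiplicity p k \<le> multiplicity p (common_denom n)"
    using p common_denom_pos[of n]
    by (metis e_def multiplicity_geI less_not_refl not_prime_unit)
qed (use assms in auto)

section \<open>Newman's Tauberian theorem\<close>

text \<open>Comparison with the integral of u^(-1-x) over [n, n + 1], written as a difference so
  that tails telescope to at most N^(-x) / x.\<close>

lemma powr_tail_term_le:
  fixes x :: real
  assumes "x > 0" "n \<ge> 1"
  shows "real (Suc n) powr (-1 - x) \<le> (real n powr (-x) - real (Suc n) powr (-x)) / x"
proof -
  obtain t where t: "real n < t" "t < real (Suc n)"
      "real (Suc n) powr (-x) - real n powr (-x) = (real (Suc n) - real n) * (-x * t powr (-x - 1))"
  proof -
    have "\<exists>z>real n. z < real (Suc n) \<and> real (Suc n) powr (-x) - real n powr (-x) = (real (Suc n) - real n) * (-x * z powr (-x - 1))"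
    proof (rule MVT2)
      fix u :: real assume "real n \<le> u" "u \<le> real (Suc n)"
      then show "((\<lambda>t. t powr (-x)) has_real_derivative (-x * u powr (-x - 1))) (at u)"
        using assms by (intro has_real_derivative_powr) auto
    qed auto
    then show ?thesis using that by blast
  qed
  have exx: "-1 - x = -x - 1" by simp
  have "x * real (Suc n) powr (-1 - x) \<le> x * t powr (-1 - x)"
    using t assms by (intro mult_left_mono powr_mono2') auto
  also have "\<dots> = real n powr (-x) - real (Suc n) powr (-x)"
    using t(3) unfolding exx by (simp add: algebra_simps)
  finally show ?thesis using assms by (simp add: field_simps)
qed

text \<open>Again a comparison with the integral of u^(y-1). For y \<le> 1 the integrand decreases
  and each term is bounded by the interval on its left; for y > 1 it increases, so the sum is
  shifted by one and its last term stands apart.\<close>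

lemma sum_powr_head_le:
  fixes y :: real
  assumes "y > 0" "N \<ge> 1"
  shows "(\<Sum>n\<in>{1..N}. real n powr (y - 1)) \<le> real N powr y / y + real N powr (y - 1)"
proof (cases "y \<le> 1")
  case True
  have "(\<Sum>n\<in>{1..N}. real n powr (y - 1)) \<le> real N powr y / y"
  proof (induction N)
    case (Suc N)
    have "real (Suc N) powr (y - 1) \<le> (real (Suc N) powr y - real N powr y) / y"
    proof (cases "N = 0")
      case True
      then show ?thesis using assms \<open>y \<le> 1\<close> by (simp add: field_simps)
    next
      case False
      have "\<exists>z>real N. z < real (Suc N) \<and> real (Suc N) powr y - real N powr y = (real (Suc N) - real N) * (y * z powr (y - 1))"
        using False by (intro MVT2 has_real_derivative_powr) auto
      then obtain t where t: "real N < t" "t < real (Suc N)" "real (Suc N) powr y - real N powr y = y * t powr (y - 1)"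
        by auto
      have "y * real (Suc N) powr (y - 1) \<le> y * t powr (y - 1)"
        using t True assms by (intro mult_left_mono powr_mono2') auto
      then show ?thesis using t assms by (simp add: field_simps)
    qed
    then show ?case using Suc by (simp add: diff_divide_distrib)
  qed auto
  then show ?thesis by (simp add: add_increasing2)
next
  case False
  have "(\<Sum>n\<in>{1..N}. real (n-1) powr (y - 1)) \<le> real N powr y / y"
  proof (induction N)
    case (Suc N)
    have "real N powr (y - 1) \<le> (real (Suc N) powr y - real N powr y) / y"
    proof (cases "N = 0")
      case True
      then show ?thesis using assms by (simp add: field_simps)
    next
      case False
      have "\<exists>z>real N. z < real (Suc N) \<and> real (Suc N) powr y - real N powr y = (real (Suc N) - real N) * (y * z powr (y - 1))"
        using False by (intro MVT2 has_real_derivative_powr) auto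
      then obtain t where t: "real N < t" "t < real (Suc N)" "real (Suc N) powr y - real N powr y = y * t powr (y - 1)"
        by auto
      have "y * real N powr (y - 1) \<le> y * t powr (y - 1)"
        using t \<open>\<not> y \<le> 1\<close> assms by (intro mult_left_mono powr_mono2) auto
      then show ?thesis using t assms by (simp add: field_simps)
    qed
    then show ?case using Suc by (simp add: diff_divide_distrib)
  qed auto
  moreover have "(\<Sum>n\<in>{1..N}. real n powr (y - 1)) = (\<Sum>n\<in>{1..N}. real (n-1) powr (y - 1)) + real N powr (y - 1)"
    using \<open>N \<ge> 1\<close>
  proof (induction N rule: dec_induct)
    case base
    then show ?case using False by simp
  qed simp
  ultimately show ?thesis by simp
qed

text \<open>The endpoints are excluded because the real part vanishes there while the estimates on
  the arcs divide by it; the bound for contour integrals tolerates finitely many exceptional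
  points.\<close>

lemma Re_neg_left_arc:
  assumes "z \<in> path_image (part_circlepath 0 R (pi/2) (3*pi/2)) - {\<i> * of_real R, -\<i> * of_real R}" "R > 0"
  shows "Re z < 0" "norm z = R"
proof -
  obtain t where t: "t \<in> {pi/2..3*pi/2}" "z = of_real R * cis t"
    using assms by (auto simp: path_image_part_circlepath' closed_segment_eq_real_ivl)
  have "cos (t - pi) \<ge> 0" using t by (intro cos_ge_zero) auto
  then have c: "cos t \<le> 0" by simp
  have "cos t \<noteq> 0"
  proof
    assume "cos t = 0"
    then have "(sin t)\<^sup>2 = 1" using sin_cos_squared_add[of t] by simp
    then have "sin t = 1 \<or> sin t = -1" by (simp add: power2_eq_1_iff)
    with \<open>cos t = 0\<close> have "cis t = \<i> \<or> cis t = -\<i>" by (auto simp: complex_eq_iff)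
    then show False using assms t by auto
  qed
  with c t assms show "Re z < 0" by (simp add: mult_pos_neg)
  show "norm z = R" using t assms by (simp add: norm_mult)
qed

lemma Re_pos_right_arc:
  assumes "z \<in> path_image (part_circlepath 0 R (-pi/2) (pi/2)) - {\<i> * of_real R, -\<i> * of_real R}" "R > 0"
  shows "Re z > 0" "norm z = R"
proof -
  obtain t where t: "t \<in> {-pi/2..pi/2}" "z = of_real R * cis t"
    using assms by (auto simp: path_image_part_circlepath' closed_segment_eq_real_ivl)
  have c: "cos t \<ge> 0" using t by (intro cos_ge_zero) auto
  have "cos t \<noteq> 0"
  proof
    assume "cos t = 0"
    then have "(sin t)\<^sup>2 = 1" using sin_cos_squared_add[of t] by simp
    then have "sin t = 1 \<or> sin t = -1" by (simp add: power2_eq_1_iff)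
    with \<open>cos t = 0\<close> have "cis t = \<i> \<or> cis t = -\<i>" by (auto simp: complex_eq_iff)
    then show False using assms t by auto
  qed
  with c t assms show "Re z > 0" by simp
  show "norm z = R" using t assms by (simp add: norm_mult)
qed

text \<open>On the circle 1 / z equals cnj z / R^2, which makes the kernel real. Its zeros at the
  two points of the imaginary axis compensate the blow-up 1 / |Re z| of the bounds for tail and
  partial sum.\<close>

lemma norm_newman_kernel:
  assumes "norm z = R" "R > 0"
  shows "norm ((1 + z\<^sup>2 / of_real R ^ 2) / z) = 2 * \<bar>Re z\<bar> / R\<^sup>2"
proof -
  have "z \<noteq> 0" using assms by auto
  have "1 / z = cnj z / of_real (R\<^sup>2)"
    using assms \<open>z \<noteq> 0\<close> complex_norm_square[of z] by (simp add: field_simps)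
  then have "(1 + z\<^sup>2 / of_real R ^ 2) / z = (cnj z + z) / of_real (R\<^sup>2)"
    using \<open>z \<noteq> 0\<close> by (simp add: add_divide_distrib power2_eq_square)
  also have "cnj z + z = of_real (2 * Re z)"
    by (simp add: complex_add_cnj add.commute)
  finally show ?thesis using assms by (simp add: norm_divide norm_power abs_mult)
qed

lemma has_contour_integral_inverse_part_circlepath:
  assumes "R > 0" "a < b"
  shows "((\<lambda>z. c / z) has_contour_integral (c * \<i> * of_real (b - a))) (part_circlepath 0 R a b)"
proof -
  have "((\<lambda>t. c * \<i>) has_integral (b - a) *\<^sub>R (c * \<i>)) {a..b}"
    using assms has_integral_const_real[of "c * \<i>" a b] by simp
  then show ?thesis
    using assms by (simp add: has_contour_integral_part_circlepath_iff scaleR_conv_of_real field_simps)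
qed

lemma cis_quarter_turns: "cis (3*pi/2) = -\<i>" "cis (-pi/2) = -\<i>" "cis (pi/2) = \<i>"
proof -
  have "cis (3*pi/2) = cis (-pi/2 + 2 * pi)" by (simp add: field_simps)
  also have "\<dots> = cis (-pi/2)" by (subst cis_mult[symmetric]) (simp add: cis_2pi)
  finally show "cis (3*pi/2) = -\<i>" by (simp add: cis_minus_pi_half)
qed (auto simp: cis_minus_pi_half)

text \<open>Cauchy's formula on a circle, cut in two because the halves are estimated differently.
  Subtracting f(0) / z leaves an entire function, and c / z is integrated explicitly over each
  arc.\<close>

lemma Cauchy_half_circles:
  assumes f: "f holomorphic_on UNIV" and R: "R > 0"
  defines "rt \<equiv> part_circlepath 0 R (-pi/2) (pi/2)" and "lt \<equiv> part_circlepath 0 R (pi/2) (3*pi/2)"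
  shows "contour_integral rt (\<lambda>z. f z / z) + contour_integral lt (\<lambda>z. f z / z) = 2 * of_real pi * \<i> * f 0"
    and "(\<lambda>z. f z / z) contour_integrable_on rt" "(\<lambda>z. f z / z) contour_integrable_on lt"
proof -
  define h where "h = (\<lambda>z. if z = 0 then deriv f 0 else (f z - f 0) / (z - 0))"
  have h: "h holomorphic_on UNIV"
    unfolding h_def by (rule pole_lemma_open) (use f in auto)
  have hi: "h contour_integrable_on rt" "h contour_integrable_on lt"
    unfolding rt_def lt_def
    by (intro contour_integrable_continuous_part_circlepath holomorphic_on_imp_continuous_on
        holomorphic_on_subset[OF h]; simp)+
  have ends: "pathfinish rt = pathstart lt" "pathfinish lt = pathstart rt"
    using cis_quarter_turns by (auto simp: rt_def lt_def cis_conv_exp)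
  have vp: "valid_path rt" "valid_path lt" by (auto simp: rt_def lt_def)
  have "(h has_contour_integral 0) (rt +++ lt)"
    by (rule Cauchy_theorem_convex_simple[of _ UNIV]) (use h ends vp in auto)
  then have h0: "contour_integral rt h + contour_integral lt h = 0"
    using hi vp by (metis contour_integral_join contour_integral_unique)
  have n0: "0 \<notin> path_image rt" "0 \<notin> path_image lt"
    using R by (auto simp: rt_def lt_def dest!: in_path_image_part_circlepath)
  have eq: "((\<lambda>z. f z / z) has_contour_integral (contour_integral g h + f 0 * \<i> * of_real pi)) g"
    if "h contour_integrable_on g" "((\<lambda>z. f 0 / z) has_contour_integral (f 0 * \<i> * of_real pi)) g" "0 \<notin> path_image g" for g
  proof -
    have "((\<lambda>z. h z + f 0 / z) has_contour_integral (contour_integral g h + f 0 * \<i> * of_real pi)) g"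
      using that by (intro has_contour_integral_add has_contour_integral_integral)
    moreover have "h z + f 0 / z = f z / z" if "z \<in> path_image g" for z
      using that \<open>0 \<notin> path_image g\<close> by (auto simp: h_def field_simps)
    ultimately show ?thesis by (rule has_contour_integral_eq)
  qed
  have 1: "((\<lambda>z. f z / z) has_contour_integral (contour_integral rt h + f 0 * \<i> * of_real pi)) rt"
    using has_contour_integral_inverse_part_circlepath[of R "-pi/2" "pi/2" "f 0"] R
    by (intro eq hi n0) (auto simp: rt_def)
  have 2: "((\<lambda>z. f z / z) has_contour_integral (contour_integral lt h + f 0 * \<i> * of_real pi)) lt"
    using has_contour_integral_inverse_part_circlepath[of R "pi/2" "3*pi/2" "f 0"] R
    by (intro eq hi n0) (auto simp: lt_def field_simps)
  show "(\<lambda>z. f z / z) contour_integrable_on rt" "(\<lambda>z. f z / z) contour_integrable_on lt"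
    using 1 2 by (auto simp: contour_integrable_on_def)
  have "contour_integral rt (\<lambda>z. f z / z) + contour_integral lt (\<lambda>z. f z / z) =
      (contour_integral rt h + contour_integral lt h) + 2 * of_real pi * \<i> * f 0"
    using 1 2 by (simp add: contour_integral_unique)
  then show "contour_integral rt (\<lambda>z. f z / z) + contour_integral lt (\<lambda>z. f z / z) = 2 * of_real pi * \<i> * f 0"
    using h0 by simp
qed

text \<open>
  Newman's contour: the transform minus its partial sum is integrated over the right half circle, the
  (entire) partial sum over the left half circle, and the transform over a rectangular detour that
  enters the left half plane only by \<open>\<eta>\<close>.
\<close>

lemma newman_bound:
  fixes a :: "nat \<Rightarrow> complex" and g :: "complex \<Rightarrow> complex"
  assumes C: "\<And>n. norm (a n) \<le> C"
    and U: "open U" "{z. Re z \<ge> 0} \<subseteq> U" and g: "g holomorphic_on U" and g0: "g 0 = 0"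
    and sums: "\<And>z. Re z > 0 \<Longrightarrow> (\<lambda>n. a (Suc n) * of_nat (Suc n) powr (-1-z)) sums g z"
    and R: "R > 0"
  shows "\<exists>B \<eta>1. \<eta>1 > 0 \<and> (\<forall>\<eta> N. 0 < \<eta> \<and> \<eta> \<le> \<eta>1 \<and> N \<ge> 1 \<longrightarrow>
           2 * pi * norm (\<Sum>n\<in>{1..N}. a n / of_nat n) \<le>
             4 * pi * C / R + 2 * pi * C / N + 2 * B * \<eta> + 2 * R * B * real N powr (-\<eta>))"
proof -
  have C0: "C \<ge> 0" using C[of 0] norm_ge_zero order_trans by blast
  define rt where "rt \<equiv> part_circlepath 0 R (-pi/2) (pi/2)"
  define lt where "lt \<equiv> part_circlepath 0 R (pi/2) (3*pi/2)"
  define K where "K = (\<lambda>y. \<i> * of_real y) ` {-R-1..R+1}"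
  have "compact K" unfolding K_def by (intro compact_continuous_image continuous_intros) auto
  moreover have "K \<subseteq> U" using U by (auto simp: K_def)
  ultimately obtain e where e: "e > 0" "(\<Union>x\<in>K. ball x e) \<subseteq> U"
    using compact_subset_open_imp_ball_epsilon_subset[of K U] U by metis
  \<comment> \<open>A convex region containing the right half circle and a thin rectangle to its
    left, so that Cauchy's theorem applies to the closed contour made of both. Its points with
    negative real part are within \<open>e\<close> of the segment \<open>K\<close>, hence in
    \<open>U\<close>.\<close>
  define V where "V = {z. Re z > -e} \<inter> ({z. Im z > -R-1} \<inter> {z. Im z < R+1})"
  have V: "open V" "convex V"
    unfolding V_def by (intro open_Int convex_Int open_halfspace_Re_gt open_halfspace_Im_gt open_halfspace_Im_lt
        convex_halfspace_Re_gt convex_halfspace_Im_gt convex_halfspace_Im_lt)+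
  have VU: "V \<subseteq> U"
  proof
    fix z assume z: "z \<in> V"
    show "z \<in> U"
    proof (cases "Re z \<ge> 0")
      case False
      have "\<i> * of_real (Im z) \<in> K" using z by (auto simp: K_def V_def)
      moreover have "dist (\<i> * of_real (Im z)) z < e"
      proof -
        have "\<i> * of_real (Im z) - z = - of_real (Re z)" by (simp add: complex_eq_iff)
        then show ?thesis using z False by (simp add: dist_norm V_def)
      qed
      ultimately show ?thesis using e by (auto simp: ball_def)
    qed (use U in auto)
  qed
  \<comment> \<open>Since \<open>g 0 = 0\<close>, this is g(z) / z with its singularity removed, and
    the contour around 0 yields no residue.\<close>
  define h where "h = (\<lambda>z. if z = 0 then deriv g 0 else (g z - g 0) / (z - 0))"
  have h: "h holomorphic_on V"
    unfolding h_def by (rule pole_lemma_open) (use g VU V holomorphic_on_subset in auto)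
  define \<eta>1 where "\<eta>1 = e / 2"
  define Q where "Q = cbox (Complex (-\<eta>1) (-R)) (Complex 0 R)"
  have QV: "Q \<subseteq> V" using e by (auto simp: Q_def V_def in_cbox_complex_iff \<eta>1_def)
  \<comment> \<open>The bound B depends on R but not on N or on \<eta>: the factor N^z of the kernel
    is kept out of it.\<close>
  have "compact ((\<lambda>z. h z * (1 + z\<^sup>2 / of_real R ^ 2)) ` Q)"
    using holomorphic_on_imp_continuous_on[OF h] QV
    by (intro compact_continuous_image continuous_intros) (use R in \<open>auto simp: Q_def intro: continuous_on_subset\<close>)
  then obtain B where B: "B > 0" "\<And>z. z \<in> Q \<Longrightarrow> norm (h z * (1 + z\<^sup>2 / of_real R ^ 2)) \<le> B"
    using compact_imp_bounded bounded_pos by (metis (no_types, lifting) image_eqI)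
  have "\<eta>1 > 0" using e by (simp add: \<eta>1_def)
  have main: "2 * pi * norm (\<Sum>n\<in>{1..N}. a n / of_nat n) \<le>
             4 * pi * C / R + 2 * pi * C / N + 2 * B * \<eta> + 2 * R * B * real N powr (-\<eta>)"
    if \<eta>: "0 < \<eta>" "\<eta> \<le> \<eta>1" and N: "N \<ge> 1" for \<eta> :: real and N :: nat
  proof -
    define s where "s = (\<lambda>z. \<Sum>n\<in>{1..N}. a n * of_nat n powr (-1-z))"
    have s: "s holomorphic_on UNIV" unfolding s_def by (intro holomorphic_intros)
    \<comment> \<open>Newman's kernel. As \<open>P 0 = 1\<close>, Cauchy's formula still returns the
      partial sum \<open>s 0\<close>, while N^z offsets the size N^(-Re z) of the tail on the right
      arc and of the partial sum on the left arc.\<close>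
    define P where "P = (\<lambda>z::complex. of_nat N powr z * (1 + z\<^sup>2 / of_real R ^ 2))"
    have P: "P holomorphic_on A" for A
      unfolding P_def by (intro holomorphic_intros) (use R in auto)
    have P0: "P 0 = 1" using N by (simp add: P_def)
    have kern: "norm (P z / z) = real N powr Re z * (2 * \<bar>Re z\<bar> / R\<^sup>2)" if "norm z = R" for z
    proof -
      have "norm (P z / z) = norm ((of_nat N :: complex) powr z) * norm ((1 + z\<^sup>2 / of_real R ^ 2) / z)"
        by (simp add: P_def norm_mult norm_divide)
      also have "norm ((of_nat N :: complex) powr z) = real N powr Re z"
        using N by (subst norm_powr_real_powr) auto
      finally show ?thesis using norm_newman_kernel[OF that R] by simp
    qed
    have sP: "(\<lambda>z. s z * P z) holomorphic_on UNIV" by (intro holomorphic_intros s P)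
    note cauchy1 = Cauchy_half_circles[OF sP R, folded rt_def lt_def]
    define p1 where "p1 = linepath (\<i> * of_real R) (\<i> * of_real R - of_real \<eta>)"
    define p2 where "p2 = linepath (\<i> * of_real R - of_real \<eta>) (-\<i> * of_real R - of_real \<eta>)"
    define p3 where "p3 = linepath (-\<i> * of_real R - of_real \<eta>) (-\<i> * of_real R)"
    have rt_ends: "pathstart rt = -\<i> * of_real R" "pathfinish rt = \<i> * of_real R"
      using cis_quarter_turns by (auto simp: rt_def cis_conv_exp)
    have seg: "path_image p1 \<subseteq> Q" "path_image p2 \<subseteq> Q \<inter> {z. Re z = -\<eta>}" "path_image p3 \<subseteq> Q"
    proof -
      have cQ: "convex Q" by (simp add: Q_def)
      have "convex {z. Re z = -\<eta>}" 
        using convex_hyperplane[of "1::complex" "-\<eta>"] by (simp add: inner_complex_def)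
      have pts: "\<i> * of_real R \<in> Q" "\<i> * of_real R - of_real \<eta> \<in> Q" "-\<i> * of_real R - of_real \<eta> \<in> Q" "-\<i> * of_real R \<in> Q"
        using R \<eta> by (auto simp: Q_def in_cbox_complex_iff)
      show "path_image p1 \<subseteq> Q" "path_image p3 \<subseteq> Q"
        unfolding p1_def p3_def path_image_linepath by (intro closed_segment_subset pts cQ)+
      show "path_image p2 \<subseteq> Q \<inter> {z. Re z = -\<eta>}"
        unfolding p2_def path_image_linepath
        by (intro closed_segment_subset convex_Int cQ \<open>convex {z. Re z = -\<eta>}\<close>) (use pts in auto)
    qed
    have rtV: "path_image rt \<subseteq> V"
    proof
      fix z assume z: "z \<in> path_image rt"
      then have 1: "norm z = R" using R by (auto simp: rt_def dest!: in_path_image_part_circlepath)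
      moreover have "Re z \<ge> 0"
        using Re_pos_right_arc[of z R] z R by (cases "z \<in> {\<i> * of_real R, -\<i> * of_real R}") (auto simp: rt_def intro: less_imp_le)
      ultimately show "z \<in> V" using e abs_Im_le_cmod[of z] by (auto simp: V_def)
    qed
    define \<phi> where "\<phi> = (\<lambda>z. h z * P z)"
    have \<phi>: "\<phi> holomorphic_on V" unfolding \<phi>_def by (intro holomorphic_intros h P)
    have vp: "valid_path rt" "valid_path p1" "valid_path p2" "valid_path p3"
      by (auto simp: rt_def p1_def p2_def p3_def)
    have \<phi>i: "\<phi> contour_integrable_on rt" "\<phi> contour_integrable_on p1" "\<phi> contour_integrable_on p2" "\<phi> contour_integrable_on p3"
      using rtV seg QV vp by (intro contour_integrable_holomorphic_simple[OF \<phi> V(1)]; auto)+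
    have "(\<phi> has_contour_integral 0) (rt +++ (p1 +++ (p2 +++ p3)))"
    proof (rule Cauchy_theorem_convex_simple[OF \<phi> V(2)])
      show "valid_path (rt +++ p1 +++ p2 +++ p3)"
        using vp rt_ends by (intro valid_path_join) (auto simp: p1_def p2_def p3_def)
      show "path_image (rt +++ p1 +++ p2 +++ p3) \<subseteq> V"
        using rtV seg QV by (intro order_trans[OF path_image_join_subset] Un_least) auto
      show "pathfinish (rt +++ p1 +++ p2 +++ p3) = pathstart (rt +++ p1 +++ p2 +++ p3)"
        using rt_ends by (simp add: p3_def)
    qed
    then have c0: "contour_integral (rt +++ (p1 +++ (p2 +++ p3))) \<phi> = 0"
      by (rule contour_integral_unique)
    have cauchy2: "contour_integral rt \<phi> + (contour_integral p1 \<phi> + (contour_integral p2 \<phi> + contour_integral p3 \<phi>)) = 0"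
      (is "?I = 0")
    proof -
      have "(\<phi> has_contour_integral ?I) (rt +++ (p1 +++ (p2 +++ p3)))"
        using vp by (intro has_contour_integral_join has_contour_integral_integral \<phi>i valid_path_join)
          (auto simp: p1_def p2_def p3_def)
      then show ?thesis using c0 by (simp only: contour_integral_unique)
    qed
    have \<phi>Q: "norm (\<phi> z) \<le> B * real N powr (Re z)" if "z \<in> Q" for z
    proof -
      have "norm (\<phi> z) = norm (h z * (1 + z\<^sup>2 / of_real R ^ 2)) * real N powr Re z"
        using N by (simp add: \<phi>_def P_def norm_mult norm_powr_real_powr mult_ac)
      then show ?thesis using B(2)[OF that] by (simp add: mult_right_mono)
    qed
    have \<phi>Q1: "norm (\<phi> z) \<le> B" if "z \<in> Q" for z
    proof -
      have "Re z \<le> 0" using that by (auto simp: Q_def in_cbox_complex_iff)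
      then have "real N powr (Re z) \<le> real N powr 0" using N by (intro powr_mono) auto
      then have "B * real N powr (Re z) \<le> B * 1" using B(1) N by (intro mult_left_mono) auto
      then show ?thesis using \<phi>Q[OF that] by simp
    qed
    have b1: "norm (contour_integral p1 \<phi>) \<le> B * \<eta>"
    proof -
      have "norm (contour_integral p1 \<phi>) \<le> B * norm ((\<i> * of_real R - of_real \<eta>) - \<i> * of_real R)"
        using \<phi>i(2) seg(1) \<phi>Q1 B(1) unfolding p1_def by (intro contour_integral_bound_linepath) auto
      then show ?thesis using \<eta> by simp
    qed
    have b3: "norm (contour_integral p3 \<phi>) \<le> B * \<eta>"
    proof -
      have "norm (contour_integral p3 \<phi>) \<le> B * norm (-\<i> * of_real R - (-\<i> * of_real R - of_real \<eta>))"
        using \<phi>i(4) seg(3) \<phi>Q1 B(1) unfolding p3_def by (intro contour_integral_bound_linepath) auto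
      then show ?thesis using \<eta> by simp
    qed
    have b2: "norm (contour_integral p2 \<phi>) \<le> 2 * R * B * real N powr (-\<eta>)"
    proof -
      have "norm (contour_integral p2 \<phi>) \<le> (B * real N powr (-\<eta>)) * norm ((-\<i> * of_real R - of_real \<eta>) - (\<i> * of_real R - of_real \<eta>))"
        using \<phi>i(3) seg(2) \<phi>Q B(1) unfolding p2_def by (intro contour_integral_bound_linepath) force+
      also have "(-\<i> * of_real R - of_real \<eta>) - (\<i> * of_real R - of_real \<eta>) = -2 * \<i> * of_real R" by simp
      finally show ?thesis using R by (simp add: norm_mult mult_ac)
    qed
    define ex where "ex = {\<i> * of_real R, -\<i> * of_real R}"
    have br: "norm (contour_integral rt (\<lambda>z. s z * P z / z - \<phi> z)) \<le> 2 * C / R\<^sup>2 * R * (pi / 2 - (-pi/2))"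
      unfolding rt_def
    proof (rule contour_integral_bound_part_circlepath_strong)
      show "(\<lambda>z. s z * P z / z - \<phi> z) contour_integrable_on part_circlepath 0 R (-pi/2) (pi/2)"
        using cauchy1(2) \<phi>i(1) unfolding rt_def by (rule contour_integrable_diff)
      show "finite ex" by (simp add: ex_def)
      fix z assume z: "z \<in> path_image (part_circlepath 0 R (-pi/2) (pi/2)) - ex"
      then have x: "Re z > 0" and nz: "norm z = R"
        using Re_pos_right_arc[of z R] R by (auto simp: ex_def)
      then have z0: "z \<noteq> 0" by auto
      have eq: "s z * P z / z - \<phi> z = (s z - g z) * (P z / z)"
        using z0 g0 by (simp add: \<phi>_def h_def field_simps)
      have "norm (s z - g z) \<le> C * (real N powr (-Re z) / Re z)"
      proof -
        have sg: "(\<lambda>M. \<Sum>n\<in>{1..M}. a n * of_nat n powr (-1-z)) \<longlonglongrightarrow> g z"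
          using sums[OF x] unfolding sums_def by (simp add: sum.atLeast1_atMost_eq)
        have "(\<lambda>M. norm (s z - (\<Sum>n\<in>{1..M}. a n * of_nat n powr (-1-z)))) \<longlonglongrightarrow> norm (s z - g z)"
          by (intro tendsto_intros sg)
        moreover have "norm (s z - (\<Sum>n\<in>{1..M}. a n * of_nat n powr (-1-z))) \<le> C * (real N powr (-Re z) / Re z)" if M: "M \<ge> N" for M
        proof -
          have "(\<Sum>n\<in>{1..M}. a n * of_nat n powr (-1-z)) = s z + (\<Sum>n\<in>{N<..M}. a n * of_nat n powr (-1-z))"
          proof -
            have "{1..M} = {1..N} \<union> {N<..M}" using M by auto
            show ?thesis unfolding s_def \<open>{1..M} = _\<close> by (subst sum.union_disjoint) auto
          qed
          then have "norm (s z - (\<Sum>n\<in>{1..M}. a n * of_nat n powr (-1-z))) = norm (\<Sum>n\<in>{N<..M}. a n * of_nat n powr (-1-z))"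
            by (simp add: norm_minus_commute)
          also have "\<dots> \<le> (\<Sum>n\<in>{N<..M}. C * real n powr (-1 - Re z))"
          proof (rule sum_norm_le)
            fix n assume "n \<in> {N<..M}"
            then have "norm ((of_nat n :: complex) powr (-1-z)) = real n powr (-1 - Re z)"
              by (subst norm_powr_real_powr) auto
            then show "norm (a n * of_nat n powr (-1-z)) \<le> C * real n powr (-1 - Re z)"
              using C[of n] by (simp add: norm_mult mult_right_mono)
          qed
          also have "\<dots> = C * (\<Sum>n\<in>{N<..M}. real n powr (-1 - Re z))" by (simp add: sum_distrib_left)
          also have "(\<Sum>n\<in>{N<..M}. real n powr (-1 - Re z)) \<le> (real N powr (-Re z) - real M powr (-Re z)) / Re z"
            using M
          proof (induction M rule: dec_induct)
            case (step m)
            have "{N<..Suc m} = insert (Suc m) {N<..m}" using step by auto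
            then show ?case
              using step powr_tail_term_le[OF x, of m] N by (simp add: diff_divide_distrib)
          qed auto
          also have "\<dots> \<le> real N powr (-Re z) / Re z"
            using x by (intro divide_right_mono) auto
          finally show ?thesis using C0 by (simp add: mult_left_mono)
        qed
        ultimately show ?thesis
          by (intro Lim_bounded[where M = N]) auto
      qed
      then have "norm ((s z - g z) * (P z / z)) \<le> C * (real N powr (-Re z) / Re z) * (real N powr Re z * (2 * \<bar>Re z\<bar> / R\<^sup>2))"
        unfolding norm_mult kern[OF nz] by (intro mult_right_mono) auto
      also have "\<dots> = 2 * C / R\<^sup>2"
        using x N by (simp add: powr_minus field_simps)
      finally show "norm (s z * P z / z - \<phi> z) \<le> 2 * C / R\<^sup>2" by (simp only: eq)
    qed (use R C0 in auto)
    \<comment> \<open>Only the entire partial sum \<open>s\<close> occurs on this arc. Its main term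
      N^y / y meets the kernel factor N^(-y) 2y / R^2; the second term N^(y-1) produces the part
      with 1 / N.\<close>
    have bl: "norm (contour_integral lt (\<lambda>z. s z * P z / z)) \<le> (2 * C / R\<^sup>2 + 2 * C / (N * R)) * R * (3 * pi / 2 - pi/2)"
      unfolding lt_def
    proof (rule contour_integral_bound_part_circlepath_strong)
      show "(\<lambda>z. s z * P z / z) contour_integrable_on part_circlepath 0 R (pi/2) (3*pi/2)"
        using cauchy1(3) unfolding lt_def .
      show "finite ex" by (simp add: ex_def)
      fix z assume z: "z \<in> path_image (part_circlepath 0 R (pi/2) (3*pi/2)) - ex"
      then have x: "Re z < 0" and nz: "norm z = R"
        using Re_neg_left_arc[of z R] R by (auto simp: ex_def)
      define y where "y = - Re z"
      have y: "y > 0" "y \<le> R" using x nz abs_Re_le_cmod[of z] by (auto simp: y_def)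
      have kz: "real N powr Re z * (2 * \<bar>Re z\<bar> / R\<^sup>2) = real N powr (-y) * (2 * y / R\<^sup>2)"
        using x by (simp add: y_def)
      have "norm (s z) \<le> (\<Sum>n\<in>{1..N}. C * real n powr (y - 1))"
        unfolding s_def
      proof (rule sum_norm_le)
        fix n assume "n \<in> {1..N}"
        then have "norm ((of_nat n :: complex) powr (-1-z)) = real n powr (-1 - Re z)"
          by (subst norm_powr_real_powr) auto
        also have "-1 - Re z = y - 1" by (simp add: y_def)
        finally have "norm ((of_nat n :: complex) powr (-1-z)) = real n powr (y - 1)" .
        then show "norm (a n * of_nat n powr (-1-z)) \<le> C * real n powr (y - 1)"
          using C[of n] by (simp add: norm_mult mult_right_mono)
      qed
      also have "\<dots> = C * (\<Sum>n\<in>{1..N}. real n powr (y - 1))" by (simp add: sum_distrib_left)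
      also have "\<dots> \<le> C * (real N powr y / y + real N powr (y - 1))"
        using sum_powr_head_le[OF y(1) N] C0 by (intro mult_left_mono)
      finally have "norm (s z * (P z / z)) \<le> C * (real N powr y / y + real N powr (y - 1)) * (real N powr (-y) * (2 * y / R\<^sup>2))"
        unfolding norm_mult kern[OF nz] kz by (intro mult_right_mono) (use y in auto)
      also have "\<dots> = 2 * C / R\<^sup>2 + C * 2 * y / (N * R\<^sup>2)"
        using y N R by (simp add: powr_minus powr_diff field_simps)
      also have "\<dots> \<le> 2 * C / R\<^sup>2 + C * 2 * R / (N * R\<^sup>2)"
        using y C0 by (intro add_left_mono divide_right_mono mult_left_mono) auto
      also have "\<dots> = 2 * C / R\<^sup>2 + 2 * C / (N * R)"
        using R by (simp add: power2_eq_square)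
      finally show "norm (s z * P z / z) \<le> 2 * C / R\<^sup>2 + 2 * C / (N * R)" by simp
    qed (use R C0 in auto)
    have "2 * of_real pi * \<i> * (s 0 * P 0) = contour_integral rt (\<lambda>z. s z * P z / z) + contour_integral lt (\<lambda>z. s z * P z / z)"
      using cauchy1(1) by simp
    also have "contour_integral rt (\<lambda>z. s z * P z / z) = contour_integral rt (\<lambda>z. s z * P z / z - \<phi> z) + contour_integral rt \<phi>"
      using contour_integral_diff[OF cauchy1(2) \<phi>i(1)] by simp
    also have "contour_integral rt \<phi> = - (contour_integral p1 \<phi> + (contour_integral p2 \<phi> + contour_integral p3 \<phi>))"
      using cauchy2 by (simp only: eq_neg_iff_add_eq_0)
    finally have split: "2 * of_real pi * \<i> * (s 0 * P 0) = contour_integral rt (\<lambda>z. s z * P z / z - \<phi> z) +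
        - (contour_integral p1 \<phi> + (contour_integral p2 \<phi> + contour_integral p3 \<phi>)) + contour_integral lt (\<lambda>z. s z * P z / z)" .
    have tri: "norm (x + - (u + (v + w)) + y) \<le> norm x + (norm u + (norm v + norm w)) + norm y" for x u v w y :: complex
      using norm_triangle_ineq[of "x + - (u + (v + w))" y] norm_triangle_ineq4[of x "u + (v + w)"]
        norm_triangle_ineq[of u "v + w"] norm_triangle_ineq[of v w]
      unfolding add_uminus_conv_diff by linarith
    have "norm (2 * of_real pi * \<i> * (s 0 * P 0)) \<le> norm (contour_integral rt (\<lambda>z. s z * P z / z - \<phi> z)) +
        (norm (contour_integral p1 \<phi>) + (norm (contour_integral p2 \<phi>) + norm (contour_integral p3 \<phi>))) +
        norm (contour_integral lt (\<lambda>z. s z * P z / z))"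
      unfolding split by (rule tri)
    also have "\<dots> \<le> 2 * C / R\<^sup>2 * R * (pi / 2 - (-pi/2)) + (B * \<eta> + (2 * R * B * real N powr (-\<eta>) + B * \<eta>)) +
        (2 * C / R\<^sup>2 + 2 * C / (N * R)) * R * (3 * pi / 2 - pi/2)"
      by (intro add_mono br bl b1 b2 b3)
    also have "\<dots> = 4 * pi * C / R + 2 * pi * C / N + 2 * B * \<eta> + 2 * R * B * real N powr (-\<eta>)"
      using R N by (simp add: field_simps power2_eq_square)
    finally have "norm (2 * of_real pi * \<i> * (s 0 * P 0)) \<le> 4 * pi * C / R + 2 * pi * C / N + 2 * B * \<eta> + 2 * R * B * real N powr (-\<eta>)" .
    moreover have "s 0 = (\<Sum>n\<in>{1..N}. a n / of_nat n)"
      unfolding s_def by (intro sum.cong) (auto simp: powr_minus_divide)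
    ultimately show ?thesis
      by (simp add: P0 norm_mult)
  qed
  show ?thesis
    using main \<open>\<eta>1 > 0\<close> by blast
qed

lemma newman_tauberian_zero:
  fixes a :: "nat \<Rightarrow> complex" and g :: "complex \<Rightarrow> complex"
  assumes C: "\<And>n. norm (a n) \<le> C"
    and U: "open U" "{z. Re z \<ge> 0} \<subseteq> U" and g: "g holomorphic_on U" and g0: "g 0 = 0"
    and sums: "\<And>z. Re z > 0 \<Longrightarrow> (\<lambda>n. a (Suc n) * of_nat (Suc n) powr (-1-z)) sums g z"
  shows "(\<lambda>N. \<Sum>n\<in>{1..N}. a n / of_nat n) \<longlonglongrightarrow> 0"
proof (rule tendstoI)
  fix \<epsilon> :: real assume \<epsilon>: "\<epsilon> > 0"
  have C0: "C \<ge> 0" using C[of 0] norm_ge_zero order_trans by blast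
  \<comment> \<open>The bound has four terms. R makes the first at most \<epsilon>; \<eta>, chosen
    afterwards because B depends on R, does so for the third; the other two tend to 0 in N. The
    total 3 \<epsilon> stays below 2 pi \<epsilon>.\<close>
  define R where "R = 4 * pi * (C + 1) / \<epsilon>"
  have R: "R > 0" using C0 \<epsilon> by (auto simp: R_def intro!: divide_pos_pos mult_pos_pos)
  obtain B \<eta>1 where B: "\<eta>1 > 0" "\<And>\<eta> N. 0 < \<eta> \<Longrightarrow> \<eta> \<le> \<eta>1 \<Longrightarrow> N \<ge> 1 \<Longrightarrow>
           2 * pi * norm (\<Sum>n\<in>{1..N}. a n / of_nat n) \<le>
             4 * pi * C / R + 2 * pi * C / N + 2 * B * \<eta> + 2 * R * B * real N powr (-\<eta>)"
    using newman_bound[OF C U g g0 sums R] by blast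
  define \<eta> where "\<eta> = min \<eta>1 (\<epsilon> / (2 * (\<bar>B\<bar> + 1)))"
  have \<eta>: "0 < \<eta>" "\<eta> \<le> \<eta>1" using B(1) \<epsilon> by (auto simp: \<eta>_def)
  have "2 * B * \<eta> \<le> 2 * (\<bar>B\<bar> + 1) * \<eta>" using \<eta> by (intro mult_right_mono) auto
  also have "\<dots> \<le> 2 * (\<bar>B\<bar> + 1) * (\<epsilon> / (2 * (\<bar>B\<bar> + 1)))"
    by (intro mult_left_mono) (auto simp: \<eta>_def)
  also have "\<dots> = \<epsilon>" by simp
  finally have b\<eta>: "2 * B * \<eta> \<le> \<epsilon>" .
  have bR: "4 * pi * C / R \<le> \<epsilon>"
  proof -
    have "4 * pi * C / R = \<epsilon> * (C / (C + 1))" by (simp add: R_def)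
    also have "\<dots> \<le> \<epsilon> * 1" using C0 \<epsilon> by (intro mult_left_mono) auto
    finally show ?thesis by simp
  qed
  have "(\<lambda>N. 2 * pi * C / real N + 2 * R * B * real N powr (-\<eta>)) \<longlonglongrightarrow> 0 + 2 * R * B * 0"
    using \<eta> by (intro tendsto_add tendsto_mult_left lim_const_over_n tendsto_neg_powr filterlim_real_sequentially) auto
  then have "((\<lambda>N. 2 * pi * C / real N + 2 * R * B * real N powr (-\<eta>)) \<longlongrightarrow> 0) sequentially"
    by simp
  then have "\<forall>\<^sub>F N in sequentially. 2 * pi * C / real N + 2 * R * B * real N powr (-\<eta>) < \<epsilon>"
    using \<epsilon> by (rule order_tendstoD)
  then show "\<forall>\<^sub>F N in sequentially. dist (\<Sum>n\<in>{1..N}. a n / of_nat n) 0 < \<epsilon>"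
    using eventually_ge_at_top[of 1]
  proof eventually_elim
    case (elim N)
    have "2 * pi * norm (\<Sum>n\<in>{1..N}. a n / of_nat n) < 2 * pi * \<epsilon>"
    proof -
      have "2 * pi * norm (\<Sum>n\<in>{1..N}. a n / of_nat n) < 3 * \<epsilon>"
        using B(2)[OF \<eta> elim(2)] elim b\<eta> bR by linarith
      also have "\<dots> \<le> 2 * pi * \<epsilon>" using pi_gt3 \<epsilon> by (intro mult_right_mono) auto
      finally show ?thesis .
    qed
    then show ?case by (simp add: mult_less_cancel_left)
  qed
qed

theorem newman_tauberian:
  fixes a :: "nat \<Rightarrow> complex" and g :: "complex \<Rightarrow> complex"
  assumes C: "\<And>n. norm (a n) \<le> C"
    and U: "open U" "{z. Re z \<ge> 0} \<subseteq> U" and g: "g holomorphic_on U"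
    and sums: "\<And>z. Re z > 0 \<Longrightarrow> (\<lambda>n. a (Suc n) * of_nat (Suc n) powr (-1-z)) sums g z"
  shows "(\<lambda>n. a (Suc n) / of_nat (Suc n)) sums g 0"
proof -
  \<comment> \<open>Since 1 powr w = 1, lowering the first coefficient by \<open>g 0\<close>
    subtracts the constant \<open>g 0\<close> from the transform, which reduces the claim to a
    transform vanishing at 0.\<close>
  define b where "b = (\<lambda>n. if n = 1 then a 1 - g 0 else a n)"
  have lim: "(\<lambda>N. \<Sum>n\<in>{1..N}. b n / of_nat n) \<longlonglongrightarrow> 0"
  proof (rule newman_tauberian_zero[OF _ U])
    show "norm (b n) \<le> C + norm (g 0)" for n
      using C[of n] norm_triangle_ineq4[of "a 1" "g 0"] C[of 1] by (auto simp: b_def add_increasing2)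
    show "(\<lambda>z. g z - g 0) holomorphic_on U" by (intro holomorphic_intros g)
    fix z assume "Re z > 0"
    from sums[OF this] have "(\<lambda>n. a (Suc n) * of_nat (Suc n) powr (-1-z) - (if n = 0 then g 0 else 0)) sums (g z - g 0)"
      by (rule sums_diff) (rule sums_single)
    then show "(\<lambda>n. b (Suc n) * of_nat (Suc n) powr (-1-z)) sums (g z - g 0)"
      by (rule back_subst[of "\<lambda>f. f sums (g z - g 0)"]) (auto simp: b_def fun_eq_iff)
  qed auto
  have "(\<lambda>n. b (Suc n) / of_nat (Suc n)) sums 0"
    using lim unfolding sums_def by (simp add: sum.atLeast1_atMost_eq)
  then have "(\<lambda>n. b (Suc n) / of_nat (Suc n) + (if n = 0 then g 0 else 0)) sums (0 + g 0)"
    by (rule sums_add) (rule sums_single)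
  also have "(\<lambda>n. b (Suc n) / of_nat (Suc n) + (if n = 0 then g 0 else 0)) = (\<lambda>n. a (Suc n) / of_nat (Suc n))"
    by (auto simp: b_def fun_eq_iff)
  finally show ?thesis by simp
qed

section \<open>The zeta function on the line of real part one\<close>

text \<open>
  The \<open>n\<close>-th term of \<open>(s - 1) \<zeta>(s)\<close>, corrected by a telescoping difference so that the series
  converges for \<open>Re s > 0\<close>. Since \<open>0 powr z = 0\<close>, the term for \<open>n = 0\<close> is \<open>1\<close>, and Dirichlet series
  can be summed over all natural numbers.
\<close>

definition zeta_diff :: "nat \<Rightarrow> complex \<Rightarrow> complex" where
  "zeta_diff n s = (s - 1) * of_nat n powr (-s) + of_nat (Suc n) powr (1 - s) - of_nat n powr (1 - s)"

text \<open>With f(x) = x^(1-s), \<open>zeta_diff n s\<close> is f(n + 1) - f(n) - f'(n), a Taylor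
  remainder of second order; this gains one power of n over the terms of the Dirichlet
  series.\<close>

lemma norm_zeta_diff_le:
  assumes n: "n \<ge> 1" and s: "Re s \<ge> -1"
  shows "norm (zeta_diff n s) \<le> norm (s - 1) * norm s * real n powr (-Re s - 1)"
proof -
  define S where "S = closed_segment (of_nat n :: complex) (of_nat (Suc n))"
  define f :: "nat \<Rightarrow> complex \<Rightarrow> complex" where
    "f = (\<lambda>i x. if i = 0 then x powr (1 - s) else if i = 1 then (1 - s) * x powr (-s)
             else (1 - s) * (-s * x powr (-s - 1)))"
  have S: "\<exists>t. x = of_real t \<and> real n \<le> t" if "x \<in> S" for x
  proof -
    from that obtain u where u: "0 \<le> u" "x = (1 - u) *\<^sub>R of_nat n + u *\<^sub>R of_nat (Suc n)"
      by (auto simp: S_def closed_segment_def)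
    then have "x = of_real (real n + u)"
      by (simp add: scaleR_conv_of_real algebra_simps)
    then show ?thesis using u by (intro exI[of _ "real n + u"]) auto
  qed
  have "cmod (f 0 (of_nat (Suc n)) - (\<Sum>i\<le>1. f i (of_nat n) * (of_nat (Suc n) - of_nat n) ^ i / (fact i)))
          \<le> (norm (s - 1) * norm s * real n powr (-Re s - 1)) * cmod (of_nat (Suc n) - of_nat n)^(Suc 1) / fact 1"
  proof (rule complex_Taylor)
    show "convex S" by (simp add: S_def)
    fix x assume x: "x \<in> S"
    then obtain t where t: "x = of_real t" "real n \<le> t" using S by blast
    have t0: "t > 0" using t n by auto
    have xnp: "x \<notin> \<real>\<^sub>\<le>\<^sub>0" using t t0 by (auto simp: complex_nonpos_Reals_iff)
    show "(f i has_field_derivative f (Suc i) x) (at x within S)" if "i \<le> 1" for i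
    proof (cases "i = 0")
      case True
      show ?thesis unfolding f_def True
        using xnp by (auto intro!: derivative_eq_intros)
    next
      case False
      then have "i = 1" using that by simp
      show ?thesis unfolding f_def \<open>i = 1\<close>
        using xnp by (auto intro!: derivative_eq_intros)
    qed
    have "norm (x powr (-s - 1)) = t powr (-Re s - 1)"
      using t t0 by (simp add: norm_powr_real_powr)
    also have "\<dots> \<le> real n powr (-Re s - 1)"
      using t n s by (intro powr_mono2') auto
    finally have "norm (1 - s) * norm s * norm (x powr (-s - 1)) \<le> norm (1 - s) * norm s * real n powr (-Re s - 1)"
      by (intro mult_left_mono) auto
    then show "cmod (f (Suc 1) x) \<le> norm (s - 1) * norm s * real n powr (-Re s - 1)"
      by (simp add: f_def norm_mult norm_minus_commute mult.assoc)
  qed (auto simp: S_def)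
  then show ?thesis
    by (simp add: f_def zeta_diff_def algebra_simps)
qed

text \<open>Local uniform convergence, on a ball of half the distance to the boundary line. The
  weights \<open>e\<close> serve two uses: constant weights for zeta itself, and the Chebyshev
  function with growth exponent 1.\<close>

lemma zeta_diff_series:
  fixes e :: "nat \<Rightarrow> complex"
  assumes e: "\<And>n. n \<ge> 1 \<Longrightarrow> norm (e n) \<le> C * real n powr \<kappa>" and \<kappa>: "\<kappa> \<ge> -1"
  shows "(\<lambda>s. \<Sum>n. e n * zeta_diff n s) holomorphic_on {s. Re s > \<kappa>}"
    and "\<And>s. Re s > \<kappa> \<Longrightarrow> summable (\<lambda>n. e n * zeta_diff n s)"
proof -
  have C0: "C \<ge> 0" using order_trans[OF norm_ge_zero e[of 1]] by simp
  have op: "open {s. Re s > \<kappa>}" by (rule open_halfspace_Re_gt)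
  have hol: "(\<lambda>s. e n * zeta_diff n s) holomorphic_on UNIV" for n
    unfolding zeta_diff_def by (intro holomorphic_intros)
  have "\<exists>g g'. \<forall>x\<in>{s. Re s > \<kappa>}. ((\<lambda>n. e n * zeta_diff n x) sums g x) \<and>
          ((\<lambda>n. deriv (\<lambda>s. e n * zeta_diff n s) x) sums g' x) \<and> (g has_field_derivative g' x) (at x)"
  proof (rule series_and_derivative_comparison_local[OF op])
    show "((\<lambda>s. e n * zeta_diff n s) has_field_derivative deriv (\<lambda>s. e n * zeta_diff n s) x) (at x)" for n x
      using hol[of n] by (intro holomorphic_derivI[of _ UNIV]) auto
    fix x assume x: "x \<in> {s. Re s > \<kappa>}"
    define d where "d = (Re x - \<kappa>) / 2"
    have d: "d > 0" using x by (simp add: d_def)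
    define h where "h = (\<lambda>n. C * (norm x + d + 1) * (norm x + d) * real n powr (-1 - d))"
    have "summable h"
      unfolding h_def using d by (intro summable_mult) (simp add: summable_real_powr_iff)
    moreover have "\<forall>\<^sub>F n in sequentially. \<forall>y\<in>ball x d \<inter> {s. Re s > \<kappa>}. norm (e n * zeta_diff n y) \<le> h n"
      using eventually_ge_at_top[of 1]
    proof eventually_elim
      case (elim n)
      show ?case
      proof
        fix y assume y: "y \<in> ball x d \<inter> {s. Re s > \<kappa>}"
        have 0: "norm (y - x) < d" using y by (simp add: dist_norm norm_minus_commute)
        have ny: "norm y \<le> norm x + d" using 0 norm_triangle_ineq2[of y x] by linarith
        have ny1: "norm (y - 1) \<le> norm x + d + 1" using ny norm_triangle_ineq4[of y 1] by simp
        have "Re x - Re y \<le> norm (y - x)" using abs_Re_le_cmod[of "y - x"] by simp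
        then have ry: "Re y \<ge> \<kappa> + d" using 0 by (simp add: d_def field_simps)
        have "norm (e n * zeta_diff n y) \<le> (C * real n powr \<kappa>) * (norm (y - 1) * norm y * real n powr (-Re y - 1))"
          unfolding norm_mult using elim ry \<kappa> d by (intro mult_mono e norm_zeta_diff_le) (auto simp: C0)
        also have "\<dots> \<le> (C * real n powr \<kappa>) * ((norm x + d + 1) * (norm x + d) * real n powr (-(\<kappa> + d) - 1))"
          using elim ry ny ny1 C0 d by (intro mult_left_mono mult_mono powr_mono) auto
        also have "\<dots> = C * (norm x + d + 1) * (norm x + d) * (real n powr \<kappa> * real n powr (-(\<kappa> + d) - 1))"
          by (simp add: algebra_simps)
        also have "real n powr \<kappa> * real n powr (-(\<kappa> + d) - 1) = real n powr (-1 - d)"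
          unfolding powr_add [symmetric] by (rule arg_cong[of _ _ "\<lambda>t. real n powr t"]) simp
        finally show "norm (e n * zeta_diff n y) \<le> h n" by (simp add: h_def)
      qed
    qed
    ultimately show "\<exists>d h. 0 < d \<and> summable h \<and> (\<forall>\<^sub>F n in sequentially. \<forall>y\<in>ball x d \<inter> {s. Re s > \<kappa>}. norm (e n * zeta_diff n y) \<le> h n)"
      using d by blast
  qed
  then obtain g g' where g: "\<And>x. Re x > \<kappa> \<Longrightarrow> (\<lambda>n. e n * zeta_diff n x) sums g x" "\<And>x. Re x > \<kappa> \<Longrightarrow> (g has_field_derivative g' x) (at x)"
    by blast
  show "summable (\<lambda>n. e n * zeta_diff n s)" if "Re s > \<kappa>" for s
    using g(1)[OF that] by (auto simp: sums_iff)
  have "g holomorphic_on {s. Re s > \<kappa>}"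
    using g(2) op by (auto simp: holomorphic_on_open)
  then show "(\<lambda>s. \<Sum>n. e n * zeta_diff n s) holomorphic_on {s. Re s > \<kappa>}"
    by (rule holomorphic_transform) (use g(1) in \<open>auto simp: sums_iff\<close>)
qed

lemma summable_dirichlet:
  fixes e :: "nat \<Rightarrow> complex"
  assumes e: "\<And>n. n \<ge> 1 \<Longrightarrow> norm (e n) \<le> C * real n powr \<kappa>" and s: "Re s > \<kappa> + 1"
  shows "summable (\<lambda>n. norm (e n * of_nat n powr (-s)))"
proof (rule summable_comparison_test_ev)
  show "\<forall>\<^sub>F n in sequentially. norm (norm (e n * of_nat n powr (-s))) \<le> C * real n powr (\<kappa> - Re s)"
    using eventually_ge_at_top[of 1]
  proof eventually_elim
    case (elim n)
    have "norm (e n * of_nat n powr (-s)) \<le> (C * real n powr \<kappa>) * real n powr (-Re s)"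
      unfolding norm_mult using elim by (intro mult_mono e) (auto simp: norm_powr_real_powr intro: order_trans[OF _ e])
    then show ?case using elim by (simp add: powr_diff powr_minus field_simps)
  qed
  show "summable (\<lambda>n. C * real n powr (\<kappa> - Re s))"
    using s by (intro summable_mult) (simp add: summable_real_powr_iff)
qed

text \<open>The function (s - 1) zeta(s), continued to Re s > 0. It is regular at 1, so the
  arguments on the line Re s = 1 can be carried out with it.\<close>

definition zeta_res :: "complex \<Rightarrow> complex" where
  "zeta_res s = (\<Sum>n. zeta_diff n s)"

lemma holomorphic_zeta_res: "zeta_res holomorphic_on {s. Re s > 0}"
  and summable_zeta_res: "\<And>s. Re s > 0 \<Longrightarrow> summable (\<lambda>n. zeta_diff n s)"
proof -
  have 1: "norm (1::complex) \<le> 1 * real n powr 0" if "n \<ge> 1" for n using that by simp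
  from zeta_diff_series[OF this] show "zeta_res holomorphic_on {s. Re s > 0}"
    "\<And>s. Re s > 0 \<Longrightarrow> summable (\<lambda>n. zeta_diff n s)"
    by (simp_all add: zeta_res_def [abs_def])
qed

lemma zeta_res_1: "zeta_res 1 = 1"
proof -
  have "zeta_diff n 1 = (if n = 0 then 1 else 0)" for n
    by (auto simp: zeta_diff_def simp del: of_nat_Suc)
  then show ?thesis using sums_unique[OF sums_single[of 0 "\<lambda>_. 1::complex"]] by (simp add: zeta_res_def)
qed

lemma summable_zeta: "Re s > 1 \<Longrightarrow> summable (\<lambda>n. norm (of_nat n powr (-s) :: complex))"
  using summable_dirichlet[of "\<lambda>_. 1" 1 0 s] by simp

text \<open>The corrections telescope to N^(1-s), which tends to 0 when Re s > 1.\<close>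

lemma zeta_res_eq:
  assumes "Re s > 1"
  shows "zeta_res s = (s - 1) * (\<Sum>n. of_nat n powr (-s))"
proof -
  have "(\<lambda>N. \<Sum>n<N. zeta_diff n s) \<longlonglongrightarrow> zeta_res s"
    using summable_zeta_res[of s] assms summable_LIMSEQ unfolding zeta_res_def by auto
  moreover have "(\<Sum>n<N. zeta_diff n s) = (s - 1) * (\<Sum>n<N. of_nat n powr (-s)) + of_nat N powr (1 - s)" for N
    by (induction N) (simp_all add: zeta_diff_def algebra_simps)
  moreover have "(\<lambda>N. (s - 1) * (\<Sum>n<N. of_nat n powr (-s)) + of_nat N powr (1 - s)) \<longlonglongrightarrow> (s - 1) * (\<Sum>n. of_nat n powr (-s)) + 0"
  proof (intro tendsto_intros summable_LIMSEQ summable_norm_cancel[OF summable_zeta[OF assms]])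
    show "(\<lambda>N. of_nat N powr (1 - s) :: complex) \<longlonglongrightarrow> 0"
      using assms by (intro tendsto_neg_powr_complex_of_nat filterlim_ident) auto
  qed
  ultimately show ?thesis using LIMSEQ_unique by fastforce
qed

section \<open>Logarithmic derivative of zeta and its zeros\<close>

definition ln_dirichlet :: "complex \<Rightarrow> complex" where
  "ln_dirichlet s = (\<Sum>n. of_real (ln (real n)) * of_nat n powr (-s))"

definition mangoldt_dirichlet :: "complex \<Rightarrow> complex" where
  "mangoldt_dirichlet s = (\<Sum>n. mangoldt n * of_nat n powr (-s))"

lemma has_field_derivative_zeta:
  assumes "Re s > 1"
  shows "((\<lambda>s. \<Sum>n. of_nat n powr (-s) :: complex) has_field_derivative -ln_dirichlet s) (at s)"
    "summable (\<lambda>n. of_real (ln (real n)) * of_nat n powr (-s) :: complex)"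
proof -
  have op: "open {s. Re s > 1}" by (rule open_halfspace_Re_gt)
  have "\<exists>g g'. \<forall>x\<in>{s. Re s > 1}. ((\<lambda>n. of_nat n powr (-x)) sums g x) \<and>
          ((\<lambda>n. -(of_real (ln (real n)) * of_nat n powr (-x))) sums g' x) \<and> (g has_field_derivative g' x) (at x)"
  proof (rule series_and_derivative_comparison_local[OF op])
    show "((\<lambda>s. of_nat n powr (-s) :: complex) has_field_derivative -(of_real (ln (real n)) * of_nat n powr (-x))) (at x)" for n x
    proof (cases "n = 0")
      case False
      have "((\<lambda>z. of_nat n powr z :: complex) has_field_derivative Ln (of_nat n) * of_nat n powr (-x)) (at (-x))"
        using False by (intro has_field_derivative_powr_right) auto
      from DERIV_chain2[OF this DERIV_minus[OF DERIV_ident]] show ?thesis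
        using False by (simp add: Ln_of_nat)
    qed auto
    fix x assume x: "x \<in> {s. Re s > 1}"
    define d where "d = (Re x - 1) / 2"
    have d: "d > 0" using x by (simp add: d_def)
    have "summable (\<lambda>n. real n powr (-1 - d))"
      using d by (simp add: summable_real_powr_iff)
    moreover have "\<forall>\<^sub>F n in sequentially. \<forall>y\<in>ball x d \<inter> {s. Re s > 1}. norm (of_nat n powr (-y) :: complex) \<le> real n powr (-1 - d)"
      using eventually_ge_at_top[of 1]
    proof eventually_elim
      case (elim n)
      show ?case
      proof
        fix y assume y: "y \<in> ball x d \<inter> {s. Re s > 1}"
        have "norm (y - x) < d" using y by (simp add: dist_norm norm_minus_commute)
        moreover have "Re x - Re y \<le> norm (y - x)" using abs_Re_le_cmod[of "y - x"] by simp
        ultimately have "Re y \<ge> 1 + d" by (simp add: d_def field_simps)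
        then show "norm (of_nat n powr (-y) :: complex) \<le> real n powr (-1 - d)"
          using elim by (auto simp: norm_powr_real_powr intro!: powr_mono)
      qed
    qed
    ultimately show "\<exists>d h. 0 < d \<and> summable h \<and> (\<forall>\<^sub>F n in sequentially. \<forall>y\<in>ball x d \<inter> {s. Re s > 1}. norm (of_nat n powr (-y) :: complex) \<le> h n)"
      using d by blast
  qed
  then obtain g g' where g: "\<And>x. Re x > 1 \<Longrightarrow> (\<lambda>n. of_nat n powr (-x)) sums g x"
    "\<And>x. Re x > 1 \<Longrightarrow> (\<lambda>n. -(of_real (ln (real n)) * of_nat n powr (-x))) sums g' x"
    "\<And>x. Re x > 1 \<Longrightarrow> (g has_field_derivative g' x) (at x)"
    by blast
  have 1: "(\<lambda>n. of_real (ln (real n)) * of_nat n powr (-s)) sums (- g' s)"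
    using sums_minus[OF g(2)[OF assms]] by simp
  then show "summable (\<lambda>n. of_real (ln (real n)) * of_nat n powr (-s) :: complex)" by (auto simp: sums_iff)
  from 1 have "-ln_dirichlet s = g' s" by (simp add: ln_dirichlet_def sums_iff)
  moreover have "((\<lambda>s. \<Sum>n. of_nat n powr (-s) :: complex) has_field_derivative g' s) (at s)"
    by (rule has_field_derivative_transform_within_open[OF g(3)[OF assms] op])
      (use assms g(1) in \<open>auto simp: sums_iff\<close>)
  ultimately show "((\<lambda>s. \<Sum>n. of_nat n powr (-s) :: complex) has_field_derivative -ln_dirichlet s) (at s)" by simp
qed

lemma summable_mangoldt_dirichlet:
  assumes "Re s > 1"
  shows "summable (\<lambda>n. norm (mangoldt n * of_nat n powr (-s) :: complex))"
proof (rule summable_dirichlet)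
  define \<kappa> where "\<kappa> = (Re s - 1) / 2"
  have \<kappa>: "\<kappa> > 0" using assms by (simp add: \<kappa>_def)
  show "Re s > \<kappa> + 1" using assms by (simp add: \<kappa>_def field_simps)
  fix n :: nat assume n: "n \<ge> 1"
  have "norm (mangoldt n :: complex) \<le> ln (real n)"
    using n by (simp add: mangoldt_le)
  also have "\<dots> \<le> real n powr \<kappa> / \<kappa>" using n \<kappa> by (intro ln_powr_bound) auto
  finally show "norm (mangoldt n :: complex) \<le> 1 / \<kappa> * real n powr \<kappa>" by simp
qed

text \<open>This is D = -zeta' / zeta in product form. Absolute convergence over pairs (d, m) allows
  regrouping by n = d m, where the Mangoldt values of the divisors add up to ln n.\<close>

lemma mangoldt_convolution:
  assumes s: "Re s > 1"
  shows "mangoldt_dirichlet s * (\<Sum>n. of_nat n powr (-s)) = ln_dirichlet s"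
proof -
  define a :: "nat \<Rightarrow> complex" where "a = (\<lambda>n. mangoldt n * of_nat n powr (-s))"
  define b :: "nat \<Rightarrow> complex" where "b = (\<lambda>n. of_nat n powr (-s))"
  define A where "A = mangoldt_dirichlet s"
  define B where "B = (\<Sum>n. b n)"
  have na: "summable (\<lambda>n. norm (a n))" using summable_mangoldt_dirichlet[OF s] by (simp add: a_def)
  have nb: "summable (\<lambda>n. norm (b n))" using summable_zeta[OF s] by (simp add: b_def)
  have ha: "(a has_sum A) UNIV"
    using norm_summable_imp_has_sum[OF na] summable_sums[OF summable_norm_cancel[OF na]]
    by (simp add: A_def mangoldt_dirichlet_def a_def)
  have hb: "(b has_sum B) UNIV"
    using norm_summable_imp_has_sum[OF nb] summable_sums[OF summable_norm_cancel[OF nb]]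
    by (simp add: B_def)
  have hnb: "((\<lambda>n. norm (b n)) has_sum (\<Sum>n. norm (b n))) UNIV"
    using sums_nonneg_imp_has_sum[OF summable_sums[OF nb]] by simp
  have hna: "((\<lambda>n. norm (a n)) has_sum (\<Sum>n. norm (a n))) UNIV"
    using sums_nonneg_imp_has_sum[OF summable_sums[OF na]] by simp
  have "(\<lambda>x. norm (a (fst x) * b (snd x))) summable_on (UNIV \<times> UNIV)"
  proof (rule summable_on_SigmaI)
    show "((\<lambda>y. norm (a (fst (x, y)) * b (snd (x, y)))) has_sum (norm (a x) * (\<Sum>n. norm (b n)))) UNIV" for x
      unfolding fst_conv snd_conv norm_mult by (intro has_sum_cmult_right hnb)
    show "(\<lambda>x. norm (a x) * (\<Sum>n. norm (b n))) summable_on UNIV"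
      using has_sum_cmult_left[OF hna] by (auto simp: summable_on_def)
  qed auto
  then have sm: "(\<lambda>x. a (fst x) * b (snd x)) summable_on (UNIV \<times> UNIV)"
    by (rule abs_summable_summable)
  have "((\<lambda>x. a (fst x) * b (snd x)) has_sum (A * B)) (UNIV \<times> UNIV)"
  proof (rule has_sum_SigmaI[OF _ _ sm])
    show "((\<lambda>y. a (fst (x, y)) * b (snd (x, y))) has_sum (a x * B)) UNIV" for x
      unfolding fst_conv snd_conv by (intro has_sum_cmult_right hb)
    show "((\<lambda>x. a x * B) has_sum (A * B)) UNIV" by (intro has_sum_cmult_left ha)
  qed
  \<comment> \<open>Pairs with a zero entry contribute nothing because \<open>0 powr z = 0\<close>;
    they go before the regrouping, since infinitely many pairs have the product 0.\<close>
  also have "?this \<longleftrightarrow> ((\<lambda>x. a (fst x) * b (snd x)) has_sum (A * B)) ({0<..} \<times> {0<..})"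
    by (rule has_sum_cong_neutral) (auto simp: a_def b_def)
  also have "\<dots> \<longleftrightarrow> ((\<lambda>x. a (snd x) * b (fst x div snd x)) has_sum (A * B)) (SIGMA n:{0<..}. {d. d dvd n})"
    by (rule has_sum_reindex_bij_witness[of _ "\<lambda>(n,d). (d, n div d)" "\<lambda>(d,m). (d * m, d)"])
      (auto simp: dvd_div_eq_0_iff dest: dvd_pos_nat)
  finally have "((\<lambda>n. of_real (ln (real n)) * of_nat n powr (-s)) has_sum (A * B)) {0<..}"
  proof (rule has_sum_SigmaD)
    fix n :: nat assume "n \<in> {0<..}"
    then have n: "n > 0" by simp
    have "(\<Sum>d | d dvd n. a d * b (n div d)) = (\<Sum>d | d dvd n. mangoldt d * of_nat n powr (-s))"
    proof (rule sum.cong)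
      fix d assume "d \<in> {d. d dvd n}"
      then obtain m where m: "n = d * m" by auto
      with n have "d > 0" "m > 0" by auto
      then show "a d * b (n div d) = mangoldt d * of_nat n powr (-s)"
        by (simp add: a_def b_def m powr_times_real)
    qed auto
    also have "\<dots> = of_real (ln (real n)) * of_nat n powr (-s)"
      using n mangoldt_sum[of n, where ?'a = complex] by (simp add: sum_distrib_right [symmetric])
    finally show "((\<lambda>d. a (snd (n, d)) * b (fst (n, d) div snd (n, d))) has_sum (of_real (ln (real n)) * of_nat n powr (-s))) {d. d dvd n}"
      using n by (simp add: has_sum_finite_iff)
  qed
  also have "?this \<longleftrightarrow> ((\<lambda>n. of_real (ln (real n)) * of_nat n powr (-s)) has_sum (A * B)) UNIV"
    by (rule has_sum_cong_neutral) auto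
  finally have "(\<lambda>n. of_real (ln (real n)) * of_nat n powr (-s)) sums (A * B)"
    by (rule has_sum_imp_sums)
  then show ?thesis by (simp add: A_def B_def b_def ln_dirichlet_def sums_iff)
qed

text \<open>Stated without dividing by \<open>zeta_res s\<close>, so that it can be used to prove
  that \<open>zeta_res s\<close> does not vanish.\<close>

lemma deriv_zeta_res:
  assumes s: "Re s > 1"
  shows "deriv zeta_res s = zeta_res s * (1 / (s - 1) - mangoldt_dirichlet s)"
proof -
  have op: "open {s. Re s > 1}" by (rule open_halfspace_Re_gt)
  let ?Z = "\<lambda>s. (\<Sum>n. of_nat n powr (-s)) :: complex"
  have "((\<lambda>s. (s - 1) * ?Z s) has_field_derivative (?Z s + (s - 1) * (- ln_dirichlet s))) (at s)"
    by (rule derivative_eq_intros has_field_derivative_zeta[OF s] refl)+ simp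
  then have "(zeta_res has_field_derivative (?Z s + (s - 1) * (- ln_dirichlet s))) (at s)"
    by (rule has_field_derivative_transform_within_open[OF _ op]) (use s zeta_res_eq in auto)
  have aux: "u \<noteq> 0 \<Longrightarrow> u * z * (1 / u - D) = z + u * (- (D * z))" for u z D :: complex
    by (simp add: field_simps)
  from \<open>(zeta_res has_field_derivative _) _\<close> have "deriv zeta_res s = ?Z s + (s - 1) * (- ln_dirichlet s)" by (rule DERIV_imp_deriv)
  moreover have "s \<noteq> 1" using s by auto
  ultimately show ?thesis
    unfolding mangoldt_convolution[OF s, symmetric] zeta_res_eq[OF s] by (simp add: aux)
qed

text \<open>The number m is the order of vanishing at \<open>z0\<close>, read off from the
  factorisation (z - z0)^m g(z); the order is finite because \<open>zeta_res 1 = 1\<close> excludes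
  the zero function.\<close>

lemma logderiv_zeta_res_tendsto:
  assumes "Re z0 > 0"
  shows "\<exists>m::nat. (m = 0 \<longleftrightarrow> zeta_res z0 \<noteq> 0) \<and> ((\<lambda>z. (z - z0) * deriv zeta_res z / zeta_res z) \<longlongrightarrow> of_nat m) (at z0)"
proof (cases "zeta_res z0 = 0")
  case False
  have op: "open {s. Re s > 0}" by (rule open_halfspace_Re_gt)
  have "(zeta_res \<longlongrightarrow> zeta_res z0) (at z0)" "(deriv zeta_res \<longlongrightarrow> deriv zeta_res z0) (at z0)"
    using holomorphic_zeta_res holomorphic_deriv[OF holomorphic_zeta_res op] assms op
    by (auto simp: isCont_def [symmetric] continuous_on_eq_continuous_at dest!: holomorphic_on_imp_continuous_on)
  then have "((\<lambda>z. (z - z0) * deriv zeta_res z / zeta_res z) \<longlongrightarrow> (z0 - z0) * deriv zeta_res z0 / zeta_res z0) (at z0)"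
    using False by (intro tendsto_intros)
  then show ?thesis using False by (intro exI[of _ 0]) auto
next
  case True
  have op: "open {s. Re s > 0}" by (rule open_halfspace_Re_gt)
  have conn: "connected {s. Re s > 0}" by (intro convex_connected convex_halfspace_Re_gt)
  have z0in: "z0 \<in> {s. Re s > 0}" using assms by simp
  have "\<not> zeta_res constant_on {s. Re s > 0}"
    using True assms zeta_res_1 unfolding constant_on_def by force
  then obtain g r n where n: "0 < n" "0 < r" "ball z0 r \<subseteq> {s. Re s > 0}" "g holomorphic_on ball z0 r"
      "\<And>w. w \<in> ball z0 r \<Longrightarrow> zeta_res w = (w - z0) ^ n * g w" "\<And>w. w \<in> ball z0 r \<Longrightarrow> g w \<noteq> 0"
    by (rule holomorphic_factor_zero_nonconstant[OF holomorphic_zeta_res op conn z0in True]) (rule that; assumption)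
  have eq: "(z - z0) * deriv zeta_res z / zeta_res z = of_nat n + (z - z0) * deriv g z / g z"
    if z: "z \<in> ball z0 r" "z \<noteq> z0" for z
  proof -
    have "(g has_field_derivative deriv g z) (at z)"
      using n(4) z by (intro holomorphic_derivI) auto
    then have "((\<lambda>w. (w - z0) ^ n * g w) has_field_derivative (of_nat n * (z - z0) ^ (n - 1) * g z + (z - z0) ^ n * deriv g z)) (at z)"
      by (auto intro!: derivative_eq_intros)
    then have "(zeta_res has_field_derivative (of_nat n * (z - z0) ^ (n - 1) * g z + (z - z0) ^ n * deriv g z)) (at z)"
      by (rule has_field_derivative_transform_within_open[where S = "ball z0 r"]) (use z n in auto)
    then have d: "deriv zeta_res z = of_nat n * (z - z0) ^ (n - 1) * g z + (z - z0) ^ n * deriv g z"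
      by (rule DERIV_imp_deriv)
    have pn: "(z - z0) ^ n = (z - z0) * (z - z0) ^ (n - 1)"
      using n(1) by (simp add: power_eq_if)
    show ?thesis
      unfolding d n(5)[OF z(1)] pn using z n(6)[OF z(1)] by (simp add: field_simps)
  qed
  have "(g \<longlongrightarrow> g z0) (at z0)" "(deriv g \<longlongrightarrow> deriv g z0) (at z0)"
    using n(4) holomorphic_deriv[OF n(4)] n(2)
    by (auto simp: isCont_def [symmetric] continuous_on_eq_continuous_at dest!: holomorphic_on_imp_continuous_on)
  then have "((\<lambda>z. of_nat n + (z - z0) * deriv g z / g z) \<longlongrightarrow> of_nat n + (z0 - z0) * deriv g z0 / g z0) (at z0)"
    using n(6)[of z0] n(2) by (intro tendsto_intros) auto
  then have "((\<lambda>z. of_nat n + (z - z0) * deriv g z / g z) \<longlongrightarrow> of_nat n) (at z0)" by simp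
  then have "((\<lambda>z. (z - z0) * deriv zeta_res z / zeta_res z) \<longlongrightarrow> of_nat n) (at z0)"
    by (rule Lim_transform_within_open[where s = "ball z0 r"]) (use eq n in auto)
  then show ?thesis using n(1) True by auto
qed

lemma filterlim_horizontal_approach:
  "filterlim (\<lambda>x. z0 + of_real x :: complex) (at z0) (at_right 0)"
proof (rule filterlim_atI)
  show "((\<lambda>x. z0 + of_real x) \<longlongrightarrow> z0) (at_right 0)"
    by (auto intro!: tendsto_eq_intros)
  show "\<forall>\<^sub>F x in at_right 0. z0 + of_real x \<noteq> z0"
    using eventually_at_right_less[of "0::real"] by eventually_elim auto
qed

text \<open>
  A zero of order \<open>m\<close> would give the logarithmic derivative \<open>1/(s-1) - D(s)\<close> the residue \<open>m\<close>,
  but the Dirichlet series \<open>D\<close> is bounded near \<open>z0\<close>.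
\<close>

lemma zeta_res_nonzero_half_plane:
  assumes "Re z0 > 1"
  shows "zeta_res z0 \<noteq> 0"
proof -
  obtain m :: nat where m: "m = 0 \<longleftrightarrow> zeta_res z0 \<noteq> 0"
    "((\<lambda>z. (z - z0) * deriv zeta_res z / zeta_res z) \<longlongrightarrow> of_nat m) (at z0)"
    using logderiv_zeta_res_tendsto[of z0] assms by auto
  define M where "M = (\<Sum>n. norm (mangoldt n * of_nat n powr (-z0) :: complex))"
  have lim: "((\<lambda>x. (z0 + of_real x - z0) * deriv zeta_res (z0 + of_real x) / zeta_res (z0 + of_real x)) \<longlongrightarrow> of_nat m) (at_right 0)"
    using filterlim_compose[OF m(2) filterlim_horizontal_approach] .
  have lim2: "((\<lambda>x. (z0 + of_real x - z0) * deriv zeta_res (z0 + of_real x) / zeta_res (z0 + of_real x)) \<longlongrightarrow> 0) (at_right 0)"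
  proof (rule Lim_null_comparison)
    show "((\<lambda>x. x * (1 / (Re z0 - 1) + M)) \<longlongrightarrow> 0) (at_right (0::real))"
      by (auto intro!: tendsto_eq_intros)
    show "\<forall>\<^sub>F x in at_right 0. norm ((z0 + of_real x - z0) * deriv zeta_res (z0 + of_real x) / zeta_res (z0 + of_real x)) \<le> x * (1 / (Re z0 - 1) + M)"
      using eventually_at_right_less[of "0::real"]
    proof eventually_elim
      case (elim x)
      define z where "z = z0 + of_real x"
      have z: "Re z > 1" using elim assms by (simp add: z_def)
      have "norm (mangoldt_dirichlet z) \<le> (\<Sum>n. norm (mangoldt n * of_nat n powr (-z) :: complex))"
        unfolding mangoldt_dirichlet_def by (rule summable_norm[OF summable_mangoldt_dirichlet[OF z]])
      also have "\<dots> \<le> M" unfolding M_def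
      proof (intro suminf_le summable_mangoldt_dirichlet z assms)
        fix n :: nat
        show "norm (mangoldt n * of_nat n powr (-z) :: complex) \<le> norm (mangoldt n * of_nat n powr (-z0) :: complex)"
        proof (cases "n = 0")
          case False
          then show ?thesis using elim unfolding norm_mult
            by (intro mult_left_mono) (auto simp: norm_powr_real_powr z_def mangoldt_nonneg intro!: powr_mono)
        qed auto
      qed
      finally have 1: "norm (mangoldt_dirichlet z) \<le> M" .
      have "Re z0 - 1 \<le> norm (z - 1)" using complex_Re_le_cmod[of "z - 1"] elim by (simp add: z_def)
      then have "norm (1 / (z - 1)) \<le> 1 / (Re z0 - 1)"
        using assms by (simp add: norm_divide divide_simps)
      then have 2: "norm (1 / (z - 1) - mangoldt_dirichlet z) \<le> 1 / (Re z0 - 1) + M"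
        using 1 norm_triangle_ineq4[of "1 / (z - 1)" "mangoldt_dirichlet z"] by linarith
      have "norm ((z - z0) * deriv zeta_res z / zeta_res z) \<le> norm ((z - z0) * (1 / (z - 1) - mangoldt_dirichlet z))"
        unfolding deriv_zeta_res[OF z] by (cases "zeta_res z = 0") simp_all
      also have "\<dots> \<le> x * (1 / (Re z0 - 1) + M)"
        unfolding norm_mult using 2 elim by (simp add: z_def mult_left_mono)
      finally show ?case unfolding z_def .
    qed
  qed
  have "of_nat m = (0 :: complex)"
    by (rule tendsto_unique[OF _ lim lim2]) simp
  then show ?thesis using m(1) by simp
qed

text \<open>Term by term, with \<theta> = t ln n, this is 3 + 4 cos \<theta> + cos 2\<theta> = 2 (1
  + cos \<theta>)^2 \<ge> 0.\<close>

lemma mangoldt_dirichlet_341: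
  assumes x: "x > 1"
  shows "3 * Re (mangoldt_dirichlet (of_real x)) + 4 * Re (mangoldt_dirichlet (of_real x + \<i> * of_real t))
       + Re (mangoldt_dirichlet (of_real x + \<i> * of_real (2 * t))) \<ge> 0"
proof -
  have sm: "(\<lambda>n. Re (mangoldt n * of_nat n powr (-(of_real x + \<i> * of_real u)))) sums Re (mangoldt_dirichlet (of_real x + \<i> * of_real u))" for u
    unfolding mangoldt_dirichlet_def using x
    by (intro sums_Re summable_sums summable_norm_cancel[OF summable_mangoldt_dirichlet]) auto
  have Re_term: "Re (mangoldt n * of_nat n powr (-(of_real x + \<i> * of_real u)) :: complex) = mangoldt n * real n powr (-x) * cos (u * ln (real n))" for n u
  proof (cases "n = 0")
    case False
    have "(of_nat n :: complex) powr (-(of_real x + \<i> * of_real u)) = of_real (real n powr (-x)) * cis (-(u * ln (real n)))"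
    proof -
      have "(of_nat n :: complex) powr (-(of_real x + \<i> * of_real u)) = exp (-(of_real x + \<i> * of_real u) * of_real (ln (real n)))"
        using False by (simp add: powr_def Ln_of_nat)
      also have "\<dots> = exp (of_real (-x * ln (real n)) + \<i> * of_real (-(u * ln (real n))))"
        by (rule arg_cong[of _ _ exp]) (simp add: algebra_simps)
      also have "\<dots> = of_real (exp (-x * ln (real n))) * cis (-(u * ln (real n)))"
        by (simp only: exp_add cis_conv_exp exp_of_real)
      also have "exp (-x * ln (real n)) = real n powr (-x)"
        using False by (simp add: powr_def)
      finally show ?thesis .
    qed
    then have "Re (mangoldt n * of_nat n powr (-(of_real x + \<i> * of_real u)) :: complex) = Re (of_real (mangoldt n * real n powr (-x)) * cis (-(u * ln (real n))))"
      by (simp add: mult.assoc)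
    also have "\<dots> = mangoldt n * real n powr (-x) * cos (u * ln (real n))" by (simp del: of_real_mult)
    finally show ?thesis .
  qed auto
  have S: "(\<lambda>n. 3 * Re (mangoldt n * of_nat n powr (-(of_real x + \<i> * of_real 0))) + 4 * Re (mangoldt n * of_nat n powr (-(of_real x + \<i> * of_real t)))
       + Re (mangoldt n * of_nat n powr (-(of_real x + \<i> * of_real (2 * t))))) sums
      (3 * Re (mangoldt_dirichlet (of_real x + \<i> * of_real 0)) + 4 * Re (mangoldt_dirichlet (of_real x + \<i> * of_real t))
       + Re (mangoldt_dirichlet (of_real x + \<i> * of_real (2 * t))))"
    by (intro sums_add sums_mult sm)
  have nn: "0 \<le> 3 * Re (mangoldt n * of_nat n powr (-(of_real x + \<i> * of_real 0)) :: complex) + 4 * Re (mangoldt n * of_nat n powr (-(of_real x + \<i> * of_real t)) :: complex)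
       + Re (mangoldt n * of_nat n powr (-(of_real x + \<i> * of_real (2 * t))) :: complex)" for n
  proof -
    have "3 + 4 * cos (t * ln (real n)) + cos (2 * t * ln (real n)) = 2 * (1 + cos (t * ln (real n)))\<^sup>2"
      using cos_double_cos[of "t * ln (real n)"] by (simp add: power2_eq_square algebra_simps)
    then have "0 \<le> (mangoldt n * real n powr (-x)) * (3 + 4 * cos (t * ln (real n)) + cos (2 * t * ln (real n)))"
      by (simp add: mangoldt_nonneg)
    moreover have "3 * (c * cos (0 * l)) + 4 * (c * v) + c * w = c * (3 + 4 * v + w)" for c l v w :: real
      by (simp add: algebra_simps)
    ultimately show ?thesis unfolding Re_term by (simp only:)
  qed
  have "0 \<le> 3 * Re (mangoldt_dirichlet (of_real x + \<i> * of_real 0)) + 4 * Re (mangoldt_dirichlet (of_real x + \<i> * of_real t))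
       + Re (mangoldt_dirichlet (of_real x + \<i> * of_real (2 * t)))"
    by (rule sums_le[OF nn sums_zero S])
  then show ?thesis by simp
qed

text \<open>As t is not 0, the summand 1 / (s - 1) of D is regular at 1 + it, so the limit sees only
  the order of the zero; at t = 0 that summand contributes the residue 1.\<close>

lemma mangoldt_dirichlet_residue:
  assumes "t \<noteq> 0"
  obtains m :: nat where "m = 0 \<longleftrightarrow> zeta_res (1 + \<i> * of_real t) \<noteq> 0"
    "((\<lambda>x. x * Re (mangoldt_dirichlet (of_real (1 + x) + \<i> * of_real t))) \<longlongrightarrow> - real m) (at_right 0)"
proof -
  define z0 where "z0 = 1 + \<i> * of_real t"
  obtain m :: nat where m: "m = 0 \<longleftrightarrow> zeta_res z0 \<noteq> 0"
    "((\<lambda>z. (z - z0) * deriv zeta_res z / zeta_res z) \<longlongrightarrow> of_nat m) (at z0)"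
    using logderiv_zeta_res_tendsto[of z0] by (auto simp: z0_def)
  have lim: "((\<lambda>x. (z0 + of_real x - z0) * deriv zeta_res (z0 + of_real x) / zeta_res (z0 + of_real x)) \<longlongrightarrow> of_nat m) (at_right 0)"
    using filterlim_compose[OF m(2) filterlim_horizontal_approach] .
  have lim2: "((\<lambda>x::real. of_real x / (z0 + of_real x - 1)) \<longlongrightarrow> of_real 0 / (z0 + of_real 0 - 1)) (at_right 0)"
    using assms by (intro tendsto_intros) (auto simp: z0_def)
  have "((\<lambda>x::real. of_real x / (z0 + of_real x - 1) - (z0 + of_real x - z0) * deriv zeta_res (z0 + of_real x) / zeta_res (z0 + of_real x)) \<longlongrightarrow> 0 - of_nat m) (at_right 0)"
    by (rule tendsto_diff[OF _ lim]) (use lim2 in simp)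
  from tendsto_Re[OF this] have "((\<lambda>x. Re (of_real x / (z0 + of_real x - 1) - (z0 + of_real x - z0) * deriv zeta_res (z0 + of_real x) / zeta_res (z0 + of_real x))) \<longlongrightarrow> - real m) (at_right 0)"
    by simp
  then have "((\<lambda>x. x * Re (mangoldt_dirichlet (of_real (1 + x) + \<i> * of_real t))) \<longlongrightarrow> - real m) (at_right 0)"
  proof (rule Lim_transform_eventually)
    show "\<forall>\<^sub>F x in at_right 0. Re (of_real x / (z0 + of_real x - 1) - (z0 + of_real x - z0) * deriv zeta_res (z0 + of_real x) / zeta_res (z0 + of_real x))
        = x * Re (mangoldt_dirichlet (of_real (1 + x) + \<i> * of_real t))"
      using eventually_at_right_less[of "0::real"]
    proof eventually_elim
      case (elim x)
      define z where "z = z0 + of_real x"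
      have z: "Re z > 1" "z = of_real (1 + x) + \<i> * of_real t" using elim by (auto simp: z_def z0_def)
      have "of_real x / (z - 1) - of_real x * deriv zeta_res z / zeta_res z = of_real x * mangoldt_dirichlet z"
        unfolding deriv_zeta_res[OF z(1)] using zeta_res_nonzero_half_plane[OF z(1)] by (simp add: field_simps)
      then have "Re (of_real x / (z - 1) - (z - z0) * deriv zeta_res z / zeta_res z) = x * Re (mangoldt_dirichlet z)"
        by (simp add: z_def)
      then show ?case unfolding z(2)[symmetric] by (simp add: z_def)
    qed
  qed
  then show ?thesis using that[of m] m(1) by (simp add: z0_def)
qed

lemma mangoldt_dirichlet_residue_1:
  "((\<lambda>x. x * Re (mangoldt_dirichlet (of_real (1 + x)))) \<longlongrightarrow> 1) (at_right 0)"
proof -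
  obtain m :: nat where m: "m = 0 \<longleftrightarrow> zeta_res 1 \<noteq> 0"
    "((\<lambda>z. (z - 1) * deriv zeta_res z / zeta_res z) \<longlongrightarrow> of_nat m) (at 1)"
    using logderiv_zeta_res_tendsto[of 1] by auto
  have "m = 0" using m(1) zeta_res_1 by simp
  have lim: "((\<lambda>x. 1 - (1 + of_real x - 1) * deriv zeta_res (1 + of_real x) / zeta_res (1 + of_real x)) \<longlongrightarrow> 1 - of_nat m) (at_right 0)"
    by (intro tendsto_diff tendsto_const filterlim_compose[OF m(2) filterlim_horizontal_approach])
  from tendsto_Re[OF this] have "((\<lambda>x. Re (1 - (1 + of_real x - 1) * deriv zeta_res (1 + of_real x) / zeta_res (1 + of_real x))) \<longlongrightarrow> 1) (at_right 0)"
    using \<open>m = 0\<close> by simp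
  then show ?thesis
  proof (rule Lim_transform_eventually)
    show "\<forall>\<^sub>F x in at_right 0. Re (1 - (1 + of_real x - 1) * deriv zeta_res (1 + of_real x) / zeta_res (1 + of_real x))
        = x * Re (mangoldt_dirichlet (of_real (1 + x)))"
      using eventually_at_right_less[of "0::real"]
    proof eventually_elim
      case (elim x)
      define z :: complex where "z = 1 + of_real x"
      have z: "Re z > 1" "z = of_real (1 + x)" "z \<noteq> 1" using elim by (auto simp: z_def)
      have "1 - (z - 1) * deriv zeta_res z / zeta_res z = of_real x * mangoldt_dirichlet z"
        unfolding deriv_zeta_res[OF z(1)] using zeta_res_nonzero_half_plane[OF z(1)] z(3) by (simp add: field_simps z_def)
      then have "Re (1 - (z - 1) * deriv zeta_res z / zeta_res z) = x * Re (mangoldt_dirichlet z)" by simp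
      then show ?case unfolding z(2)[symmetric] by (simp add: z_def)
    qed
  qed
qed

text \<open>
  The residues of \<open>D\<close> at \<open>1\<close>, \<open>1 + it\<close>, \<open>1 + 2it\<close> are \<open>1\<close>, \<open>-m\<close>, \<open>-k\<close>, and \<open>3 - 4m - k \<ge> 0\<close> forces \<open>m = 0\<close>.
\<close>

lemma zeta_res_nonzero:
  assumes "Re s \<ge> 1"
  shows "zeta_res s \<noteq> 0"
proof (cases "Re s > 1 \<or> s = 1")
  case True
  then show ?thesis using zeta_res_nonzero_half_plane zeta_res_1 by auto
next
  case False
  define t where "t = Im s"
  have s: "s = 1 + \<i> * of_real t" "t \<noteq> 0"
    using False assms by (auto simp: t_def complex_eq_iff)
  obtain m where m: "m = 0 \<longleftrightarrow> zeta_res (1 + \<i> * of_real t) \<noteq> 0"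
    "((\<lambda>x. x * Re (mangoldt_dirichlet (of_real (1 + x) + \<i> * of_real t))) \<longlongrightarrow> - real m) (at_right 0)"
    using mangoldt_dirichlet_residue[OF s(2)] by blast
  obtain k where k: 
    "((\<lambda>x. x * Re (mangoldt_dirichlet (of_real (1 + x) + \<i> * of_real (2 * t)))) \<longlongrightarrow> - real k) (at_right 0)"
    using mangoldt_dirichlet_residue[of "2 * t"] s(2) by auto
  have "((\<lambda>x. 3 * (x * Re (mangoldt_dirichlet (of_real (1 + x)))) + 4 * (x * Re (mangoldt_dirichlet (of_real (1 + x) + \<i> * of_real t)))
      + x * Re (mangoldt_dirichlet (of_real (1 + x) + \<i> * of_real (2 * t)))) \<longlongrightarrow> 3 * 1 + 4 * (- real m) + (- real k)) (at_right 0)"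
    by (intro tendsto_add tendsto_mult_left mangoldt_dirichlet_residue_1 m k)
  then have "3 * 1 + 4 * (- real m) + (- real k) \<ge> 0"
  proof (rule tendsto_lowerbound)
    show "\<forall>\<^sub>F x in at_right 0. 0 \<le> 3 * (x * Re (mangoldt_dirichlet (of_real (1 + x)))) + 4 * (x * Re (mangoldt_dirichlet (of_real (1 + x) + \<i> * of_real t)))
      + x * Re (mangoldt_dirichlet (of_real (1 + x) + \<i> * of_real (2 * t)))"
      using eventually_at_right_less[of "0::real"]
    proof eventually_elim
      case (elim x)
      then have "0 \<le> x * (3 * Re (mangoldt_dirichlet (of_real (1 + x))) + 4 * Re (mangoldt_dirichlet (of_real (1 + x) + \<i> * of_real t))
       + Re (mangoldt_dirichlet (of_real (1 + x) + \<i> * of_real (2 * t))))"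
        by (intro mult_nonneg_nonneg mangoldt_dirichlet_341) auto
      then show ?case by (simp only: distrib_left mult_ac)
    qed
  qed simp
  then have "m = 0" by linarith
  then show ?thesis using m(1) s(1) by simp
qed

section \<open>Upper bound of the prime number theorem\<close>

text \<open>Written with \<open>powr 1\<close> to match the growth hypothesis of
  \<open>zeta_diff_series\<close>.\<close>

lemma norm_cheb_psi_le: "norm (of_real (cheb_psi n) :: complex) \<le> 4 * real n powr 1" if "n \<ge> 1"
  using cheb_psi_le[of n] cheb_psi_nonneg[of n] that by simp

text \<open>Summation by parts; the boundary term \<psi>(N) N^(-s) vanishes in the limit by
  Chebyshev's bound \<psi>(N) \<le> 4N.\<close>

lemma mangoldt_dirichlet_abel:
  assumes s: "Re s > 1"
  shows "(\<lambda>n. of_real (cheb_psi n) * (of_nat n powr (-s) - of_nat (Suc n) powr (-s))) sums mangoldt_dirichlet s"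
proof -
  have eq: "(\<Sum>n<N. of_real (cheb_psi n) * (of_nat n powr (-s) - of_nat (Suc n) powr (-s))) =
        (\<Sum>n<Suc N. mangoldt n * of_nat n powr (-s)) - of_real (cheb_psi N) * of_nat N powr (-s)" for N
  proof (induction N)
    case (Suc N)
    have "(\<Sum>n<Suc N. of_real (cheb_psi n) * (of_nat n powr (-s) - of_nat (Suc n) powr (-s))) =
      (\<Sum>n<Suc N. mangoldt n * of_nat n powr (-s)) - of_real (cheb_psi N) * of_nat (Suc N) powr (-s)"
      using Suc by (simp add: ring_distribs)
    then show ?case by (simp add: cheb_psi_Suc ring_distribs)
  qed auto
  have "(\<lambda>N. (\<Sum>n<Suc N. mangoldt n * of_nat n powr (-s)) - of_real (cheb_psi N) * of_nat N powr (-s)) \<longlonglongrightarrow> mangoldt_dirichlet s - 0"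
  proof (rule tendsto_diff)
    have "(\<lambda>N. \<Sum>n<N. mangoldt n * of_nat n powr (-s)) \<longlonglongrightarrow> mangoldt_dirichlet s"
      unfolding mangoldt_dirichlet_def by (rule summable_LIMSEQ[OF summable_norm_cancel[OF summable_mangoldt_dirichlet[OF s]]])
    then show "(\<lambda>N. \<Sum>n<Suc N. mangoldt n * of_nat n powr (-s)) \<longlonglongrightarrow> mangoldt_dirichlet s"
      by (rule LIMSEQ_Suc)
    show "(\<lambda>N. of_real (cheb_psi N) * of_nat N powr (-s) :: complex) \<longlonglongrightarrow> 0"
    proof (rule Lim_null_comparison)
      show "(\<lambda>N. 4 * real N powr (1 - Re s)) \<longlonglongrightarrow> 0"
        using s by (intro tendsto_mult_right_zero tendsto_neg_powr filterlim_real_sequentially) auto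
      show "\<forall>\<^sub>F N in sequentially. norm (of_real (cheb_psi N) * of_nat N powr (-s) :: complex) \<le> 4 * real N powr (1 - Re s)"
        using eventually_ge_at_top[of 1]
      proof eventually_elim
        case (elim N)
        have "norm (of_real (cheb_psi N) * of_nat N powr (-s) :: complex) \<le> (4 * real N powr 1) * real N powr (-Re s)"
          unfolding norm_mult using elim by (intro mult_mono norm_cheb_psi_le) (auto simp: norm_powr_real_powr)
        also have "\<dots> = 4 * (real N powr 1 * real N powr (-Re s))" by simp
        also have "real N powr 1 * real N powr (-Re s) = real N powr (1 - Re s)"
          unfolding powr_add [symmetric] by simp
        finally show ?case .
      qed
    qed
  qed
  then show ?thesis unfolding sums_def eq by simp
qed

text \<open>
  Newman's theorem applies to \<open>a\<^sub>n = (\<psi>(n) - n) / n\<close>. With \<open>s = 1 + z\<close> its transform is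
  \<open>(K(s + 1) + D(s)) / s - \<zeta>(s)\<close>, where \<open>D = -\<zeta>'/\<zeta>\<close> and \<open>K\<close> is a series in \<open>zeta_diff\<close>; the poles of
  \<open>D(s) / s\<close> and \<open>\<zeta>(s)\<close> at \<open>s = 1\<close> cancel.
\<close>

lemma summable_cheb_psi_diff: "summable (\<lambda>n. (cheb_psi n - real n) / (real n)\<^sup>2)"
proof -
  define a :: "nat \<Rightarrow> complex" where "a = (\<lambda>n. of_real ((cheb_psi n - real n) / real n))"
  define K where "K = (\<lambda>s. \<Sum>n. of_real (cheb_psi n) * zeta_diff n s)"
  \<comment> \<open>This collects the cancelling poles: 1 / (s (s - 1)) from D(s) / s, and
    \<open>zeta_res s / (s - 1)\<close>, which is zeta(s). Both numerators, 1 / s and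
    \<open>zeta_res s\<close>, equal 1 at s = 1, so their difference quotient is regular
    there.\<close>
  define M where "M = (\<lambda>s. if s = 1 then deriv (\<lambda>s. 1 / s - zeta_res s) 1 else ((1 / s - zeta_res s) - (1 / 1 - zeta_res 1)) / (s - 1))"
  define gs where "gs = (\<lambda>s. K (1 + s) / s - deriv zeta_res s / (s * zeta_res s) + M s)"
  \<comment> \<open>Open by continuity, and it contains the closed half plane Re s \<ge> 1 because
    \<open>zeta_res\<close> has no zero there.\<close>
  define Us where "Us = {s. Re s > 0} \<inter> zeta_res -` (-{0})"
  have op: "open {s. Re s > 0}" by (rule open_halfspace_Re_gt)
  have opUs: "open Us" unfolding Us_def
    by (rule continuous_open_preimage) (use holomorphic_zeta_res holomorphic_on_imp_continuous_on op in auto)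
  have K: "K holomorphic_on {s. Re s > 1}" "\<And>s. Re s > 1 \<Longrightarrow> summable (\<lambda>n. of_real (cheb_psi n) * zeta_diff n s)"
    using zeta_diff_series[of "\<lambda>n. of_real (cheb_psi n)" 4 1, OF norm_cheb_psi_le] by (simp_all add: K_def)
  have holM: "M holomorphic_on {s. Re s > 0}"
    unfolding M_def by (rule pole_lemma_open[OF _ op]) (intro holomorphic_intros holomorphic_zeta_res, auto)
  have holK: "(\<lambda>s. K (1 + s)) holomorphic_on {s. Re s > 0}"
  proof -
    have "(K \<circ> (\<lambda>s. 1 + s)) holomorphic_on {s. Re s > 0}"
      by (rule holomorphic_on_compose_gen[OF _ K(1)]) (auto intro!: holomorphic_intros)
    then show ?thesis by (simp add: o_def)
  qed
  have "gs holomorphic_on Us"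
  proof -
    have sub: "Us \<subseteq> {s. Re s > 0}" by (auto simp: Us_def)
    note 1 = holomorphic_on_subset[OF holK sub] holomorphic_on_subset[OF holM sub]
      holomorphic_on_subset[OF holomorphic_zeta_res sub]
      holomorphic_on_subset[OF holomorphic_deriv[OF holomorphic_zeta_res op] sub]
    show ?thesis
      unfolding gs_def by (intro holomorphic_on_add holomorphic_on_diff holomorphic_on_divide holomorphic_on_mult
          holomorphic_on_ident 1) (auto simp: Us_def)
  qed
  then have holg: "(\<lambda>z. gs (1 + z)) holomorphic_on ((\<lambda>z. 1 + z) -` Us)"
  proof -
    have "(gs \<circ> (\<lambda>z. 1 + z)) holomorphic_on ((\<lambda>z. 1 + z) -` Us)"
      by (rule holomorphic_on_compose_gen[OF _ \<open>gs holomorphic_on Us\<close>]) (auto intro!: holomorphic_intros)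
    then show ?thesis by (simp add: o_def)
  qed
  have "(\<lambda>n. a (Suc n) / of_nat (Suc n)) sums gs (1 + 0)"
  proof (rule newman_tauberian[OF _ _ _ holg])
    show "open ((\<lambda>z. 1 + z) -` Us)"
      by (intro open_vimage opUs continuous_intros)
    show "{z. 0 \<le> Re z} \<subseteq> (\<lambda>z. 1 + z) -` Us"
      using zeta_res_nonzero by (auto simp: Us_def)
    show "norm (a n) \<le> 4" for n
    proof (cases "n = 0")
      case False
      have "\<bar>cheb_psi n - real n\<bar> \<le> 4 * real n" using cheb_psi_le[of n] cheb_psi_nonneg[of n] by simp
      then show ?thesis using False unfolding a_def norm_of_real abs_divide by (simp add: field_simps)
    qed (simp add: a_def)
    fix z assume "Re z > 0"
    define s where "s = 1 + z"
    have s: "Re s > 1" using \<open>Re z > 0\<close> by (simp add: s_def)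
    have s0: "s \<noteq> 0" "s \<noteq> 1" using s by auto
    have D: "mangoldt_dirichlet s = 1 / (s - 1) - deriv zeta_res s / zeta_res s"
      using deriv_zeta_res[OF s] zeta_res_nonzero_half_plane[OF s] by (simp add: field_simps)
    have "(\<lambda>n. of_real (cheb_psi n) * zeta_diff n (1 + s)) sums K (1 + s)"
      unfolding K_def using s by (intro summable_sums K(2)) auto
    then have "(\<lambda>n. (of_real (cheb_psi n) * zeta_diff n (1 + s) + of_real (cheb_psi n) * (of_nat n powr (-s) - of_nat (Suc n) powr (-s))) / s - of_nat n powr (-s))
      sums ((K (1 + s) + mangoldt_dirichlet s) / s - (\<Sum>n. of_nat n powr (-s)))"
      by (intro sums_diff sums_divide sums_add mangoldt_dirichlet_abel s summable_sums
           summable_norm_cancel[OF summable_zeta])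
    also have "(\<lambda>n. (of_real (cheb_psi n) * zeta_diff n (1 + s) + of_real (cheb_psi n) * (of_nat n powr (-s) - of_nat (Suc n) powr (-s))) / s - of_nat n powr (-s))
       = (\<lambda>n. a n * of_nat n powr (-1-z))"
    proof
      fix n
      have p: "of_nat n powr (-s) = of_nat n * (of_nat n powr (-(1+s)) :: complex)"
      proof (cases "n = 0")
        case False
        then show ?thesis by (simp add: powr_diff powr_minus field_simps)
      qed auto
      \<comment> \<open>The difference in \<open>zeta_diff n (1 + s)\<close> is the negative of the
        one from summation by parts, so s n^(-(1+s)) alone survives.\<close>
      have "(of_real (cheb_psi n) * zeta_diff n (1 + s) + of_real (cheb_psi n) * (of_nat n powr (-s) - of_nat (Suc n) powr (-s))) / s
         = of_real (cheb_psi n) * of_nat n powr (-(1+s))"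
        using s0 by (simp add: zeta_diff_def field_simps)
      also have "\<dots> - of_nat n powr (-s) = (of_real (cheb_psi n) - of_nat n) * of_nat n powr (-(1+s))"
        unfolding p by (simp add: algebra_simps)
      also have "\<dots> = a n * (of_nat n * of_nat n powr (-(1+s)))"
        by (cases "n = 0") (simp_all add: a_def)
      also have "\<dots> = a n * of_nat n powr (-1-z)"
        unfolding p[symmetric] by (simp add: s_def)
      finally show "(of_real (cheb_psi n) * zeta_diff n (1 + s) + of_real (cheb_psi n) * (of_nat n powr (-s) - of_nat (Suc n) powr (-s))) / s - of_nat n powr (-s) = a n * of_nat n powr (-1-z)" .
    qed
    also have "(K (1 + s) + mangoldt_dirichlet s) / s - (\<Sum>n. of_nat n powr (-s)) = gs s"
    proof -
      have z: "(\<Sum>n. of_nat n powr (-s)) = zeta_res s / (s - 1)"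
        using zeta_res_eq[OF s] s0 by simp
      show ?thesis
        unfolding gs_def D M_def z using s0 zeta_res_1 zeta_res_nonzero_half_plane[OF s]
        by (simp add: divide_simps) (simp add: algebra_simps)
    qed
    finally have 1: "(\<lambda>n. a n * of_nat n powr (-1-z)) sums gs s" .
    then show "(\<lambda>n. a (Suc n) * of_nat (Suc n) powr (-1-z)) sums gs (1 + z)"
      by (subst sums_Suc_iff) (simp add: s_def a_def)
  qed
  then have "(\<lambda>n. Re (a (Suc n) / of_nat (Suc n))) sums Re (gs (1 + 0))" by (rule sums_Re)
  then have "summable (\<lambda>n. Re (a (Suc n) / of_nat (Suc n)))" by (auto simp: sums_iff)
  also have "(\<lambda>n. Re (a (Suc n) / of_nat (Suc n))) = (\<lambda>n. (cheb_psi (Suc n) - real (Suc n)) / (real (Suc n))\<^sup>2)"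
  proof
    fix n
    have "a (Suc n) / of_nat (Suc n) = of_real ((cheb_psi (Suc n) - real (Suc n)) / (real (Suc n))\<^sup>2)"
      by (simp add: a_def power2_eq_square)
    then show "Re (a (Suc n) / of_nat (Suc n)) = (cheb_psi (Suc n) - real (Suc n)) / (real (Suc n))\<^sup>2"
      by (metis Re_complex_of_real)
  qed
  finally show ?thesis by (subst (asm) summable_Suc_iff)
qed

text \<open>If \<psi>(N) > (1 + d) N, monotonicity keeps \<psi>(k) - k at least d N / 2 for k up to
  N + d N / 2. Such a block adds a fixed amount to the series, which contradicts its
  convergence.\<close>

theorem cheb_psi_upper:
  assumes "\<epsilon> > 0"
  shows "\<forall>\<^sub>F n in sequentially. cheb_psi n \<le> (1 + \<epsilon>) * real n"
proof -
  define d where "d = min \<epsilon> 1"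
  have d: "0 < d" "d \<le> 1" "d \<le> \<epsilon>" using assms by (auto simp: d_def)
  \<comment> \<open>The threshold d^2 / 32 is what a bad block contributes: at least d N / 4 terms,
    each at least d / (8 N).\<close>
  obtain N0 where N0: "\<And>m n. m \<ge> N0 \<Longrightarrow> norm (\<Sum>k\<in>{m..<n}. (cheb_psi k - real k) / (real k)\<^sup>2) < d\<^sup>2 / 32"
  proof -
    have "d\<^sup>2 / 32 > 0" using d by simp
    then show ?thesis using summable_cheb_psi_diff that unfolding summable_Cauchy by blast
  qed
  have "cheb_psi N \<le> (1 + \<epsilon>) * real N" if N: "N \<ge> N0" "real N \<ge> 2 / d" for N
  proof (rule ccontr)
    assume "\<not> ?thesis"
    then have big: "cheb_psi N > (1 + \<epsilon>) * real N" by simp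
    have Npos: "real N > 0" using N(2) d order_less_le_trans[of 0 "2 / d" "real N"] by simp
    have "(1 + d) * real N \<le> (1 + \<epsilon>) * real N" using d Npos by (intro mult_right_mono) auto
    then have big: "cheb_psi N > (1 + d) * real N" using big by linarith
    define L where "L = nat \<lfloor>d * real N / 2\<rfloor>"
    have x1: "d * real N / 2 \<ge> 1" using N(2) d by (simp add: field_simps)
    have L: "real L \<le> d * real N / 2" "real L \<ge> d * real N / 4"
    proof -
      have "real L = of_int \<lfloor>d * real N / 2\<rfloor>" using x1 by (simp add: L_def)
      moreover have "\<lfloor>d * real N / 2\<rfloor> \<ge> 1" using x1 by simp
      then have "(1::real) \<le> of_int \<lfloor>d * real N / 2\<rfloor>" by linarith
      ultimately show "real L \<le> d * real N / 2" "real L \<ge> d * real N / 4" by linarith+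
    qed
    have "(\<Sum>k\<in>{N..<N+L}. d / (8 * real N)) \<le> (\<Sum>k\<in>{N..<N+L}. (cheb_psi k - real k) / (real k)\<^sup>2)"
    proof (rule sum_mono)
      fix k assume k: "k \<in> {N..<N+L}"
      have k1: "real k \<le> real N + d * real N / 2" using k L(1) by auto
      have "d * real N \<le> 1 * real N" using d by (intro mult_right_mono) auto
      then have k2: "real k \<le> 2 * real N" using k1 Npos by linarith
      have "cheb_psi k \<ge> (1 + d) * real N" using big cheb_psi_mono[of N k] k by auto
      then have num: "cheb_psi k - real k \<ge> d * real N / 2" using k1 by (simp add: algebra_simps)
      have kpos: "real k > 0" using k Npos by auto
      have "(real k)\<^sup>2 \<le> (2 * real N)\<^sup>2" using k2 by (intro power_mono) auto
      then have "d / (8 * real N) * (real k)\<^sup>2 \<le> d / (8 * real N) * (2 * real N)\<^sup>2"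
        using d Npos by (intro mult_left_mono) auto
      also have "\<dots> = d * real N / 2" using Npos by (simp add: power2_eq_square)
      also note num
      finally show "d / (8 * real N) \<le> (cheb_psi k - real k) / (real k)\<^sup>2"
        using kpos by (simp add: pos_le_divide_eq)
    qed
    also have "\<dots> < d\<^sup>2 / 32" using N0[of N "N+L"] N(1) by simp
    finally have "real L * (d / (8 * real N)) < d\<^sup>2 / 32" by simp
    moreover have "real L * (d / (8 * real N)) \<ge> (d * real N / 4) * (d / (8 * real N))"
      using L d Npos by (intro mult_right_mono) auto
    moreover have "(d * real N / 4) * (d / (8 * real N)) = d\<^sup>2 / 32"
      using Npos by (simp add: power2_eq_square)
    ultimately show False by linarith
  qed
  then have main: "cheb_psi N \<le> (1 + \<epsilon>) * real N" if "N \<ge> max N0 (nat \<lceil>2 / d\<rceil>)" for N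
    using that of_nat_ceiling[of "2 / d"] by (meson max.boundedE of_nat_mono order_trans)
  show ?thesis
    using eventually_ge_at_top[of "max N0 (nat \<lceil>2 / d\<rceil>)"] by eventually_elim (rule main)
qed

corollary common_denom_upper:
  assumes "\<epsilon> > 0"
  shows "\<forall>\<^sub>F n in sequentially. real (common_denom n) \<le> exp ((1 + \<epsilon>) * real n)"
  using cheb_psi_upper[OF assms] by eventually_elim (simp add: of_nat_common_denom)

section \<open>Partial fractions with controlled denominators\<close>

definition pf_eval :: "nat \<Rightarrow> nat \<Rightarrow> (nat \<Rightarrow> nat \<Rightarrow> real) \<Rightarrow> real \<Rightarrow> real" where
  "pf_eval n s c t = (\<Sum>i\<in>{1..s}. \<Sum>j\<le>n. c i j / (t + real j) ^ i)"

definition pf_norm :: "nat \<Rightarrow> nat \<Rightarrow> (nat \<Rightarrow> nat \<Rightarrow> real) \<Rightarrow> real" where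
  "pf_norm n s c = (\<Sum>i\<in>{1..s}. \<Sum>j\<le>n. \<bar>c i j\<bar>)"

text \<open>In a product of \<open>s\<close> simple fractions a term of order i has lost s - i
  orders by splitting, and each split costs one factor of the common denominator.\<close>

definition pf_int :: "nat \<Rightarrow> nat \<Rightarrow> (nat \<Rightarrow> nat \<Rightarrow> real) \<Rightarrow> bool" where
  "pf_int n s c \<longleftrightarrow> (\<forall>i\<in>{1..s}. \<forall>j\<le>n. real (common_denom n) ^ (s - i) * c i j \<in> \<int>)"

text \<open>Expansion, denominators and size of the coefficients are bundled so that all three pass
  through one induction on the number of factors.\<close>

definition pf_rep :: "nat \<Rightarrow> nat \<Rightarrow> real \<Rightarrow> (real \<Rightarrow> real) \<Rightarrow> bool" where
  "pf_rep n s B f \<longleftrightarrow> (\<exists>c. pf_int n s c \<and> pf_norm n s c \<le> B \<and>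
     (\<forall>t. (\<forall>j\<le>n. t + real j \<noteq> 0) \<longrightarrow> f t = pf_eval n s c t))"

lemma pf_rep_cong:
  assumes "pf_rep n s B f" "\<And>t. (\<And>j. j \<le> n \<Longrightarrow> t + real j \<noteq> 0) \<Longrightarrow> g t = f t" "B \<le> B'"
  shows "pf_rep n s B' g"
  using assms unfolding pf_rep_def by (metis order_trans)

lemma pf_rep_add:
  assumes "pf_rep n s B f" "pf_rep n s B' g"
  shows "pf_rep n s (B + B') (\<lambda>t. f t + g t)"
proof -
  from assms obtain c d where c: "pf_int n s c" "pf_norm n s c \<le> B" "\<And>t. (\<forall>j\<le>n. t + real j \<noteq> 0) \<Longrightarrow> f t = pf_eval n s c t"
    and d: "pf_int n s d" "pf_norm n s d \<le> B'" "\<And>t. (\<forall>j\<le>n. t + real j \<noteq> 0) \<Longrightarrow> g t = pf_eval n s d t"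
    unfolding pf_rep_def by metis
  define e where "e = (\<lambda>i j. c i j + d i j)"
  have "pf_int n s e" using c(1) d(1) by (auto simp: pf_int_def e_def ring_distribs)
  moreover have "pf_norm n s e \<le> pf_norm n s c + pf_norm n s d"
    unfolding pf_norm_def e_def sum.distrib [symmetric] by (intro sum_mono abs_triangle_ineq)
  moreover have "f t + g t = pf_eval n s e t" if "\<forall>j\<le>n. t + real j \<noteq> 0" for t
    using c(3)[OF that] d(3)[OF that] by (simp add: pf_eval_def e_def add_divide_distrib sum.distrib)
  ultimately show ?thesis unfolding pf_rep_def using c(2) d(2) by (intro exI[of _ e]) auto
qed

lemma pf_rep_zero: "pf_rep n s 0 (\<lambda>_. 0)"
  unfolding pf_rep_def by (intro exI[of _ "\<lambda>_ _. 0"]) (auto simp: pf_int_def pf_norm_def pf_eval_def)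

lemma pf_rep_sum:
  assumes "finite I" "\<And>k. k \<in> I \<Longrightarrow> pf_rep n s (B k) (f k)"
  shows "pf_rep n s (\<Sum>k\<in>I. B k) (\<lambda>t. \<Sum>k\<in>I. f k t)"
  using assms by (induction rule: finite_induct) (auto intro: pf_rep_zero pf_rep_add)

lemma pf_rep_elem:
  assumes "1 \<le> i" "i \<le> s" "j \<le> n" "real (common_denom n) ^ (s - i) * x \<in> \<int>"
  shows "pf_rep n s \<bar>x\<bar> (\<lambda>t. x / (t + real j) ^ i)"
proof -
  define c where "c = (\<lambda>i' j'. if i' = i then if j' = j then x else 0 else 0)"
  have delta: "(\<Sum>i'\<in>{1..s}. \<Sum>j'\<le>n. h (c i' j') i' j') = h x i j" if "\<And>i j. h 0 i j = 0" for h :: "real \<Rightarrow> nat \<Rightarrow> nat \<Rightarrow> real"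
  proof -
    have "(\<Sum>j'\<le>n. h (c i' j') i' j') = (if i' = i then h x i j else 0)" for i'
    proof (cases "i' = i")
      case True
      have "(\<Sum>j'\<le>n. h (c i' j') i' j') = (\<Sum>j'\<le>n. if j' = j then h x i j else 0)"
        by (intro sum.cong) (auto simp: c_def that True)
      then show ?thesis using True assms by simp
    qed (simp add: c_def that)
    then have "(\<Sum>i'\<in>{1..s}. \<Sum>j'\<le>n. h (c i' j') i' j') = (\<Sum>i'\<in>{1..s}. if i' = i then h x i j else 0)"
      by simp
    also have "\<dots> = h x i j" using assms by simp
    finally show ?thesis .
  qed
  have "pf_int n s c" using assms by (auto simp: pf_int_def c_def)
  moreover have "pf_norm n s c = \<bar>x\<bar>"
    unfolding pf_norm_def using delta[of "\<lambda>y _ _. \<bar>y\<bar>"] by simp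
  moreover have "pf_eval n s c t = x / (t + real j) ^ i" for t
    unfolding pf_eval_def using delta[of "\<lambda>y i j. y / (t + real j) ^ i"] by simp
  ultimately show ?thesis unfolding pf_rep_def by auto
qed

lemma common_denom_div_Ints:
  assumes "j \<le> n" "l \<le> n" "j \<noteq> l"
  shows "real (common_denom n) / (real l - real j) \<in> \<int>"
proof -
  have "real (common_denom n) / real d \<in> \<int>" if "1 \<le> d" "d \<le> n" for d
    using dvd_common_denom[OF that] that by (auto elim!: dvdE)
  note * = this
  show ?thesis
  proof (cases "j < l")
    case True
    then show ?thesis using *[of "l - j"] assms by (simp add: of_nat_diff)
  next
    case False
    have "real (common_denom n) / (real l - real j) = - (real (common_denom n) / (real j - real l))"
      by (metis minus_diff_eq minus_divide_right)
    then show ?thesis using False *[of "j - l"] assms by (simp add: of_nat_diff)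
  qed
qed

text \<open>Repeated splitting 1 / ((t + j) (t + l)) = (1 / (t + j) - 1 / (t + l)) / (l - j) for
  distinct j and l. Every split lowers the total order by one and divides by l - j, which divides
  the common denominator and has absolute value at least 1, so coefficients do not grow and at most
  i + 1 of them arise.\<close>

lemma pf_rep_elem_mult:
  assumes "i \<le> s" "j \<le> n" "l \<le> n" "real (common_denom n) ^ (s - i) * x \<in> \<int>"
  shows "pf_rep n (Suc s) (real (Suc i) * \<bar>x\<bar>) (\<lambda>t. x / ((t + real j) ^ i * (t + real l)))"
  using assms
proof (induction i arbitrary: x)
  case 0
  then have "pf_rep n (Suc s) \<bar>x\<bar> (\<lambda>t. x / (t + real l) ^ 1)"
    by (intro pf_rep_elem) auto
  then show ?case by simp
next
  case (Suc i)
  show ?case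
  proof (cases "l = j")
    case True
    have "pf_rep n (Suc s) \<bar>x\<bar> (\<lambda>t. x / (t + real j) ^ (Suc (Suc i)))"
      using Suc.prems by (intro pf_rep_elem) auto
    then show ?thesis
      by (rule pf_rep_cong) (auto simp: True mult_ac algebra_simps)
  next
    case False
    define y where "y = x / (real l - real j)"
    have lj: "real l - real j \<noteq> 0" using False by simp
    have "\<bar>real l - real j\<bar> \<ge> 1" using False by linarith
    then have yx: "\<bar>y\<bar> \<le> \<bar>x\<bar>"
      unfolding y_def abs_divide using lj by (simp add: pos_divide_le_eq mult_le_cancel_left1)
    have sI: "s - i = Suc (s - Suc i)" using Suc.prems by simp
    have "(real (common_denom n) ^ (s - Suc i) * x) * (real (common_denom n) / (real l - real j)) \<in> \<int>"
      using Suc.prems False by (intro Ints_mult[OF Suc.prems(4) common_denom_div_Ints]) auto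
    then have yI: "real (common_denom n) ^ (s - i) * y \<in> \<int>"
      unfolding sI y_def by (simp add: mult_ac)
    have 1: "pf_rep n (Suc s) \<bar>y\<bar> (\<lambda>t. y / (t + real j) ^ Suc i)"
      using Suc.prems yI by (intro pf_rep_elem) auto
    have 2: "pf_rep n (Suc s) (real (Suc i) * \<bar>- y\<bar>) (\<lambda>t. (- y) / ((t + real j) ^ i * (t + real l)))"
      using Suc.prems yI by (intro Suc.IH) auto
    show ?thesis
    proof (rule pf_rep_cong[OF pf_rep_add[OF 1 2]])
      fix t assume t: "\<And>j. j \<le> n \<Longrightarrow> t + real j \<noteq> 0"
      have nz: "t + real j \<noteq> 0" "t + real l \<noteq> 0" using t Suc.prems by auto
      have "x = y * (real l - real j)"
        using lj by (simp add: y_def)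
      also have "\<dots> = y * (t + real l) - y * (t + real j)"
        by (simp add: algebra_simps)
      finally have "x = y * (t + real l) - y * (t + real j)" .
      then have "x / ((t + real j) ^ Suc i * (t + real l)) = (y * (t + real l) - y * (t + real j)) / ((t + real j) ^ Suc i * (t + real l))"
        by simp
      also have "\<dots> = y / (t + real j) ^ Suc i + (- y) / ((t + real j) ^ i * (t + real l))"
        using nz by (simp add: diff_divide_distrib)
      finally show "x / ((t + real j) ^ Suc i * (t + real l)) = y / (t + real j) ^ Suc i + (- y) / ((t + real j) ^ i * (t + real l))" .
    next
      show "\<bar>y\<bar> + real (Suc i) * \<bar>- y\<bar> \<le> real (Suc (Suc i)) * \<bar>x\<bar>"
      proof -
        have "\<bar>y\<bar> + real (Suc i) * \<bar>- y\<bar> = real (Suc (Suc i)) * \<bar>y\<bar>" by (simp add: algebra_simps)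
        also have "\<dots> \<le> real (Suc (Suc i)) * \<bar>x\<bar>" using yx by (intro mult_left_mono) auto
        finally show ?thesis .
      qed
    qed
  qed
qed

text \<open>The shape of each of the a factors into which R is decomposed: simple poles only, with
  integer residues.\<close>

definition brick :: "nat \<Rightarrow> (nat \<Rightarrow> int) \<Rightarrow> real \<Rightarrow> real" where
  "brick n \<alpha> t = (\<Sum>l\<le>n. of_int (\<alpha> l) / (t + real l))"

lemma pf_rep_brick:
  assumes "(\<Sum>l\<le>n. \<bar>of_int (\<alpha> l)\<bar>) \<le> A"
  shows "pf_rep n 1 A (brick n \<alpha>)"
proof -
  have "pf_rep n 1 (\<Sum>l\<le>n. \<bar>of_int (\<alpha> l)\<bar>) (\<lambda>t. \<Sum>l\<le>n. of_int (\<alpha> l) / (t + real l) ^ 1)"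
    by (intro pf_rep_sum pf_rep_elem) auto
  then show ?thesis
    by (rule pf_rep_cong) (use assms in \<open>auto simp: brick_def\<close>)
qed

text \<open>The factor \<open>Suc s\<close> counts the terms into which one product of fractions can
  split; over a product of a bricks these factors accumulate to a!.\<close>

lemma pf_rep_mult_brick:
  assumes f: "pf_rep n s B f" and A: "(\<Sum>l\<le>n. \<bar>of_int (\<alpha> l)\<bar>) \<le> A"
  shows "pf_rep n (Suc s) (real (Suc s) * B * A) (\<lambda>t. f t * brick n \<alpha> t)"
proof -
  from f obtain c where c: "pf_int n s c" "pf_norm n s c \<le> B" "\<And>t. (\<forall>j\<le>n. t + real j \<noteq> 0) \<Longrightarrow> f t = pf_eval n s c t"
    unfolding pf_rep_def by metis
  have "pf_rep n (Suc s) (\<Sum>i\<in>{1..s}. \<Sum>j\<le>n. \<Sum>l\<le>n. real (Suc i) * \<bar>c i j * of_int (\<alpha> l)\<bar>)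
     (\<lambda>t. \<Sum>i\<in>{1..s}. \<Sum>j\<le>n. \<Sum>l\<le>n. (c i j * of_int (\<alpha> l)) / ((t + real j) ^ i * (t + real l)))"
  proof (intro pf_rep_sum pf_rep_elem_mult)
    fix i j l assume "i \<in> {1..s}" "j \<in> {..n}" "l \<in> {..n}"
    then have "real (common_denom n) ^ (s - i) * c i j * of_int (\<alpha> l) \<in> \<int>"
      using c(1) by (intro Ints_mult[of "_ * _"]) (auto simp: pf_int_def)
    then show "real (common_denom n) ^ (s - i) * (c i j * of_int (\<alpha> l)) \<in> \<int>" by (simp add: mult_ac)
  qed auto
  then show ?thesis
  proof (rule pf_rep_cong)
    fix t assume "\<And>j. j \<le> n \<Longrightarrow> t + real j \<noteq> 0"
    then have "f t * brick n \<alpha> t = (\<Sum>i\<in>{1..s}. \<Sum>j\<le>n. c i j / (t + real j) ^ i) * (\<Sum>l\<le>n. of_int (\<alpha> l) / (t + real l))"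
      using c(3) by (simp add: pf_eval_def brick_def)
    then show "f t * brick n \<alpha> t = (\<Sum>i\<in>{1..s}. \<Sum>j\<le>n. \<Sum>l\<le>n. (c i j * of_int (\<alpha> l)) / ((t + real j) ^ i * (t + real l)))"
      unfolding sum_distrib_right by (simp add: sum_distrib_left)
  next
    have "(\<Sum>i\<in>{1..s}. \<Sum>j\<le>n. \<Sum>l\<le>n. real (Suc i) * \<bar>c i j * of_int (\<alpha> l)\<bar>) \<le>
          (\<Sum>i\<in>{1..s}. \<Sum>j\<le>n. \<Sum>l\<le>n. real (Suc s) * (\<bar>c i j\<bar> * \<bar>of_int (\<alpha> l)\<bar>))"
      by (intro sum_mono) (auto simp: abs_mult intro!: mult_right_mono)
    also have "\<dots> = real (Suc s) * (pf_norm n s c * (\<Sum>l\<le>n. \<bar>of_int (\<alpha> l)\<bar>))"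
      unfolding pf_norm_def sum_distrib_right by (simp add: sum_distrib_left)
    also have "\<dots> \<le> real (Suc s) * (B * A)"
      using c(2) A by (intro mult_left_mono mult_mono) (auto simp: pf_norm_def intro!: sum_nonneg order_trans[OF _ c(2)])
    finally show "(\<Sum>i\<in>{1..s}. \<Sum>j\<le>n. \<Sum>l\<le>n. real (Suc i) * \<bar>c i j * of_int (\<alpha> l)\<bar>) \<le> real (Suc s) * B * A" by simp
  qed
qed

text \<open>
  Antisymmetrising the coefficients (whence the factor 2) kills the coefficient sums of even order, i.e. the
  even zeta values, without using uniqueness of the expansion.
\<close>

lemma pf_rep_antisym:
  assumes f: "pf_rep n s B f"
    and anti: "\<And>t. (\<And>j. j \<le> n \<Longrightarrow> t + real j \<noteq> 0) \<Longrightarrow> f (- real n - t) = - f t"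
  obtains c where "pf_int n s c" "pf_norm n s c \<le> 2 * B"
    "\<And>t. (\<And>j. j \<le> n \<Longrightarrow> t + real j \<noteq> 0) \<Longrightarrow> 2 * f t = pf_eval n s c t"
    "\<And>i. even i \<Longrightarrow> (\<Sum>j\<le>n. c i j) = 0"
proof -
  from f obtain c where c: "pf_int n s c" "pf_norm n s c \<le> B" "\<And>t. (\<forall>j\<le>n. t + real j \<noteq> 0) \<Longrightarrow> f t = pf_eval n s c t"
    unfolding pf_rep_def by metis
  define d where "d = (\<lambda>i j. c i j - (-1) ^ i * c i (n - j))"
  have flip: "(\<Sum>j\<le>n. g (n - j)) = (\<Sum>j\<le>n. g j)" for g :: "nat \<Rightarrow> real"
    using sum.nat_diff_reindex[of g "Suc n"] by (simp add: lessThan_Suc_atMost)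
  show ?thesis
  proof (rule that[of d])
    show "pf_int n s d"
      unfolding pf_int_def
    proof (intro ballI allI impI)
      fix i j assume ij: "i \<in> {1..s}" "j \<le> n"
      let ?D = "real (common_denom n) ^ (s - i)"
      have "?D * c i j - (-1) ^ i * (?D * c i (n - j)) \<in> \<int>"
        using c(1) ij by (intro Ints_diff Ints_mult[of "(-1) ^ i"] Ints_power) (auto simp: pf_int_def)
      then show "?D * d i j \<in> \<int>" by (simp add: d_def algebra_simps)
    qed
    have "pf_norm n s d \<le> (\<Sum>i\<in>{1..s}. \<Sum>j\<le>n. \<bar>c i j\<bar> + \<bar>c i (n - j)\<bar>)"
      unfolding pf_norm_def d_def
      by (intro sum_mono order_trans[OF abs_triangle_ineq4]) (simp add: abs_mult power_abs)
    also have "\<dots> = 2 * pf_norm n s c"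
      unfolding pf_norm_def sum.distrib flip[of "\<lambda>j. \<bar>c _ j\<bar>"] by simp
    finally show "pf_norm n s d \<le> 2 * B" using c(2) by simp
    show "(\<Sum>j\<le>n. d i j) = 0" if "even i" for i
      using that flip[of "c i"] by (simp add: d_def sum_subtractf)
    fix t assume t: "\<And>j. j \<le> n \<Longrightarrow> t + real j \<noteq> 0"
    have "- real n - t + real j \<noteq> 0" if "j \<le> n" for j
      using t[of "n - j"] that by (simp add: of_nat_diff)
    then have "- f t = pf_eval n s c (- real n - t)" using anti[OF t] c(3)[of "- real n - t"] by auto
    also have "\<dots> = (\<Sum>i\<in>{1..s}. \<Sum>j\<le>n. (-1) ^ i * c i (n - j) / (t + real j) ^ i)"
      unfolding pf_eval_def
    proof (rule sum.cong)
      fix i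
      have "(\<Sum>j\<le>n. c i j / (- real n - t + real j) ^ i) = (\<Sum>j\<le>n. c i (n - j) / (- real n - t + real (n - j)) ^ i)"
        by (rule flip[symmetric])
      also have "\<dots> = (\<Sum>j\<le>n. (-1) ^ i * c i (n - j) / (t + real j) ^ i)"
      proof (rule sum.cong)
        fix j assume "j \<in> {..n}"
        then have "- real n - t + real (n - j) = (-1) * (t + real j)" by (simp add: of_nat_diff)
        then show "c i (n - j) / (- real n - t + real (n - j)) ^ i = (-1) ^ i * c i (n - j) / (t + real j) ^ i"
          by (cases "even i") (simp_all only: power_mult_distrib, simp_all)
      qed auto
      finally show "(\<Sum>j\<le>n. c i j / (- real n - t + real j) ^ i) = (\<Sum>j\<le>n. (-1) ^ i * c i (n - j) / (t + real j) ^ i)" .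
    qed auto
    finally have "2 * f t = f t - (\<Sum>i\<in>{1..s}. \<Sum>j\<le>n. (-1) ^ i * c i (n - j) / (t + real j) ^ i)" by simp
    moreover have "f t = pf_eval n s c t" using c(3) t by auto
    ultimately have "2 * f t = pf_eval n s c t - (\<Sum>i\<in>{1..s}. \<Sum>j\<le>n. (-1) ^ i * c i (n - j) / (t + real j) ^ i)" by simp
    also have "pf_eval n s c t - (\<Sum>i\<in>{1..s}. \<Sum>j\<le>n. (-1) ^ i * c i (n - j) / (t + real j) ^ i) = pf_eval n s d t"
      by (simp add: pf_eval_def d_def diff_divide_distrib sum_subtractf)
    finally show "2 * f t = pf_eval n s d t" .
  qed
qed

section \<open>Elementary factors with integer residues\<close>

lemma prod_minus_lessThan: "(\<Prod>i<n. - f i) = (-1) ^ n * (\<Prod>i<n. f i :: 'a :: comm_ring_1)"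
  by (induction n) auto

text \<open>The derivative of t (t + 1) ... (t + n) at -j, by which the residue there is
  divided.\<close>

lemma prod_shift_diff:
  assumes "j \<le> n"
  shows "(\<Prod>l\<in>{..n}-{j}. real l - real j) = (-1) ^ j * fact j * fact (n - j)"
proof -
  have eq: "{..n} - {j} = {..<j} \<union> {j<..n}" using assms by auto
  have "(\<Prod>l\<in>{..<j}. real l - real j) = (\<Prod>l\<in>{..<j}. - real (j - l))"
    by (intro prod.cong) (auto simp: of_nat_diff)
  also have "\<dots> = (-1) ^ j * (\<Prod>l\<in>{..<j}. real (j - l))"
    by (rule prod_minus_lessThan)
  also have "(\<Prod>l\<in>{..<j}. real (j - l)) = (\<Prod>l\<in>{1..j}. real l)"
    by (rule prod.reindex_bij_witness[of _ "\<lambda>l. j - l" "\<lambda>l. j - l"]) auto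
  also have "\<dots> = fact j" by (simp add: fact_prod)
  finally have 1: "(\<Prod>l\<in>{..<j}. real l - real j) = (-1) ^ j * fact j" .
  have "(\<Prod>l\<in>{j<..n}. real l - real j) = (\<Prod>l\<in>{1..n-j}. real l)"
    by (rule prod.reindex_bij_witness[of _ "\<lambda>l. l + j" "\<lambda>l. l - j"]) (auto simp: of_nat_diff)
  also have "\<dots> = fact (n - j)" by (simp add: fact_prod)
  finally have 2: "(\<Prod>l\<in>{j<..n}. real l - real j) = fact (n - j)" .
  show ?thesis unfolding eq using 1 2 by (subst prod.union_disjoint) auto
qed

text \<open>Lagrange interpolation: both polynomials have degree at most \<open>n\<close> and agree
  at the n + 1 points 0, -1, ..., -n.\<close>

lemma partial_fraction_simple_poles:
  fixes p :: "real poly"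
  assumes deg: "degree p \<le> n" and t: "\<And>j. j \<le> n \<Longrightarrow> t + real j \<noteq> 0"
  shows "poly p t / (\<Prod>j\<le>n. t + real j) =
         (\<Sum>j\<le>n. (poly p (- real j) * (-1) ^ j / (fact j * fact (n - j))) / (t + real j))"
proof -
  define a where "a = (\<lambda>j. poly p (- real j) * (-1) ^ j / (fact j * fact (n - j)))"
  define q where "q = (\<Sum>j\<le>n. smult (a j) (\<Prod>l\<in>{..n}-{j}. [:real l, 1:]))"
  have "p = q"
  proof (rule poly_eqI_degree)
    fix x assume "x \<in> (\<lambda>j. - real j) ` {..n}"
    then obtain k where k: "k \<le> n" "x = - real k" by auto
    have "poly q x = (\<Sum>j\<le>n. a j * (\<Prod>l\<in>{..n}-{j}. real l - real k))"
      by (simp add: q_def k poly_sum poly_prod)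
    also have "\<dots> = (\<Sum>j\<le>n. if j = k then a k * (\<Prod>l\<in>{..n}-{k}. real l - real k) else 0)"
    proof (intro sum.cong refl)
      fix j assume "j \<in> {..n}"
      have "(\<Prod>l\<in>{..n}-{j}. real l - real k) = 0" if "j \<noteq> k"
        by (rule prod_zero) (use that k in auto)
      then show "a j * (\<Prod>l\<in>{..n}-{j}. real l - real k) = (if j = k then a k * (\<Prod>l\<in>{..n}-{k}. real l - real k) else 0)"
        by auto
    qed
    also have "\<dots> = a k * ((-1) ^ k * fact k * fact (n - k))"
      using k by (simp add: prod_shift_diff)
    also have "\<dots> = poly p x * ((-1) ^ k * (-1) ^ k)"
      by (simp add: a_def k)
    also have "(-1) ^ k * (-1) ^ k = (1::real)"
      by (simp flip: power_mult_distrib)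
    finally show "poly p x = poly q x" by simp
  next
    have c: "card ((\<lambda>j. - real j) ` {..n}) = Suc n"
      by (subst card_image) (auto simp: inj_on_def)
    show "degree p < card ((\<lambda>j. - real j) ` {..n})" using deg unfolding c by simp
    have "degree q \<le> n" unfolding q_def
    proof (intro degree_sum_le)
      fix j assume j: "j \<in> {..n}"
      have "degree (\<Prod>l\<in>{..n}-{j}. [:real l, 1:]) \<le> (\<Sum>l\<in>{..n}-{j}. degree [:real l, 1:])"
        by (rule degree_prod_sum_le[unfolded o_def]) auto
      also have "\<dots> = n" using j by simp
      finally show "degree (smult (a j) (\<Prod>l\<in>{..n}-{j}. [:real l, 1:])) \<le> n"
        using degree_smult_le order_trans by blast
    qed auto
    then show "degree q < card ((\<lambda>j. - real j) ` {..n})" unfolding c by simp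
  qed
  then have "poly p t = (\<Sum>j\<le>n. a j * (\<Prod>l\<in>{..n}-{j}. t + real l))"
    by (simp add: q_def poly_sum poly_prod add.commute)
  then have "poly p t / (\<Prod>j\<le>n. t + real j) = (\<Sum>j\<le>n. (a j * (\<Prod>l\<in>{..n}-{j}. t + real l)) / (\<Prod>j\<le>n. t + real j))"
    by (simp add: sum_divide_distrib)
  also have "\<dots> = (\<Sum>j\<le>n. a j / (t + real j))"
  proof (intro sum.cong refl)
    fix j assume "j \<in> {..n}"
    then have "(\<Prod>l\<le>n. t + real l) = (t + real j) * (\<Prod>l\<in>{..n}-{j}. t + real l)"
      by (subst prod.remove[of _ j]) auto
    moreover have "(\<Prod>l\<in>{..n}-{j}. t + real l) \<noteq> 0" using t by (subst prod_zero_iff) auto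
    ultimately show "(a j * (\<Prod>l\<in>{..n}-{j}. t + real l)) / (\<Prod>j\<le>n. t + real j) = a j / (t + real j)" by simp
  qed
  finally show ?thesis by (simp add: a_def)
qed

lemma prod_descending_binomial:
  assumes "n \<le> m"
  shows "(\<Prod>i<n. real m - real i) = fact n * real (m choose n)"
proof -
  have "real (m choose n) = (\<Prod>i<n. real m - real i) / fact n"
    using gbinomial_prod_rev[of "real m" n] binomial_gbinomial[of m n, where ?'a = real] by (simp add: atLeast0LessThan)
  then show ?thesis by simp
qed

lemma pochhammer_eq_prod: "pochhammer (t::real) (Suc n) = (\<Prod>j\<le>n. t + real j)"
  by (simp add: pochhammer_prod atLeast0LessThan lessThan_Suc_atMost)

text \<open>The n! in the values of \<open>p\<close> turns 1 / (j! (n - j)!) into a binomial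
  coefficient, which is why the residues are integers.\<close>

lemma brick_eq_of_poly:
  assumes deg: "degree p \<le> n"
    and val: "\<And>j. j \<le> n \<Longrightarrow> poly p (- real j) = (-1) ^ s * (fact n * real (m j choose n))"
    and t: "\<And>j. j \<le> n \<Longrightarrow> t + real j \<noteq> 0"
  shows "poly p t / pochhammer t (Suc n) = brick n (\<lambda>j. (-1) ^ (s + j) * int (m j choose n) * int (n choose j)) t"
proof -
  have "poly p t / pochhammer t (Suc n) = (\<Sum>j\<le>n. (poly p (- real j) * (-1) ^ j / (fact j * fact (n - j))) / (t + real j))"
    unfolding pochhammer_eq_prod by (rule partial_fraction_simple_poles[OF deg t])
  also have "\<dots> = brick n (\<lambda>j. (-1) ^ (s + j) * int (m j choose n) * int (n choose j)) t"
    unfolding brick_def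
  proof (intro sum.cong refl)
    fix j assume "j \<in> {..n}"
    then have "poly p (- real j) * (-1) ^ j / (fact j * fact (n - j)) = (-1) ^ (s + j) * real (m j choose n) * (fact n / (fact j * fact (n - j)))"
      by (simp add: val power_add)
    also have "fact n / (fact j * fact (n - j)) = real (n choose j)"
      using \<open>j \<in> {..n}\<close> by (simp add: binomial_fact)
    finally show "(poly p (- real j) * (-1) ^ j / (fact j * fact (n - j))) / (t + real j)
       = of_int ((-1) ^ (s + j) * int (m j choose n) * int (n choose j)) / (t + real j)" by simp
  qed
  finally show ?thesis .
qed

text \<open>The row sum 2^n that appears here once for each brick is the origin of ln 2 in the
  theorem.\<close>

lemma brick_coeff_bound:
  assumes "\<And>j. j \<le> n \<Longrightarrow> m j \<le> M"
  shows "(\<Sum>j\<le>n. \<bar>of_int ((-1) ^ (s + j) * int (m j choose n) * int (n choose j)) :: real\<bar>) \<le> real (M choose n) * 2 ^ n"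
proof -
  have "(\<Sum>j\<le>n. \<bar>of_int ((-1) ^ (s + j) * int (m j choose n) * int (n choose j)) :: real\<bar>) \<le> (\<Sum>j\<le>n. real (M choose n) * real (n choose j))"
    using assms by (intro sum_mono) (auto simp: abs_mult power_abs intro!: mult_right_mono binomial_right_mono)
  also have "\<dots> = real (M choose n) * real (\<Sum>j\<le>n. n choose j)"
    by (simp add: sum_distrib_left)
  also have "(\<Sum>j\<le>n. n choose j) = 2 ^ n" by (rule choose_row_sum)
  finally show ?thesis by simp
qed

lemma poly_prod_linear:
  "poly (\<Prod>i<n. [:c + real i, 1:]) t = pochhammer (t + c) n"
  "degree (\<Prod>i<n. [:c + real i, 1:]) \<le> n"
proof -
  show "poly (\<Prod>i<n. [:c + real i, 1:]) t = pochhammer (t + c) n"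
    by (simp add: poly_prod pochhammer_prod atLeast0LessThan algebra_simps)
  have "degree (\<Prod>i<n. [:c + real i, 1:]) \<le> (\<Sum>i<n. degree [:c + real i, 1:])"
    by (rule degree_prod_sum_le[unfolded o_def]) auto
  then show "degree (\<Prod>i<n. [:c + real i, 1:]) \<le> n" by simp
qed

text \<open>The residues of n! / (t)_(n+1). The trivial factors \<open>n choose n\<close> and
  \<open>0 + j\<close> keep the three definitions in the common form of
  \<open>brick_eq_of_poly\<close>; the other two have the numerator blocks (t - qn)_n and (t + qn +
  1)_n.\<close>

definition coeff_F :: "nat \<Rightarrow> nat \<Rightarrow> int" where
  "coeff_F n = (\<lambda>j. (-1) ^ (0 + j) * int (n choose n) * int (n choose j))"

definition coeff_A :: "nat \<Rightarrow> nat \<Rightarrow> nat \<Rightarrow> int" where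
  "coeff_A n q = (\<lambda>j. (-1) ^ (n + j) * int ((j + q * n) choose n) * int (n choose j))"

definition coeff_B :: "nat \<Rightarrow> nat \<Rightarrow> nat \<Rightarrow> int" where
  "coeff_B n q = (\<lambda>j. (-1) ^ (0 + j) * int ((q * n + n - j) choose n) * int (n choose j))"

lemma brick_F:
  assumes "\<And>j. j \<le> n \<Longrightarrow> t + real j \<noteq> 0"
  shows "fact n / pochhammer t (Suc n) = brick n (coeff_F n) t"
  using brick_eq_of_poly[of "[:fact n:]" n 0 "\<lambda>_. n" t] assms by (simp add: coeff_F_def)

lemma brick_A:
  assumes "\<And>j. j \<le> n \<Longrightarrow> t + real j \<noteq> 0" "q \<ge> 1"
  shows "pochhammer (t - real (q * n)) n / pochhammer t (Suc n) = brick n (coeff_A n q) t"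
proof -
  let ?p = "\<Prod>i<n. [:- real (q * n) + real i, 1:]"
  have "poly ?p t / pochhammer t (Suc n) = brick n (\<lambda>j. (-1) ^ (n + j) * int ((j + q * n) choose n) * int (n choose j)) t"
  proof (rule brick_eq_of_poly[OF poly_prod_linear(2) _ assms(1)])
    fix j assume j: "j \<le> n"
    have "poly ?p (- real j) = (\<Prod>i<n. - (real (j + q * n) - real i))"
      by (simp add: poly_prod algebra_simps)
    also have "\<dots> = (-1) ^ n * (\<Prod>i<n. real (j + q * n) - real i)" by (rule prod_minus_lessThan)
    also have "(\<Prod>i<n. real (j + q * n) - real i) = fact n * real ((j + q * n) choose n)"
    proof (rule prod_descending_binomial)
      have "n \<le> q * n" using assms(2) by simp
      then show "n \<le> j + q * n" by linarith
    qed
    finally show "poly ?p (- real j) = (-1) ^ n * (fact n * real ((j + q * n) choose n))" .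
  qed
  then show ?thesis unfolding poly_prod_linear coeff_A_def by simp
qed

lemma brick_B:
  assumes "\<And>j. j \<le> n \<Longrightarrow> t + real j \<noteq> 0" "q \<ge> 1"
  shows "pochhammer (t + real (q * n) + 1) n / pochhammer t (Suc n) = brick n (coeff_B n q) t"
proof -
  let ?p = "\<Prod>i<n. [:real (q * n) + 1 + real i, 1:]"
  have "poly ?p t / pochhammer t (Suc n) = brick n (\<lambda>j. (-1) ^ (0 + j) * int ((q * n + n - j) choose n) * int (n choose j)) t"
  proof (rule brick_eq_of_poly[OF poly_prod_linear(2) _ assms(1)])
    fix j assume j: "j \<le> n"
    have "poly ?p (- real j) = (\<Prod>i<n. real (q * n) + 1 + real i - real j)"
      by (simp add: poly_prod algebra_simps)
    also have "\<dots> = (\<Prod>i<n. real (q * n + n - j) - real i)"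
      by (rule prod.reindex_bij_witness[of _ "\<lambda>i. n - 1 - i" "\<lambda>i. n - 1 - i"]) (use j in \<open>auto simp: of_nat_diff\<close>)
    also have "\<dots> = fact n * real ((q * n + n - j) choose n)"
    proof (rule prod_descending_binomial)
      have "n \<le> q * n" using assms(2) by simp
      then show "n \<le> q * n + n - j" using j by linarith
    qed
    finally show "poly ?p (- real j) = (-1) ^ 0 * (fact n * real ((q * n + n - j) choose n))" by simp
  qed
  then show ?thesis unfolding poly_prod_linear coeff_B_def by (simp add: add.assoc)
qed

text \<open>Bound the descending product by its largest factor, then use n^n / n! \<le> e^n, a
  single term of the exponential series.\<close>

lemma choose_mult_le: "real ((Suc q * n) choose n) \<le> (exp 1 * real (Suc q)) ^ n"
proof -
  have "real ((Suc q * n) choose n) * fact n \<le> real (Suc q * n) ^ n"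
  proof -
    have "fact n * ((Suc q * n) choose n) \<le> (Suc q * n) ^ n"
      using binomial_fact_pow[of "Suc q * n" n] by (simp add: mult.commute)
    then have "real (fact n * ((Suc q * n) choose n)) \<le> real ((Suc q * n) ^ n)" by (rule of_nat_mono)
    then show ?thesis by (simp add: mult.commute)
  qed
  also have "\<dots> = real (Suc q) ^ n * real n ^ n" by (simp only: of_nat_mult power_mult_distrib)
  also have "real n ^ n \<le> exp (real n) * fact n"
  proof -
    have "real n ^ n /\<^sub>R fact n \<le> exp (real n)"
      using sum_le_suminf[OF summable_exp_generic[of "real n"], of "{n}"]
      by (simp add: exp_def)
    then show ?thesis by (simp add: field_simps)
  qed
  finally have "real ((Suc q * n) choose n) * fact n \<le> (exp 1 * real (Suc q)) ^ n * fact n"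
    by (simp add: power_mult_distrib exp_of_nat_mult [symmetric] mult_ac mult_left_mono)
  then show ?thesis by (simp add: mult_le_cancel_right)
qed

section \<open>The rational function\<close>

lemma pf_rep_prod_list:
  assumes "xs \<noteq> []"
  shows "pf_rep n (length xs) (fact (length xs) * (\<Prod>\<alpha>\<leftarrow>xs. \<Sum>l\<le>n. \<bar>of_int (\<alpha> l)\<bar>)) (\<lambda>t. \<Prod>\<alpha>\<leftarrow>xs. brick n \<alpha> t)"
  using assms
proof (induction xs rule: list_nonempty_induct)
  case (single \<alpha>)
  then show ?case using pf_rep_brick[where \<alpha> = \<alpha> and n = n, OF order_refl] by simp
next
  case (cons \<alpha> xs)
  have "pf_rep n (Suc (length xs)) (real (Suc (length xs)) * (fact (length xs) * (\<Prod>\<alpha>\<leftarrow>xs. \<Sum>l\<le>n. \<bar>of_int (\<alpha> l)\<bar>)) * (\<Sum>l\<le>n. \<bar>of_int (\<alpha> l)\<bar>))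
      (\<lambda>t. (\<Prod>\<alpha>\<leftarrow>xs. brick n \<alpha> t) * brick n \<alpha> t)"
    by (rule pf_rep_mult_brick[OF cons.IH order_refl])
  then show ?case by (simp add: mult_ac)
qed

text \<open>
  The function \<open>R\<close> of the header. The cubes are needed because the second derivative of \<open>R\<close> has
  to be summed as well: they make the zeros \<open>1, \<dots>, r n\<close> triple.
\<close>

definition rfun :: "nat \<Rightarrow> nat \<Rightarrow> nat \<Rightarrow> real \<Rightarrow> real" where
  "rfun a r n t = fact n ^ (a - 6 * r) * pochhammer (t - real (r * n)) (r * n) ^ 3
     * pochhammer (t + real n + 1) (r * n) ^ 3 / pochhammer t (Suc n) ^ a"

text \<open>Cutting the long product into r blocks of length n lets each block be paired with one
  copy of the denominator, which makes it a brick.\<close>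

lemma pochhammer_blocks_A:
  "pochhammer (t - real (r * n)) (r * n) = (\<Prod>q\<in>{1..r}. pochhammer (t - real (q * n)) n)"
proof (induction r)
  case (Suc r)
  have "pochhammer (t - real (Suc r * n)) (n + r * n) =
        pochhammer (t - real (Suc r * n)) n * pochhammer (t - real (Suc r * n) + real n) (r * n)"
    by (rule pochhammer_product')
  also have "t - real (Suc r * n) + real n = t - real (r * n)" by simp
  finally show ?case using Suc by (simp del: of_nat_mult)
qed auto

lemma pochhammer_blocks_B:
  "pochhammer (t + real n + 1) (r * n) = (\<Prod>q\<in>{1..r}. pochhammer (t + real (q * n) + 1) n)"
proof (induction r)
  case (Suc r)
  have "pochhammer (t + real n + 1) (r * n + n) =
        pochhammer (t + real n + 1) (r * n) * pochhammer (t + real n + 1 + real (r * n)) n"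
    by (rule pochhammer_product')
  also have "t + real n + 1 + real (r * n) = t + real (Suc r * n) + 1" by simp
  also have "r * n + n = Suc r * n" by simp
  finally show ?case using Suc by (simp del: of_nat_mult)
qed auto

lemma rfun_bricks:
  assumes t: "\<And>j. j \<le> n \<Longrightarrow> t + real j \<noteq> 0" and ar: "6 * r \<le> a"
  shows "rfun a r n t = (fact n / pochhammer t (Suc n)) ^ (a - 6 * r)
     * (\<Prod>q\<in>{1..r}. pochhammer (t - real (q * n)) n / pochhammer t (Suc n)) ^ 3
     * (\<Prod>q\<in>{1..r}. pochhammer (t + real (q * n) + 1) n / pochhammer t (Suc n)) ^ 3"
proof -
  have "a = (a - 6 * r) + r * 3 + r * 3" using ar by simp
  then have "pochhammer t (Suc n) ^ a = pochhammer t (Suc n) ^ (a - 6 * r) * (pochhammer t (Suc n) ^ r) ^ 3 * (pochhammer t (Suc n) ^ r) ^ 3"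
    by (metis power_add power_mult)
  then show ?thesis
    unfolding rfun_def pochhammer_blocks_A pochhammer_blocks_B prod_dividef
    by (simp add: power_divide)
qed

definition rbricks :: "nat \<Rightarrow> nat \<Rightarrow> nat \<Rightarrow> (nat \<Rightarrow> int) list" where
  "rbricks a r n = replicate (a - 6 * r) (coeff_F n) @
     concat (map (\<lambda>q. replicate 3 (coeff_A n q) @ replicate 3 (coeff_B n q)) [1..<Suc r])"

lemma length_rbricks: "6 * r \<le> a \<Longrightarrow> length (rbricks a r n) = a"
proof -
  have "length (concat (map (\<lambda>q. replicate 3 (coeff_A n q) @ replicate 3 (coeff_B n q)) [1..<Suc r])) = 6 * r"
    by (induction r) auto
  then show "6 * r \<le> a \<Longrightarrow> length (rbricks a r n) = a" by (simp add: rbricks_def)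
qed

lemma prod_list_rbricks:
  fixes f :: "_ \<Rightarrow> real"
  shows "(\<Prod>\<alpha>\<leftarrow>rbricks a r n. f \<alpha>) = f (coeff_F n) ^ (a - 6 * r)
    * (\<Prod>q\<in>{1..r}. f (coeff_A n q)) ^ 3 * (\<Prod>q\<in>{1..r}. f (coeff_B n q)) ^ 3"
proof -
  have "(\<Prod>\<alpha>\<leftarrow>concat (map (\<lambda>q. replicate 3 (coeff_A n q) @ replicate 3 (coeff_B n q)) [1..<Suc r]). f \<alpha>)
    = (\<Prod>q\<in>{1..r}. f (coeff_A n q)) ^ 3 * (\<Prod>q\<in>{1..r}. f (coeff_B n q)) ^ 3"
    by (induction r) (auto simp: prod_list_replicate power_mult_distrib mult_ac)
  then show ?thesis by (simp add: rbricks_def prod_list_replicate)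
qed

text \<open>The growth rate in n: 2 for each of the a bricks, and e (r + 1) from the binomial bound
  for each of the 6r bricks that carry a numerator block.\<close>

definition coeff_growth :: "nat \<Rightarrow> nat \<Rightarrow> real" where
  "coeff_growth a r = 2 ^ a * (exp 1 * real (Suc r)) ^ (6 * r)"

lemma pf_rep_rfun:
  assumes ar: "6 * r \<le> a" "a > 0"
  shows "pf_rep n a (fact a * coeff_growth a r ^ n) (rfun a r n)"
proof -
  define nrm :: "(nat \<Rightarrow> int) \<Rightarrow> real" where "nrm = (\<lambda>\<alpha>. \<Sum>l\<le>n. \<bar>of_int (\<alpha> l)\<bar>)"
  have "rbricks a r n \<noteq> []" using length_rbricks[OF ar(1), of n] ar(2) by auto
  from pf_rep_prod_list[OF this, of n]
  have "pf_rep n a (fact a * (\<Prod>\<alpha>\<leftarrow>rbricks a r n. nrm \<alpha>)) (\<lambda>t. \<Prod>\<alpha>\<leftarrow>rbricks a r n. brick n \<alpha> t)"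
    by (simp add: length_rbricks[OF ar(1)] nrm_def)
  then show ?thesis
  proof (rule pf_rep_cong)
    fix t assume t: "\<And>j. j \<le> n \<Longrightarrow> t + real j \<noteq> 0"
    show "rfun a r n t = (\<Prod>\<alpha>\<leftarrow>rbricks a r n. brick n \<alpha> t)"
    proof -
      have "fact n / pochhammer t (Suc n) = brick n (coeff_F n) t" by (rule brick_F) (rule t)
      moreover have "pochhammer (t - real (q * n)) n / pochhammer t (Suc n) = brick n (coeff_A n q) t"
        "pochhammer (t + real (q * n) + 1) n / pochhammer t (Suc n) = brick n (coeff_B n q) t" if "q \<in> {1..r}" for q
        using that t by (auto intro!: brick_A brick_B simp del: pochhammer_Suc of_nat_mult)
      moreover have "rfun a r n t = (fact n / pochhammer t (Suc n)) ^ (a - 6 * r)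
     * (\<Prod>q\<in>{1..r}. pochhammer (t - real (q * n)) n / pochhammer t (Suc n)) ^ 3
     * (\<Prod>q\<in>{1..r}. pochhammer (t + real (q * n) + 1) n / pochhammer t (Suc n)) ^ 3"
        by (rule rfun_bricks[OF _ ar(1)]) (rule t)
      ultimately show ?thesis unfolding prod_list_rbricks by simp
    qed
  next
    have nF: "nrm (coeff_F n) \<le> 2 ^ n"
      using brick_coeff_bound[of n "\<lambda>_. n" n 0] by (simp add: nrm_def coeff_F_def)
    define X where "X = (exp 1 * real (Suc r)) ^ n * 2 ^ n"
    have ch: "real ((Suc q * n) choose n) * 2 ^ n \<le> X" if "q \<le> r" for q
    proof -
      have "real ((Suc q * n) choose n) \<le> (exp 1 * real (Suc q)) ^ n" by (rule choose_mult_le)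
      also have "\<dots> \<le> (exp 1 * real (Suc r)) ^ n" using that by (intro power_mono mult_left_mono) auto
      finally show ?thesis by (simp add: X_def)
    qed
    have nA: "nrm (coeff_A n q) \<le> X" if "q \<in> {1..r}" for q
      using brick_coeff_bound[of n "\<lambda>j. j + q * n" "Suc q * n" n] ch[of q] that by (simp add: nrm_def coeff_A_def)
    have nB: "nrm (coeff_B n q) \<le> X" if "q \<in> {1..r}" for q
    proof -
      have "q * n + n - j \<le> Suc q * n" for j by simp
      from brick_coeff_bound[of n "\<lambda>j. q * n + n - j", OF this, of 0] show ?thesis
        using ch[of q] that by (simp add: nrm_def coeff_B_def)
    qed
    have n0: "nrm \<alpha> \<ge> 0" for \<alpha> by (simp add: nrm_def sum_nonneg)
    have X0: "X \<ge> 0" by (simp add: X_def)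
    have "(\<Prod>\<alpha>\<leftarrow>rbricks a r n. nrm \<alpha>) \<le> (2 ^ n) ^ (a - 6 * r) * (\<Prod>q\<in>{1..r}. X) ^ 3 * (\<Prod>q\<in>{1..r}. X) ^ 3"
      unfolding prod_list_rbricks using nF nA nB n0 X0
      by (intro mult_mono power_mono prod_mono mult_nonneg_nonneg zero_le_power prod_nonneg) auto
    also have "\<dots> = (2 ^ n) ^ (a - 6 * r) * X ^ (6 * r)"
      by (simp add: power_mult [symmetric] power_add [symmetric] mult.commute)
    also have "\<dots> = (2 ^ n) ^ (a - 6 * r + 6 * r) * ((exp 1 * real (Suc r)) ^ n) ^ (6 * r)"
      by (simp only: X_def power_mult_distrib power_add mult_ac)
    also have "\<dots> = coeff_growth a r ^ n"
      using ar by (simp add: coeff_growth_def power_mult_distrib power_mult [symmetric] mult.commute)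
    finally show "fact a * (\<Prod>\<alpha>\<leftarrow>rbricks a r n. nrm \<alpha>) \<le> fact a * coeff_growth a r ^ n" by simp
  qed
qed

text \<open>The reflection exchanges the two numerator products and maps the denominator product to
  itself up to sign. For even n the numerators keep their signs, and the n + 1 factors of each of
  the a denominators give one sign in total.\<close>

lemma rfun_antisym:
  assumes "even n" "odd a"
  shows "rfun a r n (- real n - t) = - rfun a r n t"
proof -
  have ev: "(-1) ^ (r * n) = (1::real)" using assms by simp
  have 1: "pochhammer (- real n - t - real (r * n)) (r * n) = pochhammer (t + real n + 1) (r * n)"
  proof -
    have e: "- real n - t - real (r * n) = - (t + real n + real (r * n))" by simp
    show ?thesis unfolding e pochhammer_minus ev by simp
  qed
  have 2: "pochhammer (- real n - t + real n + 1) (r * n) = pochhammer (t - real (r * n)) (r * n)"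
  proof -
    have "- real n - t + real n + 1 = - (t - 1)" by simp
    then show ?thesis using pochhammer_minus[of "t - 1" "r * n"] unfolding ev by simp
  qed
  have 3: "pochhammer (- real n - t) (Suc n) = - pochhammer t (Suc n)"
  proof -
    have e: "- real n - t = - (t + real n)" "(-1) ^ Suc n = (-1::real)" "t + real n - real (Suc n) + 1 = t" using assms by simp_all
    show ?thesis unfolding e(1) pochhammer_minus e(2,3) by (simp del: pochhammer_Suc)
  qed
  show ?thesis unfolding rfun_def 1 2 3 using assms(2) by (simp add: mult_ac)
qed

section \<open>Upper bounds for R to the right of its zeros\<close>

lemma pochhammer_mono_real:
  fixes x y :: real
  assumes "0 \<le> x" "x \<le> y"
  shows "pochhammer x m \<le> pochhammer y m"
  unfolding pochhammer_prod using assms by (intro prod_mono) auto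

lemma pochhammer_ge_power: "0 \<le> (x::real) \<Longrightarrow> x ^ m \<le> pochhammer x m"
  unfolding pochhammer_prod using prod_mono[of "{0..<m}" "\<lambda>_. x" "\<lambda>i. x + real i"] by simp

lemma pochhammer_le_power: "0 \<le> (x::real) \<Longrightarrow> pochhammer x m \<le> (x + real m) ^ m"
  unfolding pochhammer_prod using prod_mono[of "{0..<m}" "\<lambda>i. x + real i" "\<lambda>_. x + real m"] by simp

text \<open>For \<open>t \<ge> M n\<close> each factor \<open>n! / (t)\<^sub>n\<^sub>+\<^sub>1\<close> is at most \<open>M\<^sup>-\<^sup>n / t\<close>; each of the other bricks are at most \<open>3\<^sup>n / t\<close>.\<close>

lemma rfun_upper:
  assumes ar: "6 * r \<le> a" and r: "r \<ge> 1" and n: "n \<ge> 1" and M: "M \<ge> real r" and t: "t \<ge> M * real n"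
  shows "0 \<le> rfun a r n t" "rfun a r n t \<le> ((1 / M) ^ (a - 6 * r) * 27 ^ r) ^ n / t ^ a"
proof -
  have M0: "M \<ge> 1" using M r by linarith
  have "M * real n \<ge> real r * real n" using M by (intro mult_right_mono) auto
  then have trn: "t \<ge> real (r * n)" using t by simp
  have "r * n \<ge> 1" using r n by (metis One_nat_def Suc_leI mult_pos_pos less_le_trans zero_less_one)
  then have t0: "t > 0" using trn by linarith
  have tp: "t + real j \<noteq> 0" for j using t0 by linarith
  have Q: "pochhammer t (Suc n) > 0" "t * t ^ n \<le> pochhammer t (Suc n)"
    using pochhammer_pos[OF t0] pochhammer_ge_power[of t "Suc n"] t0 by (auto simp del: pochhammer_Suc)
  have F: "0 \<le> fact n / pochhammer t (Suc n)" "fact n / pochhammer t (Suc n) \<le> (1 / M) ^ n / t"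
  proof -
    have "fact n \<le> (real n) ^ n" using fact_le_power[of n, where ?'a = real] by simp
    also have "\<dots> \<le> (t / M) ^ n" using t M0 by (intro power_mono) (auto simp: field_simps)
    finally have fl: "fact n \<le> (t / M) ^ n" .
    show "fact n / pochhammer t (Suc n) \<le> (1 / M) ^ n / t"
    proof -
      have "fact n / pochhammer t (Suc n) \<le> (t / M) ^ n / (t * t ^ n)"
        using fl Q t0 M0 by (intro frac_le) auto
      also have "\<dots> = (1 / M) ^ n / t" using t0 by (simp add: power_divide)
      finally show ?thesis .
    qed
    show "0 \<le> fact n / pochhammer t (Suc n)" using Q(1) by simp
  qed
  have A: "0 \<le> pochhammer (t - real (q * n)) n / pochhammer t (Suc n)"
     "pochhammer (t - real (q * n)) n / pochhammer t (Suc n) \<le> 1 / t" if q: "q \<in> {1..r}" for q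
  proof -
    have "real (q * n) \<le> real (r * n)" using q by (intro of_nat_mono mult_le_mono) auto
    then have tq: "t - real (q * n) \<ge> 0" using trn by linarith
    have "pochhammer (t - real (q * n)) n \<ge> 0" unfolding pochhammer_prod using tq by (intro prod_nonneg) auto
    then show "0 \<le> pochhammer (t - real (q * n)) n / pochhammer t (Suc n)" using Q(1) by simp
    have "pochhammer (t - real (q * n)) n * t \<le> pochhammer t n * (t + real n)"
      using tq t0 by (intro mult_mono pochhammer_mono_real pochhammer_nonneg) auto
    then show "pochhammer (t - real (q * n)) n / pochhammer t (Suc n) \<le> 1 / t"
      using Q(1) t0 by (simp add: divide_simps pochhammer_Suc)
  qed
  have B: "0 \<le> pochhammer (t + real (q * n) + 1) n / pochhammer t (Suc n)"
     "pochhammer (t + real (q * n) + 1) n / pochhammer t (Suc n) \<le> 3 ^ n / t" if q: "q \<in> {1..r}" for q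
  proof -
    show "0 \<le> pochhammer (t + real (q * n) + 1) n / pochhammer t (Suc n)"
      using Q(1) t0 by (intro divide_nonneg_pos pochhammer_nonneg add_pos_nonneg) auto
    have qn: "real (q * n) \<le> real (r * n)" using q by (intro of_nat_mono mult_le_mono) auto
    have nr: "real n \<le> real (r * n)" using r by (simp add: mult_le_cancel_right1)
    have "pochhammer (t + real (q * n) + 1) n = (\<Prod>i\<in>{0..<n}. t + real (q * n) + 1 + real i)"
      by (simp add: pochhammer_prod)
    also have "\<dots> \<le> (\<Prod>i\<in>{0..<n}. 3 * t)"
    proof (intro prod_mono conjI)
      fix i assume "i \<in> {0..<n}"
      then have "1 + real i \<le> real n" by auto
      then show "t + real (q * n) + 1 + real i \<le> 3 * t" using qn nr trn by linarith
    qed (use t0 in auto)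
    also have "\<dots> = 3 ^ n * t ^ n" by (simp add: power_mult_distrib)
    finally have "pochhammer (t + real (q * n) + 1) n / pochhammer t (Suc n) \<le> (3 ^ n * t ^ n) / (t * t ^ n)"
      using Q t0 by (intro frac_le) auto
    then show "pochhammer (t + real (q * n) + 1) n / pochhammer t (Suc n) \<le> 3 ^ n / t"
      using t0 by simp
  qed
  note eq = rfun_bricks[OF tp ar]
  show "0 \<le> rfun a r n t"
    unfolding eq using F(1) A(1) B(1) by (intro mult_nonneg_nonneg zero_le_power prod_nonneg) auto
  have "rfun a r n t \<le> ((1 / M) ^ n / t) ^ (a - 6 * r) * (\<Prod>q\<in>{1..r}. 1 / t) ^ 3 * (\<Prod>q\<in>{1..r}. 3 ^ n / t) ^ 3"
    unfolding eq using F A B t0 M0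
    by (intro mult_mono power_mono prod_mono mult_nonneg_nonneg zero_le_power prod_nonneg) auto
  also have "\<dots> = ((1 / M) ^ n) ^ (a - 6 * r) * ((3 ^ n) ^ r) ^ 3 / (t ^ (a - 6 * r) * (t ^ r) ^ 3 * (t ^ r) ^ 3)"
    by (simp add: power_divide power_mult_distrib)
  also have "t ^ (a - 6 * r) * (t ^ r) ^ 3 * (t ^ r) ^ 3 = t ^ a"
    unfolding power_mult [symmetric] power_add [symmetric] using ar by (intro arg_cong[of _ _ "\<lambda>k. t ^ k"]) simp
  also have "((3 ^ n) ^ r) ^ 3 = ((27::real) ^ r) ^ n"
  proof -
    have "(27::real) = 3 ^ 3" by simp
    then show ?thesis by (simp only: power_mult [symmetric] mult_ac)
  qed
  also have "((1 / M) ^ n) ^ (a - 6 * r) * (27 ^ r) ^ n = ((1 / M) ^ (a - 6 * r) * 27 ^ r) ^ n"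
    by (simp only: power_mult_distrib power_mult [symmetric] mult_ac)
  finally show "rfun a r n t \<le> ((1 / M) ^ (a - 6 * r) * 27 ^ r) ^ n / t ^ a" .
qed

section \<open>Its logarithmic and second derivatives\<close>

text \<open>The logarithmic derivative of \<open>pochhammer (t + c) m\<close>; its own derivative is
  \<open>inv_sum'\<close>.\<close>

definition inv_sum :: "real \<Rightarrow> nat \<Rightarrow> real \<Rightarrow> real" where
  "inv_sum c m t = (\<Sum>i<m. 1 / (t + c + real i))"

definition inv_sum' :: "real \<Rightarrow> nat \<Rightarrow> real \<Rightarrow> real" where
  "inv_sum' c m t = (\<Sum>i<m. - (1 / (t + c + real i) ^ 2))"

lemma inv_sum_deriv:
  assumes "t + c > 0"
  shows "(inv_sum c m has_real_derivative inv_sum' c m t) (at t)"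
  unfolding inv_sum_def inv_sum'_def
proof (rule DERIV_sum)
  fix i
  have "t + c + real i \<noteq> 0" using assms by linarith
  then show "((\<lambda>t. 1 / (t + c + real i)) has_real_derivative - (1 / (t + c + real i) ^ 2)) (at t)"
    by (auto intro!: derivative_eq_intros simp: power2_eq_square)
qed

lemma pochhammer_deriv:
  assumes "t + c > 0"
  shows "((\<lambda>t. pochhammer (t + c) m) has_real_derivative pochhammer (t + c) m * inv_sum c m t) (at t)"
proof (induction m)
  case (Suc m)
  have nz: "t + c + real m \<noteq> 0" using assms by linarith
  have "((\<lambda>t. pochhammer (t + c) m * (t + c + real m)) has_real_derivative
      (pochhammer (t + c) m * inv_sum c m t) * (t + c + real m) + pochhammer (t + c) m * 1) (at t)"
    by (rule derivative_eq_intros Suc refl | simp)+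
  moreover have "(pochhammer (t + c) m * inv_sum c m t) * (t + c + real m) + pochhammer (t + c) m * 1 =
     pochhammer (t + c) (Suc m) * inv_sum c (Suc m) t"
    using nz by (simp add: pochhammer_Suc inv_sum_def field_simps)
  ultimately show ?case by (simp add: pochhammer_Suc)
qed (simp add: inv_sum_def)

text \<open>This is R' / R for t > r n.\<close>

definition rlog :: "nat \<Rightarrow> nat \<Rightarrow> nat \<Rightarrow> real \<Rightarrow> real" where
  "rlog a r n t = 3 * inv_sum (- real (r * n)) (r * n) t + 3 * inv_sum (real n + 1) (r * n) t - real a * inv_sum 0 (Suc n) t"

definition rlog' :: "nat \<Rightarrow> nat \<Rightarrow> nat \<Rightarrow> real \<Rightarrow> real" where
  "rlog' a r n t = 3 * inv_sum' (- real (r * n)) (r * n) t + 3 * inv_sum' (real n + 1) (r * n) t - real a * inv_sum' 0 (Suc n) t"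

lemma rlog_deriv:
  assumes "t > real (r * n)"
  shows "(rlog a r n has_real_derivative rlog' a r n t) (at t)"
proof -
  have "t > 0" using assms by (meson of_nat_0_le_iff order_le_less_trans)
  show ?thesis
    unfolding rlog_def rlog'_def
    by (intro DERIV_add DERIV_diff DERIV_cmult inv_sum_deriv) (use assms \<open>t > 0\<close> in auto)
qed

text \<open>Derivatives are kept in the form function times logarithmic derivative, so that products
  merely add and powers multiply the second factor.\<close>

lemma power_deriv_log:
  assumes "(f has_real_derivative f t * u) (at t)"
  shows "((\<lambda>t. f t ^ k) has_real_derivative f t ^ k * (real k * u)) (at t)"
  using DERIV_power[OF assms, of k] by (cases k) (simp_all add: mult_ac)

lemma mult_deriv_log:
  assumes "(f has_real_derivative f t * u) (at t)" "(g has_real_derivative g t * v) (at t)"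
  shows "((\<lambda>t. f t * g t) has_real_derivative (f t * g t) * (u + v)) (at t)"
  using DERIV_mult[OF assms] by (simp add: algebra_simps)

lemma inverse_deriv_log:
  assumes "(f has_real_derivative f t * u) (at t)" "f t \<noteq> 0"
  shows "((\<lambda>t. inverse (f t)) has_real_derivative (inverse (f t)) * (- u)) (at t)"
  using DERIV_inverse_fun[OF assms] assms(2) by (simp add: field_simps)

text \<open>R without the cubed factor that vanishes at 1, ..., r n. It has a logarithmic derivative
  for all t > 0, so R can be differentiated at those zeros too.\<close>

definition rtail :: "nat \<Rightarrow> nat \<Rightarrow> nat \<Rightarrow> real \<Rightarrow> real" where
  "rtail a r n t = fact n ^ (a - 6 * r) * (pochhammer (t + (real n + 1)) (r * n) ^ 3 * inverse (pochhammer (t + 0) (Suc n) ^ a))"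

lemma rfun_eq_rtail: "rfun a r n t = pochhammer (t + (- real (r * n))) (r * n) ^ 3 * rtail a r n t"
  by (simp add: rfun_def rtail_def field_simps del: pochhammer_Suc)

definition rtail_log :: "nat \<Rightarrow> nat \<Rightarrow> nat \<Rightarrow> real \<Rightarrow> real" where
  "rtail_log a r n t = real 3 * inv_sum (real n + 1) (r * n) t + - (real a * inv_sum 0 (Suc n) t)"

lemma rtail_deriv:
  assumes "t > 0"
  shows "(rtail a r n has_real_derivative rtail a r n t * rtail_log a r n t) (at t)"
proof -
  have "pochhammer (t + 0) (Suc n) ^ a \<noteq> 0"
    using pochhammer_pos[OF assms] by (simp del: pochhammer_Suc add: less_imp_neq[symmetric])
  then have "((\<lambda>t. pochhammer (t + (real n + 1)) (r * n) ^ 3 * inverse (pochhammer (t + 0) (Suc n) ^ a)) has_real_derivative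
     (pochhammer (t + (real n + 1)) (r * n) ^ 3 * inverse (pochhammer (t + 0) (Suc n) ^ a)) * rtail_log a r n t) (at t)"
    unfolding rtail_log_def using assms
    by (intro mult_deriv_log inverse_deriv_log power_deriv_log pochhammer_deriv) auto
  from DERIV_cmult[OF this, of "fact n ^ (a - 6 * r)"] show ?thesis
    unfolding rtail_def [abs_def] by (simp only: mult.assoc)
qed

lemma rfun_deriv:
  assumes "t > real (r * n)"
  shows "(rfun a r n has_real_derivative rfun a r n t * rlog a r n t) (at t)"
proof -
  have t0: "t > 0" using assms by (meson of_nat_0_le_iff order_le_less_trans)
  have "((\<lambda>t. pochhammer (t + (- real (r * n))) (r * n) ^ 3 * rtail a r n t) has_real_derivative
     (pochhammer (t + (- real (r * n))) (r * n) ^ 3 * rtail a r n t) * (real 3 * inv_sum (- real (r * n)) (r * n) t + rtail_log a r n t)) (at t)"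
    using assms by (intro mult_deriv_log power_deriv_log pochhammer_deriv rtail_deriv t0) auto
  moreover have "real 3 * inv_sum (- real (r * n)) (r * n) t + rtail_log a r n t = rlog a r n t"
    by (simp add: rlog_def rtail_log_def)
  ultimately show ?thesis unfolding rfun_eq_rtail [abs_def] by (simp only:)
qed

text \<open>Half the second derivative of \<open>pf_eval\<close>.\<close>

definition pf_eval2 :: "nat \<Rightarrow> nat \<Rightarrow> (nat \<Rightarrow> nat \<Rightarrow> real) \<Rightarrow> real \<Rightarrow> real" where
  "pf_eval2 n s c t = (\<Sum>i\<in>{1..s}. \<Sum>j\<le>n. real (Suc i choose 2) * c i j / (t + real j) ^ (i + 2))"

lemma inverse_power_deriv:
  fixes x :: real
  assumes "t + x \<noteq> 0"
  shows "((\<lambda>t. c / (t + x) ^ i) has_real_derivative (- (real i * c) / (t + x) ^ Suc i)) (at t)"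
proof -
  have "((\<lambda>t. t + x) has_real_derivative (t + x) * (1 / (t + x))) (at t)"
    using assms by (auto intro!: derivative_eq_intros)
  then have "((\<lambda>t. c * inverse ((t + x) ^ i)) has_real_derivative
     c * (inverse ((t + x) ^ i) * (- (real i * (1 / (t + x)))))) (at t)"
    using assms by (intro DERIV_cmult inverse_deriv_log power_deriv_log) auto
  moreover have "c * (inverse ((t + x) ^ i) * (- (real i * (1 / (t + x))))) = (- (real i * c) / (t + x) ^ Suc i)"
    using assms by (simp add: field_simps)
  ultimately show ?thesis by (simp only: divide_inverse[of c])
qed

text \<open>Differentiating (t + j)^(-i) twice gives the factor i (i + 1), which is twice the
  binomial coefficient in \<open>pf_eval2\<close>; this 2 cancels the one in front of
  \<open>f\<close>.\<close>

lemma pf_eval_second_deriv: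
  assumes op: "open A" and t: "t \<in> A" and A: "A \<subseteq> {0<..}"
    and d1: "\<And>t. t \<in> A \<Longrightarrow> (f has_real_derivative f1 t) (at t)"
    and eq: "\<And>t. t \<in> A \<Longrightarrow> 2 * f t = pf_eval n s c t"
    and d2: "(f1 has_real_derivative f2) (at t)"
  shows "pf_eval2 n s c t = f2"
proof -
  define g where "g = (\<lambda>t. \<Sum>i\<in>{1..s}. \<Sum>j\<le>n. - (real i * c i j) / (t + real j) ^ Suc i)"
  have g: "(pf_eval n s c has_real_derivative g t) (at t)" if "t > 0" for t
    unfolding pf_eval_def [abs_def] g_def using that
    by (intro DERIV_sum inverse_power_deriv) (metis add_pos_nonneg of_nat_0_le_iff less_irrefl)
  have gf: "g t = 2 * f1 t" if "t \<in> A" for t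
  proof -
    have "((\<lambda>t. 2 * f t) has_real_derivative 2 * f1 t) (at t)" by (rule DERIV_cmult[OF d1[OF that]])
    then have "(pf_eval n s c has_real_derivative 2 * f1 t) (at t)"
      by (rule has_field_derivative_transform_within_open[OF _ op that]) (rule eq)
    moreover have "t > 0" using that A by auto
    ultimately show ?thesis using g DERIV_unique by blast
  qed
  have "t > 0" using t A by auto
  have "(g has_real_derivative (\<Sum>i\<in>{1..s}. \<Sum>j\<le>n. - (real (Suc i) * - (real i * c i j)) / (t + real j) ^ Suc (Suc i))) (at t)"
    unfolding g_def using \<open>t > 0\<close>
    by (intro DERIV_sum inverse_power_deriv) (metis add_pos_nonneg of_nat_0_le_iff less_irrefl)
  moreover have "((\<lambda>t. 2 * f1 t) has_real_derivative 2 * f2) (at t)" by (rule DERIV_cmult[OF d2])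
  then have "(g has_real_derivative 2 * f2) (at t)"
    by (rule has_field_derivative_transform_within_open[OF _ op t]) (simp add: gf)
  ultimately have "(\<Sum>i\<in>{1..s}. \<Sum>j\<le>n. - (real (Suc i) * - (real i * c i j)) / (t + real j) ^ Suc (Suc i)) = 2 * f2"
    by (rule DERIV_unique)
  moreover have "(\<Sum>i\<in>{1..s}. \<Sum>j\<le>n. - (real (Suc i) * - (real i * c i j)) / (t + real j) ^ Suc (Suc i)) = 2 * pf_eval2 n s c t"
    unfolding pf_eval2_def sum_distrib_left
  proof (intro sum.cong refl)
    fix i j
    have "2 * (Suc i choose 2) = Suc i * i"
      using choose_two[of "Suc i"] by simp
    then have "2 * real (Suc i choose 2) = real (Suc i) * real i"
      by (metis of_nat_mult of_nat_numeral)
    then have "- (real (Suc i) * - (real i * c i j)) = 2 * (real (Suc i choose 2) * c i j)" by simp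
    then show "- (real (Suc i) * - (real i * c i j)) / (t + real j) ^ Suc (Suc i) = 2 * (real (Suc i choose 2) * c i j / (t + real j) ^ (i + 2))"
      by simp
  qed
  ultimately show ?thesis by simp
qed

lemma rfun_second_deriv:
  assumes c: "\<And>t. t > 0 \<Longrightarrow> 2 * rfun a r n t = pf_eval n s c t" and t: "t > real (r * n)"
  shows "pf_eval2 n s c t = rfun a r n t * (rlog a r n t ^ 2 + rlog' a r n t)"
proof (rule pf_eval_second_deriv[of "{real (r * n)<..}"])
  show sub: "{real (r * n)<..} \<subseteq> {0<..}"
  proof (rule subsetI)
    fix x :: real assume "x \<in> {real (r * n)<..}"
    moreover have "0 \<le> real (r * n)" by (rule of_nat_0_le_iff)
    ultimately show "x \<in> {0<..}" by (simp only: greaterThan_iff)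
  qed
  show "2 * rfun a r n t = pf_eval n s c t" if "t \<in> {real (r * n)<..}" for t
    by (rule c) (use subsetD[OF sub that] in simp)
  show "(rfun a r n has_real_derivative rfun a r n t * rlog a r n t) (at t)" if "t \<in> {real (r * n)<..}" for t
    using that by (intro rfun_deriv) auto
  have "((\<lambda>t. rfun a r n t * rlog a r n t) has_real_derivative
     (rfun a r n t * rlog a r n t) * rlog a r n t + rlog' a r n t * rfun a r n t) (at t)"
    by (rule DERIV_mult[OF rfun_deriv[OF t] rlog_deriv[OF t]])
  then show "((\<lambda>t. rfun a r n t * rlog a r n t) has_real_derivative rfun a r n t * (rlog a r n t ^ 2 + rlog' a r n t)) (at t)"
    by (simp add: algebra_simps power2_eq_square)
qed (use t in auto)

lemma rfun_zeros:
  assumes "1 \<le> k" "k \<le> r * n"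
  shows "rfun a r n (real k) = 0"
proof -
  have "pochhammer (real k - real (r * n)) (r * n) = 0"
    unfolding pochhammer_eq_0_iff using assms by (intro exI[of _ "r * n - k"]) (auto simp: of_nat_diff)
  then show ?thesis by (simp add: rfun_def)
qed

text \<open>Writing R as p^3 times a smooth factor, R' is p^2 times a differentiable function, so
  R'' still vanishes at the zeros of p.\<close>

lemma rfun_second_deriv_zeros:
  assumes c: "\<And>t. t > 0 \<Longrightarrow> 2 * rfun a r n t = pf_eval n s c t" and k: "1 \<le> k" "k \<le> r * n"
  shows "pf_eval2 n s c (real k) = 0"
proof (rule pf_eval_second_deriv[of "{0<..}"])
  define p where "p = (\<Prod>i<r * n. [:- real (r * n) + real i, 1:])"
  have p: "pochhammer (t + (- real (r * n))) (r * n) = poly p t" for t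
    unfolding p_def poly_prod_linear ..
  have pk: "poly p (real k) = 0"
    unfolding p [symmetric] pochhammer_eq_0_iff using k by (intro exI[of _ "r * n - k"]) (auto simp: of_nat_diff)
  define m where "m = (\<lambda>t. 3 * poly (pderiv p) t * rtail a r n t + poly p t * (rtail a r n t * rtail_log a r n t))"
  show "(rfun a r n has_real_derivative poly p t ^ 2 * m t) (at t)" if "t \<in> {0<..}" for t
  proof -
    have "((\<lambda>t. poly p t ^ 3 * rtail a r n t) has_real_derivative
      (of_nat 3 * (poly (pderiv p) t * poly p t ^ (3 - Suc 0))) * rtail a r n t + (rtail a r n t * rtail_log a r n t) * poly p t ^ 3) (at t)"
      using that by (intro DERIV_mult DERIV_power poly_DERIV rtail_deriv) auto
    moreover have "(of_nat 3 * (poly (pderiv p) t * poly p t ^ (3 - 1))) * rtail a r n t + (rtail a r n t * rtail_log a r n t) * poly p t ^ 3 = poly p t ^ 2 * m t"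
      by (simp add: m_def algebra_simps power2_eq_square power3_eq_cube)
    ultimately show ?thesis unfolding rfun_eq_rtail [abs_def] p by simp
  qed
  have k0: "real k > 0" using k by simp
  have "rtail_log a r n differentiable (at (real k))"
    unfolding rtail_log_def [abs_def]
    using inv_sum_deriv[of "real k" "real n + 1" "r * n"] inv_sum_deriv[of "real k" 0 "Suc n"] k0
    by (intro differentiable_add differentiable_minus differentiable_mult differentiable_const)
       (auto simp: real_differentiable_def)
  moreover have "rtail a r n differentiable (at (real k))"
    using rtail_deriv[OF k0] by (auto simp: real_differentiable_def)
  moreover have "poly q differentiable (at (real k))" for q
    using poly_DERIV[of q "real k"] unfolding real_differentiable_def by blast
  ultimately have "m differentiable (at (real k))"
    unfolding m_def by (intro differentiable_add differentiable_mult differentiable_const)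
  then obtain m' where "(m has_real_derivative m') (at (real k))" by (auto simp: real_differentiable_def)
  then have "((\<lambda>t. poly p t ^ 2 * m t) has_real_derivative
     (of_nat 2 * (poly (pderiv p) (real k) * poly p (real k) ^ (2 - Suc 0))) * m (real k) + m' * poly p (real k) ^ 2) (at (real k))"
    by (intro DERIV_mult DERIV_power poly_DERIV)
  then show "((\<lambda>t. poly p t ^ 2 * m t) has_real_derivative 0) (at (real k))" by (simp add: pk)
qed (use k c in auto)

section \<open>Bounds for the logarithmic derivative\<close>

lemma sum_inverse_ge_ln:
  assumes "y > 0"
  shows "(\<Sum>i<N. 1 / (y + real i)) \<ge> ln ((y + real N) / y)"
proof (induction N)
  case (Suc N)
  have pos: "y + real N > 0" "y + real (Suc N) > 0" using assms by auto
  have "ln ((y + real (Suc N)) / y) = ln ((y + real N) / y) + ln ((y + real (Suc N)) / (y + real N))"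
    using pos assms by (simp add: ln_div)
  also have "ln ((y + real (Suc N)) / (y + real N)) \<le> (y + real (Suc N)) / (y + real N) - 1"
    using pos by (intro ln_le_minus_one divide_pos_pos) auto
  also have "\<dots> = 1 / (y + real N)" using pos by (simp add: field_simps)
  finally show ?case using Suc by simp
qed (use assms in auto)

lemma inv_sum_bounds:
  assumes "t + c \<ge> d" "d > 0"
  shows "0 \<le> inv_sum c m t" "inv_sum c m t \<le> real m / d" "\<bar>inv_sum' c m t\<bar> \<le> real m / d ^ 2"
proof -
  have p: "t + c + real i \<ge> d" for i using assms by (simp add: add_increasing2)
  have p0: "t + c + real i > 0" for i using p[of i] assms by linarith
  show "0 \<le> inv_sum c m t" unfolding inv_sum_def using p0 by (intro sum_nonneg) (simp add: less_imp_le)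
  have "inv_sum c m t \<le> (\<Sum>i<m. 1 / d)" unfolding inv_sum_def
    using p p0 assms(2) by (intro sum_mono frac_le) auto
  then show "inv_sum c m t \<le> real m / d" by simp
  have "\<bar>inv_sum' c m t\<bar> \<le> (\<Sum>i<m. 1 / d ^ 2)" unfolding inv_sum'_def
  proof (intro order_trans[OF sum_abs] sum_mono)
    fix i
    have "1 / (t + c + real i) ^ 2 \<le> 1 / d ^ 2"
      using p[of i] p0[of i] assms(2) by (intro frac_le power_mono) auto
    then show "\<bar>- (1 / (t + c + real i) ^ 2)\<bar> \<le> 1 / d ^ 2" by simp
  qed
  then show "\<bar>inv_sum' c m t\<bar> \<le> real m / d ^ 2" by simp
qed

text \<open>To the right of r n all denominators at integers are at least 1, so counting terms
  suffices. This crude bound is applied where R itself is exponentially small.\<close>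

lemma rlog_crude:
  assumes n: "n \<ge> 1" and k: "k > r * n"
  shows "\<bar>rlog a r n (real k)\<bar> \<le> real ((6 * r + 2 * a) * n)" "\<bar>rlog' a r n (real k)\<bar> \<le> real ((6 * r + 2 * a) * n)"
proof -
  have k1: "real k \<ge> real (r * n) + 1" using k by (simp flip: of_nat_mult)
  then have k2: "real k + - real (r * n) \<ge> 1" "real k + (real n + 1) \<ge> 1" "real k + 0 \<ge> 1"
    using of_nat_0_le_iff[of "r * n", where ?'a = real] by linarith+
  note b1 = inv_sum_bounds[OF k2(1) zero_less_one, of "r * n", unfolded div_by_1 power_one]
  note b2 = inv_sum_bounds[OF k2(2) zero_less_one, of "r * n", unfolded div_by_1 power_one]
  note b3 = inv_sum_bounds[OF k2(3) zero_less_one, of "Suc n", unfolded div_by_1 power_one]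
  have n2: "real (Suc n) \<le> 2 * real n" using n by simp
  have E: "real ((6 * r + 2 * a) * n) = 3 * real (r * n) + 3 * real (r * n) + real a * (2 * real n)"
    by (simp add: algebra_simps)
  have "real a * inv_sum 0 (Suc n) (real k) \<le> real a * (2 * real n)"
    using b3 n2 by (intro mult_left_mono) auto
  moreover have "0 \<le> real a * inv_sum 0 (Suc n) (real k)" using b3 by simp
  moreover have "0 \<le> real a * (2 * real n)" by simp
  ultimately show "\<bar>rlog a r n (real k)\<bar> \<le> real ((6 * r + 2 * a) * n)"
    unfolding rlog_def E using b1(1,2) b2(1,2) by linarith
  have "real a * \<bar>inv_sum' 0 (Suc n) (real k)\<bar> \<le> real a * (2 * real n)"
    using b3 n2 by (intro mult_left_mono) auto
  then have "\<bar>real a * inv_sum' 0 (Suc n) (real k)\<bar> \<le> real a * (2 * real n)" by (simp add: abs_mult)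
  then show "\<bar>rlog' a r n (real k)\<bar> \<le> real ((6 * r + 2 * a) * n)"
    unfolding rlog'_def E using b1(3) b2(3) by linarith
qed

text \<open>Beyond the distance \<epsilon> n from r n, every sum in \<open>rlog'\<close> has O(n)
  terms of size O(1 / n^2).\<close>

lemma rlog'_bound:
  assumes n: "n \<ge> 1" and r: "r \<ge> 1" and \<epsilon>: "\<epsilon> > 0" and t: "t \<ge> (real r + \<epsilon>) * real n"
  shows "\<bar>rlog' a r n t\<bar> \<le> (3 * real r / \<epsilon> ^ 2 + 3 * real r + 2 * real a) / real n"
proof -
  have n0: "real n > 0" using n by simp
  have rn: "real r * real n \<ge> real n" using r n by simp
  have en: "\<epsilon> * real n > 0" using \<epsilon> n0 by simp
  have t': "t \<ge> real r * real n + \<epsilon> * real n" using t by (simp add: algebra_simps)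
  have k2: "t + - real (r * n) \<ge> \<epsilon> * real n" "t + (real n + 1) \<ge> real n" "t + 0 \<ge> real n"
    using t' rn en by auto
  have b1: "\<bar>inv_sum' (- real (r * n)) (r * n) t\<bar> \<le> (real r / \<epsilon> ^ 2) / real n"
    using inv_sum_bounds(3)[OF k2(1) en, of "r * n"] n0 \<epsilon> by (simp add: field_simps power2_eq_square)
  have b2: "\<bar>inv_sum' (real n + 1) (r * n) t\<bar> \<le> real r / real n"
    using inv_sum_bounds(3)[OF k2(2) n0, of "r * n"] n0 by (simp add: field_simps power2_eq_square)
  have b3: "\<bar>inv_sum' 0 (Suc n) t\<bar> \<le> 2 / real n"
  proof -
    have "real (Suc n) / real n ^ 2 \<le> (2 * real n) / real n ^ 2" using n by (intro divide_right_mono) auto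
    also have "\<dots> = 2 / real n" using n0 by (simp add: power2_eq_square)
    finally show ?thesis using inv_sum_bounds(3)[OF k2(3) n0, of "Suc n"] by linarith
  qed
  have b3': "\<bar>real a * inv_sum' 0 (Suc n) t\<bar> \<le> real a * (2 / real n)"
    unfolding abs_mult abs_of_nat by (rule mult_left_mono[OF b3]) simp
  have "(3 * real r / \<epsilon> ^ 2 + 3 * real r + 2 * real a) / real n = 3 * ((real r / \<epsilon> ^ 2) / real n) + 3 * (real r / real n) + real a * (2 / real n)"
    by (simp add: add_divide_distrib)
  then show ?thesis unfolding rlog'_def using b1 b2 b3' by linarith
qed

text \<open>Within 2 \<epsilon> n to the right of r n the nearby zeros contribute at least 3 ln (1 +
  r / (2 \<epsilon>)), whereas the poles take away at most 2a / r.\<close>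

lemma rlog_left:
  assumes n: "n \<ge> 1" and r: "r \<ge> 1" and \<epsilon>: "\<epsilon> > 0" and big: "3 * ln (1 + real r / (2 * \<epsilon>)) \<ge> 2 * real a / real r + 1"
    and t: "real (r * n) < t" "t \<le> (real r + 2 * \<epsilon>) * real n"
  shows "rlog a r n t \<ge> 1"
proof -
  have n0: "real n > 0" using n by simp
  have rn: "real (r * n) > 0" using r n by simp
  define y where "y = t - real (r * n)"
  have y: "0 < y" "y \<le> 2 * \<epsilon> * real n" using t by (auto simp: y_def algebra_simps)
  have "inv_sum (- real (r * n)) (r * n) t = (\<Sum>i<r * n. 1 / (y + real i))"
    by (simp add: inv_sum_def y_def)
  then have 1: "inv_sum (- real (r * n)) (r * n) t \<ge> ln ((y + real (r * n)) / y)"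
    using sum_inverse_ge_ln[OF y(1), of "r * n"] by simp
  have "1 + real r / (2 * \<epsilon>) = 1 + real (r * n) / (2 * \<epsilon> * real n)" using n0 by simp
  also have "\<dots> \<le> 1 + real (r * n) / y" using y rn by (intro add_left_mono frac_le) auto
  also have "\<dots> = (y + real (r * n)) / y" using y by (simp add: field_simps)
  finally have 2: "ln (1 + real r / (2 * \<epsilon>)) \<le> ln ((y + real (r * n)) / y)"
    using \<epsilon> by (intro ln_mono) (auto intro!: add_pos_nonneg)
  have t0: "t + (real n + 1) \<ge> 1" "t + 0 \<ge> real (r * n)" using t rn by auto
  have 3: "inv_sum (real n + 1) (r * n) t \<ge> 0" using inv_sum_bounds(1)[OF t0(1)] by simp
  have "inv_sum 0 (Suc n) t \<le> real (Suc n) / real (r * n)" using inv_sum_bounds(2)[OF t0(2) rn] .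
  also have "\<dots> \<le> (2 * real n) / real (r * n)" using n by (intro divide_right_mono) auto
  also have "\<dots> = 2 / real r" using n0 by simp
  finally have "real a * inv_sum 0 (Suc n) t \<le> real a * (2 / real r)" by (intro mult_left_mono) auto
  then have 4: "real a * inv_sum 0 (Suc n) t \<le> 2 * real a / real r" by (simp add: mult.commute)
  show ?thesis unfolding rlog_def using 1 2 3 4 big by linarith
qed

lemma exists_left_margin:
  assumes "r \<ge> 1"
  obtains \<epsilon> :: real where "\<epsilon> > 0" "3 * ln (1 + real r / (2 * \<epsilon>)) \<ge> 2 * real a / real r + 1"
\<comment> \<open>The witness solves r / (2 \<epsilon>) = exp ((2a / r + 1) / 3).\<close>
proof (rule that[of "real r / (2 * exp ((2 * real a / real r + 1) / 3))"])
  let ?E = "exp ((2 * real a / real r + 1) / 3)"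
  show "real r / (2 * ?E) > 0" using assms by simp
  have "(2 * real a / real r + 1) / 3 \<le> ln (1 + ?E)"
    by (subst ln_exp [symmetric], rule ln_mono) (auto simp: add_pos_pos)
  moreover have "real r / (2 * (real r / (2 * ?E))) = ?E" using assms by simp
  ultimately show "3 * ln (1 + real r / (2 * (real r / (2 * ?E)))) \<ge> 2 * real a / real r + 1" by simp
qed

text \<open>
  With \<open>R = rfun a r n\<close>: where \<open>\<bar>R'/R\<bar> \<ge> \<delta>\<close>, the function \<open>R\<close> keeps growing (or decaying) exponentially over a range of
  length proportional to \<open>n\<close>, because \<open>R'/R\<close> varies by \<open>O(1/n)\<close> per step.  So such points carry
  an exponentially small part of \<open>\<Sum> R(k)\<close>, and elsewhere \<open>\<bar>R''\<bar> \<le> (\<delta>\<^sup>2 + O(1/n)) R\<close>.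
\<close>

lemma rfun_local_growth:
  assumes n: "n \<ge> 1" and r: "r \<ge> 1" and ar: "6 * r \<le> a"
    and \<epsilon>: "\<epsilon> > 0" and big: "3 * ln (1 + real r / (2 * \<epsilon>)) \<ge> 2 * real a / real r + 1"
    and \<delta>: "0 < \<delta>" "\<delta> \<le> 1"
    and C: "C = 3 * real r / \<epsilon> ^ 2 + 3 * real r + 2 * real a"
    and J: "real J \<le> \<epsilon> * real n" "real J \<le> \<delta> / (2 * C) * real n"
    and k: "k > r * n"
  shows "rlog a r n (real k) \<ge> \<delta> \<Longrightarrow> rfun a r n (real k) \<le> exp (- (\<delta> / 2) * real J) * rfun a r n (real (k + J))"
    and "rlog a r n (real k) \<le> - \<delta> \<Longrightarrow> k - J > r * n \<and> J \<le> k \<and> rfun a r n (real k) \<le> exp (- (\<delta> / 2) * real J) * rfun a r n (real (k - J))"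
    and "\<bar>rlog a r n (real k)\<bar> < \<delta> \<Longrightarrow> \<bar>rlog' a r n (real k)\<bar> \<le> C / real n"
proof -
  have n0: "real n > 0" using n by simp
  have C0: "C > 0" unfolding C using r by (intro add_pos_nonneg add_nonneg_pos) (auto intro!: add_nonneg_pos)
  have kr: "real k > real (r * n)" using k by (simp flip: of_nat_mult)
  \<comment> \<open>A slope of at most C / n over a length of at most \<delta> n / (2C) changes
    \<open>rlog\<close> by at most \<delta> / 2.\<close>
  have varies: "\<bar>rlog a r n s - rlog a r n s'\<bar> \<le> \<delta> / 2"
    if "s \<ge> (real r + \<epsilon>) * real n" "s \<le> s'" "s' - s \<le> real J" for s s'
  proof (cases "s = s'")
    case False
    with that have ss: "s < s'" by simp
    have gr: "x > real (r * n)" if "s \<le> x" for x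
    proof -
      have "\<epsilon> * real n > 0" using \<epsilon> n0 by simp
      then show ?thesis using that \<open>s \<ge> _\<close> by (simp add: algebra_simps)
    qed
    have "\<exists>z>s. z < s' \<and> rlog a r n s' - rlog a r n s = (s' - s) * rlog' a r n z"
      by (rule MVT2[OF ss]) (use gr in \<open>auto intro!: rlog_deriv\<close>)
    then obtain z where z: "s < z" "z < s'" "rlog a r n s' - rlog a r n s = (s' - s) * rlog' a r n z" by blast
    have "\<bar>rlog' a r n z\<bar> \<le> C / real n"
      unfolding C using z that by (intro rlog'_bound n r \<epsilon>) auto
    then have "\<bar>(s' - s) * rlog' a r n z\<bar> \<le> (\<delta> / (2 * C) * real n) * (C / real n)"
      unfolding abs_mult using that ss J C0 \<delta> by (intro mult_mono) auto
    also have "\<dots> = \<delta> / 2" using C0 n0 by simp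
    finally show ?thesis using z(3) by (simp add: abs_minus_commute)
  qed (use \<delta> in auto)
  have pos: "0 \<le> rfun a r n x" if "x \<ge> real (r * n)" for x
    using rfun_upper(1)[OF ar r n order_refl] that by simp
  {
    assume up: "rlog a r n (real k) \<ge> \<delta>"
    have half: "rlog a r n s \<ge> \<delta> / 2" if "real k \<le> s" "s \<le> real (k + J)" for s
    proof (cases "real k \<ge> (real r + \<epsilon>) * real n")
      case True
      have "\<bar>rlog a r n (real k) - rlog a r n s\<bar> \<le> \<delta> / 2"
        by (rule varies) (use True that in auto)
      then show ?thesis using up by linarith
    next
      case False
      then have "s \<le> (real r + 2 * \<epsilon>) * real n" using that J(1) by (simp add: algebra_simps)
      then have "rlog a r n s \<ge> 1" using that kr by (intro rlog_left[OF n r \<epsilon> big]) auto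
      then show ?thesis using \<delta> by simp
    qed
    \<comment> \<open>The exponential factor turns the lower bound \<delta> / 2 for
      \<open>rlog\<close> into monotonicity; over the length J this is the claimed gain.\<close>
    have D: "\<exists>y. ((\<lambda>s. rfun a r n s * exp (- (\<delta> / 2) * s)) has_real_derivative y) (at s) \<and> y \<ge> 0"
      if "real k \<le> s" "s \<le> real (k + J)" for s
    proof (intro exI conjI)
      show "((\<lambda>s. rfun a r n s * exp (- (\<delta> / 2) * s)) has_real_derivative
          rfun a r n s * exp (- (\<delta> / 2) * s) * (rlog a r n s + - (\<delta> / 2))) (at s)"
        using that kr by (intro mult_deriv_log rfun_deriv) (auto intro!: derivative_eq_intros)
      show "rfun a r n s * exp (- (\<delta> / 2) * s) * (rlog a r n s + - (\<delta> / 2)) \<ge> 0"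
        using half[OF that] pos[of s] that kr by (intro mult_nonneg_nonneg) auto
    qed
    have "rfun a r n (real k) * exp (- (\<delta> / 2) * real k) \<le> rfun a r n (real (k + J)) * exp (- (\<delta> / 2) * real (k + J))"
      by (rule DERIV_nonneg_imp_nondecreasing[where f = "\<lambda>s. rfun a r n s * exp (- (\<delta> / 2) * s)", OF _ D]) simp_all
    also have "exp (- (\<delta> / 2) * real (k + J)) = exp (- (\<delta> / 2) * real J) * exp (- (\<delta> / 2) * real k)"
      by (simp add: exp_add [symmetric] algebra_simps add_divide_distrib)
    finally have "rfun a r n (real k) * exp (- (\<delta> / 2) * real k) \<le>
        (exp (- (\<delta> / 2) * real J) * rfun a r n (real (k + J))) * exp (- (\<delta> / 2) * real k)" by (simp add: mult_ac)
    then show "rfun a r n (real k) \<le> exp (- (\<delta> / 2) * real J) * rfun a r n (real (k + J))"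
      by (simp only: mult_le_cancel_right_pos exp_gt_zero)
  }
  \<comment> \<open>A point with small or negative \<open>rlog\<close> is beyond 2 \<epsilon> n, so
    moving left by J \<le> \<epsilon> n stays where the slope bound holds.\<close>
  have right: "real k > (real r + 2 * \<epsilon>) * real n" if "rlog a r n (real k) < 1"
    using rlog_left[OF n r \<epsilon> big kr] that by linarith
  have eq: "(real r + 2 * \<epsilon>) * real n = (real r + \<epsilon>) * real n + \<epsilon> * real n" by (simp add: algebra_simps)
  have en: "\<epsilon> * real n > 0" using \<epsilon> n0 by simp
  {
    assume down: "rlog a r n (real k) \<le> - \<delta>"
    then have rk: "real k > (real r + \<epsilon>) * real n + \<epsilon> * real n" using right \<delta> unfolding eq by simp
    have Jk: "J \<le> k"
    proof -
      have "(real r + \<epsilon>) * real n \<ge> 0" using \<epsilon> by simp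
      then have "real J \<le> real k" using rk J(1) by linarith
      then show ?thesis by simp
    qed
    have kJ: "real (k - J) > (real r + \<epsilon>) * real n" using rk J(1) Jk by (simp add: of_nat_diff)
    then have kJ': "real (k - J) > real (r * n)" using en by (simp add: algebra_simps)
    have half: "rlog a r n s \<le> - (\<delta> / 2)" if "real (k - J) \<le> s" "s \<le> real k" for s
    proof -
      have "\<bar>rlog a r n s - rlog a r n (real k)\<bar> \<le> \<delta> / 2"
        using that kJ Jk by (intro varies) (auto simp: of_nat_diff)
      then show ?thesis using down by linarith
    qed
    have D: "\<exists>y. ((\<lambda>s. rfun a r n s * exp (\<delta> / 2 * s)) has_real_derivative y) (at s) \<and> y \<le> 0"
      if "real (k - J) \<le> s" "s \<le> real k" for s
    proof (intro exI conjI)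
      have sr: "real (r * n) < s" using less_le_trans[OF kJ' that(1)] .
      show "((\<lambda>s. rfun a r n s * exp (\<delta> / 2 * s)) has_real_derivative
          rfun a r n s * exp (\<delta> / 2 * s) * (rlog a r n s + \<delta> / 2)) (at s)"
        using sr by (intro mult_deriv_log rfun_deriv) (auto intro!: derivative_eq_intros)
      show "rfun a r n s * exp (\<delta> / 2 * s) * (rlog a r n s + \<delta> / 2) \<le> 0"
        using half[OF that] pos[of s] sr by (intro mult_nonneg_nonpos mult_nonneg_nonneg) auto
    qed
    have "rfun a r n (real k) * exp (\<delta> / 2 * real k) \<le> rfun a r n (real (k - J)) * exp (\<delta> / 2 * real (k - J))"
      by (rule DERIV_nonpos_imp_nonincreasing[where f = "\<lambda>s. rfun a r n s * exp (\<delta> / 2 * s)", OF _ D]) simp_all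
    also have "exp (\<delta> / 2 * real (k - J)) = exp (- (\<delta> / 2) * real J) * exp (\<delta> / 2 * real k)"
      using Jk by (simp add: exp_add [symmetric] algebra_simps diff_divide_distrib of_nat_diff)
    finally have "rfun a r n (real k) * exp (\<delta> / 2 * real k) \<le>
        (exp (- (\<delta> / 2) * real J) * rfun a r n (real (k - J))) * exp (\<delta> / 2 * real k)" by (simp add: mult_ac)
    then have "rfun a r n (real k) \<le> exp (- (\<delta> / 2) * real J) * rfun a r n (real (k - J))"
      by (simp only: mult_le_cancel_right_pos exp_gt_zero)
    moreover have "k - J > r * n" using kJ' of_nat_less_iff by blast
    ultimately show "k - J > r * n \<and> J \<le> k \<and> rfun a r n (real k) \<le> exp (- (\<delta> / 2) * real J) * rfun a r n (real (k - J))"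
      using Jk by simp
  }
  show "\<bar>rlog' a r n (real k)\<bar> \<le> C / real n" if "\<bar>rlog a r n (real k)\<bar> < \<delta>"
  proof -
    have "real k > (real r + 2 * \<epsilon>) * real n" using right that \<delta> by linarith
    then show ?thesis unfolding C using en eq by (intro rlog'_bound n r \<epsilon>) linarith
  qed
qed

section \<open>Nesterenko's linear independence criterion\<close>

text \<open>
  Approximate the \<open>\<xi>\<^sub>i\<close> simultaneously by \<open>v\<^sub>i / q\<close> and take the first \<open>n\<close> with \<open>q \<bar>L\<^sub>n\<bar> \<le> 1/2\<close>. By the lower bound
  on \<open>L\<^sub>n\<^sub>+\<^sub>1 / L\<^sub>n\<close> this value is not too small, so the integer obtained from \<open>q L\<^sub>n\<close> by replacing
  \<open>q \<xi>\<^sub>i\<close> with \<open>v\<^sub>i\<close> lies strictly between \<open>-1\<close> and \<open>1\<close> without being \<open>0\<close>.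
\<close>

lemma nesterenko_criterion_integral_forms:
  fixes \<xi> :: "nat \<Rightarrow> real" and p0 :: "nat \<Rightarrow> int" and p :: "nat \<Rightarrow> nat \<Rightarrow> int" and e :: nat
  defines "L \<equiv> \<lambda>n. of_int (p0 n) + (\<Sum>i<e. of_int (p n i) * \<xi> i)"
  assumes nz: "\<And>n. L n \<noteq> 0"
    and coeff: "\<And>n i. i < e \<Longrightarrow> \<bar>of_int (p n i)\<bar> \<le> B n"
    and upper: "\<And>n. \<bar>L n\<bar> \<le> A n" and A0: "A \<longlonglongrightarrow> 0"
    and \<kappa>: "\<And>n. \<kappa> n > 0" "\<And>n. \<bar>L (Suc n)\<bar> \<ge> \<kappa> n * \<bar>L n\<bar>"
    and small: "\<And>n. (2 * (real e + 1) * B (Suc n) / \<kappa> n) ^ e * (2 * A n) < 1"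
  shows False
proof -
  define c0 where "c0 = min (1/2) \<bar>L 0\<bar>"
  have c0: "0 < c0" "c0 \<le> \<bar>L 0\<bar>" "c0 \<le> 1/2" using nz[of 0] unfolding c0_def by linarith+
  define B0 :: real where "B0 = (\<Sum>i<e. \<bar>of_int (p 0 i)\<bar>)"
  have B0: "B0 \<ge> 0" unfolding B0_def by (rule sum_nonneg) simp
  \<comment> \<open>N is fixed by the case n = 0 alone, where no preceding form is available. For n
    > 0 the condition on N follows from \<open>small\<close>.\<close>
  define N where "N = nat \<lceil>B0 / c0\<rceil> + 2"
  have N: "N > 0" "real N > B0 / c0" "N \<ge> 2"
  proof -
    show "N > 0" "N \<ge> 2" by (simp_all add: N_def)
    have "real N = real (nat \<lceil>B0 / c0\<rceil>) + 2" by (simp add: N_def)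
    then show "real N > B0 / c0" using of_nat_ceiling[of "B0 / c0"] by simp
  qed
  obtain q :: int and v where q: "0 < q" "q \<le> int (N ^ e)" and v: "\<And>i. i < e \<Longrightarrow> \<bar>of_int q * \<xi> i - of_int (v i)\<bar> < 1 / N"
    using Dirichlet_approx_simult[OF N(1), of e \<xi>] by metis
  have q1: "real_of_int q \<ge> 1" using q(1) by linarith
  have qN: "real_of_int q \<le> real N ^ e" using q(2) by (metis of_int_le_iff of_int_of_nat_eq of_nat_power)
  define m where "m = (\<lambda>n. p0 n * q + (\<Sum>i<e. p n i * v i))"
  have mL: "of_int (m n) = of_int q * L n - (\<Sum>i<e. of_int (p n i) * (of_int q * \<xi> i - of_int (v i)))" for n
    by (simp add: m_def L_def sum_subtractf sum_distrib_left algebra_simps)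
  have err: "\<bar>\<Sum>i<e. of_int (p n i) * (of_int q * \<xi> i - of_int (v i))\<bar> \<le> (\<Sum>i<e. \<bar>of_int (p n i)\<bar>) / N" for n
  proof -
    have "\<bar>\<Sum>i<e. of_int (p n i) * (of_int q * \<xi> i - of_int (v i))\<bar> \<le> (\<Sum>i<e. \<bar>of_int (p n i)\<bar> * (1 / N))"
    proof (intro order_trans[OF sum_abs] sum_mono)
      fix i assume "i \<in> {..<e}"
      then show "\<bar>of_int (p n i) * (of_int q * \<xi> i - of_int (v i))\<bar> \<le> \<bar>of_int (p n i)\<bar> * (1 / N)"
        unfolding abs_mult by (intro mult_left_mono less_imp_le[OF v]) auto
    qed
    then show ?thesis by (simp add: sum_distrib_right sum_divide_distrib)
  qed
  have contra: False if "of_int q * \<bar>L n\<bar> \<le> 1/2" "(\<Sum>i<e. \<bar>of_int (p n i)\<bar>) / N < of_int q * \<bar>L n\<bar>" for n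
  proof -
    define E where "E = (\<Sum>i<e. of_int (p n i) * (of_int q * \<xi> i - of_int (v i)))"
    have E: "\<bar>E\<bar> < \<bar>of_int q * L n\<bar>" using err[of n] that q1 by (simp add: E_def abs_mult)
    have 1: "of_int (m n) = of_int q * L n - E" using mL[of n] by (simp add: E_def)
    have "of_int (m n) \<noteq> (0::real)" using E unfolding 1 by auto
    moreover from E have "\<bar>of_int (m n) :: real\<bar> < 1" using E that q1 unfolding 1 by (simp add: abs_mult)
    then have "\<bar>m n\<bar> < 1" by (simp flip: of_int_abs)
    ultimately show False by simp
  qed
  have "\<exists>n. of_int q * \<bar>L n\<bar> \<le> 1/2"
  proof -
    have "\<forall>\<^sub>F n in sequentially. A n < 1 / (2 * of_int q)"
      using order_tendstoD(2)[OF A0] q1 by simp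
    then obtain n where "A n < 1 / (2 * of_int q)" by (auto simp: eventually_sequentially)
    then have "of_int q * \<bar>L n\<bar> \<le> of_int q * (1 / (2 * of_int q))"
      using upper[of n] q1 by (intro mult_left_mono) auto
    then show ?thesis using q1 by (intro exI[of _ n]) simp
  qed
  then obtain n where n: "of_int q * \<bar>L n\<bar> \<le> 1/2" "\<And>k. k < n \<Longrightarrow> of_int q * \<bar>L k\<bar> > 1/2"
    using exists_least_iff[of "\<lambda>n. of_int q * \<bar>L n\<bar> \<le> 1/2"] by (meson not_le)
  show False
  proof (cases n)
    case 0
    have "(\<Sum>i<e. \<bar>of_int (p 0 i)\<bar>) / N < c0"
      using N c0 by (simp add: B0_def [symmetric] field_simps)
    also have "c0 \<le> 1 * \<bar>L 0\<bar>" using c0 by simp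
    also have "\<dots> \<le> of_int q * \<bar>L 0\<bar>" using q1 by (intro mult_right_mono) auto
    finally show False using contra[of n] n(1) 0 by simp
  next
    case (Suc k)
    have k: "of_int q * \<bar>L k\<bar> > 1/2" using n(2) Suc by simp
    have low: "of_int q * \<bar>L n\<bar> > \<kappa> k / 2"
    proof -
      have "\<kappa> k * (1/2) < \<kappa> k * (of_int q * \<bar>L k\<bar>)" using k \<kappa>(1) by (intro mult_strict_left_mono) auto
      also have "\<dots> = of_int q * (\<kappa> k * \<bar>L k\<bar>)" by simp
      also have "\<dots> \<le> of_int q * \<bar>L n\<bar>" using \<kappa>(2)[of k] q1 Suc by (intro mult_left_mono) auto
      finally show ?thesis by simp
    qed
    have Apos: "A k > 0" using upper[of k] nz[of k] by linarith
    have "1 < of_int q * (2 * A k)"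
    proof -
      have "1/2 < of_int q * A k"
        using k upper[of k] q1 by (meson less_le_trans mult_left_mono order_trans zero_le_one)
      then show ?thesis by simp
    qed
    also have "\<dots> \<le> real N ^ e * (2 * A k)" using qN Apos by (intro mult_right_mono) auto
    finally have big: "real N ^ e * (2 * A k) > 1" .
    \<comment> \<open>Minimality of n gives q |L k| > 1/2 for its predecessor k, hence N^e 2 A k >
      1, while \<open>small\<close> says X^e 2 A k < 1. So X < N, which is what the error term at n
      requires.\<close>
    define X where "X = 2 * (real e + 1) * B n / \<kappa> k"
    show False
    proof (cases "e = 0")
      case True
      then show False using small[of k] big by simp
    next
      case False
      have Bn: "B n \<ge> 0" using order_trans[OF abs_ge_zero coeff[of 0 n]] False by simp
      have X0: "X \<ge> 0" using Bn \<kappa>(1)[of k] by (simp add: X_def)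
      have "X ^ e * (2 * A k) < real N ^ e * (2 * A k)"
        using small[of k] big Suc by (simp add: X_def)
      then have "X ^ e < real N ^ e" using Apos by simp
      then have XN: "X < real N" using X0 by (meson power_less_imp_less_base of_nat_0_le_iff)
      have "(\<Sum>i<e. \<bar>of_int (p n i)\<bar>) \<le> (\<Sum>i<e. B n)" by (intro sum_mono coeff) auto
      also have "\<dots> \<le> (real e + 1) * B n" using Bn by (simp add: algebra_simps)
      also have "\<dots> = X * \<kappa> k / 2" using \<kappa>(1)[of k] by (simp add: X_def)
      also have "\<dots> \<le> real N * (\<kappa> k / 2)" using XN \<kappa>(1)[of k] by (simp add: mult_right_mono)
      finally have "(\<Sum>i<e. \<bar>of_int (p n i)\<bar>) / N \<le> \<kappa> k / 2" using N(1) by (simp add: field_simps)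
      then show False using low contra[of n] n(1) by linarith
    qed
  qed
qed

lemma common_denominator_rat:
  assumes "finite (Q :: rat set)"
  shows "\<exists>M::int. M > 0 \<and> (\<forall>q\<in>Q. of_int M * (of_rat q :: real) \<in> \<int>)"
  using assms
proof (induction rule: finite_induct)
  case (insert q Q)
  then obtain M :: int where M: "M > 0" "\<And>q. q \<in> Q \<Longrightarrow> of_int M * (of_rat q :: real) \<in> \<int>" by blast
  obtain a b where ab: "quotient_of q = (a, b)" by fastforce
  have b: "b > 0" using quotient_of_denom_pos[OF ab] .
  have "q = of_int a / of_int b" using quotient_of_div[OF ab] .
  then have q: "of_int b * (of_rat q :: real) = of_int a"
    using b by (simp add: of_rat_divide)
  show ?case
  proof (intro exI[of _ "M * b"] conjI ballI)
    show "M * b > 0" using M b by simp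
    fix r assume "r \<in> insert q Q"
    then show "of_int (M * b) * (of_rat r :: real) \<in> \<int>"
    proof
      assume "r = q"
      have "of_int M * (of_int b * (of_rat q :: real)) \<in> \<int>" unfolding q by simp
      then show ?thesis using \<open>r = q\<close> by (simp add: mult.assoc)
    next
      assume "r \<in> Q"
      then have "of_int b * (of_int M * (of_rat r :: real)) \<in> \<int>" by (intro Ints_mult[OF Ints_of_int M(2)])
      then show ?thesis by (simp add: mult_ac)
    qed
  qed
qed (intro exI[of _ 1], auto)

text \<open>Reduction to a basis of the span that contains 1, which leaves e other basis elements.
  Rewriting the forms in this basis and clearing denominators changes all sizes by constants only,
  and these are absorbed by the arbitrary \<open>K\<close> in \<open>small\<close>.\<close>

theorem nesterenko_criterion:
  fixes g :: "'i \<Rightarrow> real" and P :: "nat \<Rightarrow> 'i \<Rightarrow> int" and I :: "'i set"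
  defines "L \<equiv> \<lambda>n. \<Sum>k\<in>I. of_int (P n k) * g k"
  defines "e \<equiv> rat_real.dim (rat_real.span (g ` I)) - 1"
  assumes I: "finite I" "1 \<in> g ` I"
    and nz: "\<And>n. L n \<noteq> 0"
    and coeff: "\<And>n k. k \<in> I \<Longrightarrow> \<bar>of_int (P n k)\<bar> \<le> B n"
    and upper: "\<And>n. \<bar>L n\<bar> \<le> A n" and A0: "A \<longlonglongrightarrow> 0"
    and \<kappa>: "\<And>n. \<kappa> n > 0" "\<And>n. \<bar>L (Suc n)\<bar> \<ge> \<kappa> n * \<bar>L n\<bar>"
    and small: "\<And>K. K > 0 \<Longrightarrow> \<forall>\<^sub>F n in sequentially. (K * B (Suc n) / \<kappa> n) ^ e * (K * A n) < 1"
  shows False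
proof -
  let ?V = "rat_real.span (g ` I)"
  have "{1} \<subseteq> ?V" using I(2) rat_real.span_base by auto
  moreover have "rat_real.independent {1}" by (simp add: rat_real.dependent_single)
  ultimately obtain S where S: "{1} \<subseteq> S" "S \<subseteq> ?V" "rat_real.independent S" "?V \<subseteq> rat_real.span S"
    using rat_real.maximal_independent_subset_extend by metis
  have finS: "finite S" using rat_real.independent_span_bound[OF finite_imageI[OF I(1)] S(3,2)] by simp
  have cardS: "card S = rat_real.dim ?V" using S rat_real.basis_card_eq_dim by blast
  define S' where "S' = S - {1}"
  have S': "finite S'" "card S' = e" "S = insert 1 S'" "1 \<notin> S'"
    using finS S(1) cardS by (auto simp: S'_def e_def)
  obtain \<xi> where \<xi>: "bij_betw \<xi> {..<e} S'"
    using ex_bij_betw_nat_finite[OF S'(1)] S'(2) by (auto simp: atLeast0LessThan)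
  have "\<exists>u. g k = (\<Sum>b\<in>S. of_rat (u b) * b)" if "k \<in> I" for k
  proof -
    have "g k \<in> rat_real.span S" using that S(4) rat_real.span_base by blast
    then show ?thesis using rat_real.span_finite[OF finS] by auto
  qed
  then obtain u where u: "\<And>k. k \<in> I \<Longrightarrow> g k = (\<Sum>b\<in>S. of_rat (u k b) * b)" by metis
  have "finite ((\<lambda>(k, b). u k b) ` (I \<times> S))" using I(1) finS by simp
  then obtain M :: int where M: "M > 0" "\<And>q. q \<in> (\<lambda>(k, b). u k b) ` (I \<times> S) \<Longrightarrow> of_int M * (of_rat q :: real) \<in> \<int>"
    using common_denominator_rat by meson
  have "\<exists>w::int. of_int w = of_int M * (of_rat (u k b) :: real)" if "k \<in> I" "b \<in> S" for k b
    using M(2)[of "u k b"] that by (force elim!: Ints_cases)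
  then obtain w :: "'i \<Rightarrow> real \<Rightarrow> int" where w: "\<And>k b. k \<in> I \<Longrightarrow> b \<in> S \<Longrightarrow> of_int (w k b) = of_int M * (of_rat (u k b) :: real)"
    by metis
  define W where "W = (\<Sum>k\<in>I. \<Sum>b\<in>S. \<bar>real_of_int (w k b)\<bar>)"
  have W0: "W \<ge> 0" by (simp add: W_def sum_nonneg)
  have B0: "B n \<ge> 0" for n
    using I(2) coeff[of _ n] by (auto intro: order_trans[OF abs_ge_zero])
  have A00: "A n \<ge> 0" for n using upper[of n] by linarith
  define c where "c = (\<lambda>n b. \<Sum>k\<in>I. P n k * w k b)"
  have lin: "of_int M * L n = (\<Sum>b\<in>S. of_int (c n b) * b)" for n
  proof -
    have "of_int M * L n = (\<Sum>k\<in>I. of_int (P n k) * (\<Sum>b\<in>S. of_int (w k b) * b))"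
      unfolding L_def sum_distrib_left
      by (intro sum.cong refl) (simp add: u w sum_distrib_left mult_ac)
    also have "\<dots> = (\<Sum>b\<in>S. \<Sum>k\<in>I. of_int (P n k) * (of_int (w k b) * b))"
      unfolding sum_distrib_left by (rule sum.swap)
    also have "\<dots> = (\<Sum>b\<in>S. of_int (c n b) * b)"
      by (simp add: c_def sum_distrib_right mult.assoc)
    finally show ?thesis .
  qed
  have cb: "\<bar>real_of_int (c n b)\<bar> \<le> W * B n" if "b \<in> S" for n b
  proof -
    have "\<bar>real_of_int (c n b)\<bar> \<le> (\<Sum>k\<in>I. \<bar>real_of_int (w k b)\<bar> * B n)"
      unfolding c_def of_int_sum using coeff
      by (intro order_trans[OF sum_abs] sum_mono) (auto simp: abs_mult mult.commute intro!: mult_right_mono)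
    also have "\<dots> = (\<Sum>k\<in>I. \<bar>real_of_int (w k b)\<bar>) * B n" by (simp add: sum_distrib_right)
    also have "\<dots> \<le> W * B n"
      unfolding W_def using that finS B0 by (intro mult_right_mono sum_mono member_le_sum) auto
    finally show ?thesis .
  qed
  have lin': "of_int M * L n = of_int (c n 1) + (\<Sum>i<e. of_int (c n (\<xi> i)) * \<xi> i)" for n
  proof -
    have "(\<Sum>i<e. of_int (c n (\<xi> i)) * \<xi> i) = (\<Sum>b\<in>S'. of_int (c n b) * b)"
      using sum.reindex_bij_betw[OF \<xi>, of "\<lambda>b. of_int (c n b) * b"] .
    then show ?thesis unfolding lin S'(3) using S' by simp
  qed
  define K where "K = 2 * (real e + 1) * (W + 1) + 2 * real_of_int M"
  have K: "K > 0" "K \<ge> 2 * (real e + 1) * W" "K \<ge> 2 * real_of_int M"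
    using W0 M(1) by (auto simp: K_def algebra_simps add_nonneg_pos intro!: add_pos_nonneg)
  obtain n0 where n0: "\<And>n. n \<ge> n0 \<Longrightarrow> (K * B (Suc n) / \<kappa> n) ^ e * (K * A n) < 1"
    using small[OF K(1)] by (auto simp: eventually_sequentially)
  show False
  proof (rule nesterenko_criterion_integral_forms[where e = e and \<xi> = \<xi> and ?p0.0 = "\<lambda>n. c (n + n0) 1" and p = "\<lambda>n i. c (n + n0) (\<xi> i)"
      and B = "\<lambda>n. W * B (n + n0)" and A = "\<lambda>n. of_int M * A (n + n0)" and \<kappa> = "\<lambda>n. \<kappa> (n + n0)"])
    show "of_int (c (n + n0) 1) + (\<Sum>i<e. of_int (c (n + n0) (\<xi> i)) * \<xi> i) \<noteq> 0" for n
      unfolding lin'[symmetric] using nz[of "n + n0"] M(1) by simp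
    show "\<bar>of_int (c (n + n0) (\<xi> i))\<bar> \<le> W * B (n + n0)" if "i < e" for n i
      using cb[of "\<xi> i" "n + n0"] that \<xi> S'(3) by (auto simp: bij_betw_def)
    show "\<bar>of_int (c (n + n0) 1) + (\<Sum>i<e. of_int (c (n + n0) (\<xi> i)) * \<xi> i)\<bar> \<le> of_int M * A (n + n0)" for n
      unfolding lin'[symmetric] using upper[of "n + n0"] M(1) by (simp add: abs_mult)
    have "(\<lambda>n. of_int M * A (n + n0)) \<longlonglongrightarrow> of_int M * 0"
      by (intro tendsto_mult_left LIMSEQ_ignore_initial_segment A0)
    then show "(\<lambda>n. of_int M * A (n + n0)) \<longlonglongrightarrow> 0" by simp
    show "\<kappa> (n + n0) > 0" for n by (rule \<kappa>)
    show "\<kappa> (n + n0) * \<bar>of_int (c (n + n0) 1) + (\<Sum>i<e. of_int (c (n + n0) (\<xi> i)) * \<xi> i)\<bar>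
        \<le> \<bar>of_int (c (Suc n + n0) 1) + (\<Sum>i<e. of_int (c (Suc n + n0) (\<xi> i)) * \<xi> i)\<bar>" for n
    proof -
      have "of_int M * (\<kappa> (n + n0) * \<bar>L (n + n0)\<bar>) \<le> of_int M * \<bar>L (Suc n + n0)\<bar>"
        using \<kappa>(2)[of "n + n0"] M(1) by (intro mult_left_mono) auto
      then show ?thesis unfolding lin'[symmetric] using M(1) by (simp add: abs_mult mult_ac)
    qed
    show "(2 * (real e + 1) * (W * B (Suc n + n0)) / \<kappa> (n + n0)) ^ e * (2 * (of_int M * A (n + n0))) < 1" for n
    proof -
      have "(2 * (real e + 1) * (W * B (Suc n + n0)) / \<kappa> (n + n0)) ^ e * (2 * (of_int M * A (n + n0)))
          \<le> (K * B (Suc (n + n0)) / \<kappa> (n + n0)) ^ e * (K * A (n + n0))"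
      proof (rule mult_mono)
        have "2 * (real e + 1) * (W * B (Suc n + n0)) \<le> K * B (Suc (n + n0))"
          using mult_right_mono[OF K(2) B0[of "Suc (n + n0)"]] by (simp add: mult_ac)
        then show "(2 * (real e + 1) * (W * B (Suc n + n0)) / \<kappa> (n + n0)) ^ e \<le> (K * B (Suc (n + n0)) / \<kappa> (n + n0)) ^ e"
          using W0 B0 \<kappa>(1)[of "n + n0"] by (intro power_mono divide_right_mono) auto
        show "2 * (of_int M * A (n + n0)) \<le> K * A (n + n0)"
          using mult_right_mono[OF K(3) A00[of "n + n0"]] by (simp add: mult_ac)
      qed (use A00 B0 K M \<kappa>(1)[of "n + n0"] in auto)
      also have "\<dots> < 1" by (rule n0) simp
      finally show ?thesis .
    qed
  qed
qed

section \<open>Zeta values and the generators\<close>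

definition harm_sum :: "nat \<Rightarrow> nat \<Rightarrow> real" where
  "harm_sum j i = (\<Sum>k\<in>{1..j}. 1 / real k ^ i)"

text \<open>Induction by telescoping. The differences are summed as a whole, so that the case i = 1
  is covered although neither series converges by itself.\<close>

lemma shift_sums:
  assumes i: "i \<ge> 1"
  shows "(\<lambda>m. 1 / (real (Suc m) + real j) ^ i - 1 / real (Suc m) ^ i) sums (- harm_sum j i)"
proof (induction j)
  case (Suc j)
  have "(\<lambda>m. 1 / (real (Suc m) + real j) ^ i) \<longlonglongrightarrow> 0"
  proof -
    have "(\<lambda>m. 1 / (real (Suc m) + real j)) \<longlonglongrightarrow> 0" by real_asymp
    then have "(\<lambda>m. (1 / (real (Suc m) + real j)) ^ i) \<longlonglongrightarrow> 0 ^ i" by (rule tendsto_power)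
    then show ?thesis using i by (simp add: power_divide power_0_left)
  qed
  from telescope_sums[OF this]
  have "(\<lambda>m. 1 / (real (Suc (Suc m)) + real j) ^ i - 1 / (real (Suc m) + real j) ^ i) sums (0 - 1 / (real (Suc 0) + real j) ^ i)" .
  from sums_add[OF this Suc] show ?case by (simp add: harm_sum_def algebra_simps)
qed (simp add: harm_sum_def)

text \<open>Applied with d = 0 to R and with d = 2 to its second derivative. The hypothesis concerns
  the total order 1, where the coefficient of the meaningless \<open>zeta 1\<close> has to be
  zero.\<close>

lemma pf_zeta_sums:
  assumes w: "\<And>i. i + d = 1 \<Longrightarrow> (\<Sum>j\<le>n. w i j) = 0"
  shows "(\<lambda>m. \<Sum>i\<in>{1..s}. \<Sum>j\<le>n. w i j / (real (Suc m) + real j) ^ (i + d)) sums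
    ((\<Sum>i\<in>{1..s}. (\<Sum>j\<le>n. w i j) * zeta (i + d)) - (\<Sum>i\<in>{1..s}. \<Sum>j\<le>n. w i j * harm_sum j (i + d)))"
proof -
  have "(\<lambda>m. \<Sum>j\<le>n. w i j / (real (Suc m) + real j) ^ (i + d)) sums
      ((\<Sum>j\<le>n. w i j) * zeta (i + d) - (\<Sum>j\<le>n. w i j * harm_sum j (i + d)))" if i: "i \<in> {1..s}" for i
  proof -
    have z: "(\<lambda>m. (\<Sum>j\<le>n. w i j) * (1 / real (Suc m) ^ (i + d))) sums ((\<Sum>j\<le>n. w i j) * zeta (i + d))"
    proof (cases "i + d = 1")
      case True
      then show ?thesis using w by simp
    next
      case False
      then show ?thesis using i by (intro sums_mult zeta_sums) auto
    qed
    have "(\<lambda>m. (\<Sum>j\<le>n. w i j * (1 / (real (Suc m) + real j) ^ (i + d) - 1 / real (Suc m) ^ (i + d)))) sums (\<Sum>j\<le>n. w i j * (- harm_sum j (i + d)))"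
      using i by (intro sums_sum sums_mult shift_sums) auto
    from sums_add[OF this z]
    have "(\<lambda>m. (\<Sum>j\<le>n. w i j * (1 / (real (Suc m) + real j) ^ (i + d) - 1 / real (Suc m) ^ (i + d))) + (\<Sum>j\<le>n. w i j) * (1 / real (Suc m) ^ (i + d))) sums
       ((\<Sum>j\<le>n. w i j * (- harm_sum j (i + d))) + (\<Sum>j\<le>n. w i j) * zeta (i + d))" .
    also have "(\<lambda>m. (\<Sum>j\<le>n. w i j * (1 / (real (Suc m) + real j) ^ (i + d) - 1 / real (Suc m) ^ (i + d))) + (\<Sum>j\<le>n. w i j) * (1 / real (Suc m) ^ (i + d)))
       = (\<lambda>m. \<Sum>j\<le>n. w i j / (real (Suc m) + real j) ^ (i + d))"
      by (simp only: right_diff_distrib sum_subtractf sum_distrib_right) simp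
    finally show ?thesis by (simp add: sum_negf)
  qed
  then have "(\<lambda>m. \<Sum>i\<in>{1..s}. \<Sum>j\<le>n. w i j / (real (Suc m) + real j) ^ (i + d)) sums
      (\<Sum>i\<in>{1..s}. (\<Sum>j\<le>n. w i j) * zeta (i + d) - (\<Sum>j\<le>n. w i j * harm_sum j (i + d)))"
    by (rule sums_sum)
  then show ?thesis by (simp only: sum_subtractf)
qed

lemma harm_sum_Ints:
  assumes "j \<le> n"
  shows "real (common_denom n) ^ m * harm_sum j m \<in> \<int>"
proof -
  have "real (common_denom n) ^ m * (1 / real k ^ m) \<in> \<int>" if "k \<in> {1..j}" for k
  proof -
    have "k dvd common_denom n" using that assms by (intro dvd_common_denom) auto
    then obtain q where "common_denom n = k * q" by auto
    then have "real (common_denom n) ^ m * (1 / real k ^ m) = real q ^ m"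
      using that by (simp add: power_mult_distrib)
    then show ?thesis by simp
  qed
  then show ?thesis unfolding harm_sum_def sum_distrib_left by (intro Ints_sum) auto
qed

lemma harm_sum_bounds: "0 \<le> harm_sum j m" "harm_sum j m \<le> real j"
proof -
  show "0 \<le> harm_sum j m" unfolding harm_sum_def by (intro sum_nonneg) auto
  have "harm_sum j m \<le> (\<Sum>k\<in>{1..j}. 1)" unfolding harm_sum_def
    by (intro sum_mono) (auto simp: divide_le_eq_1)
  then show "harm_sum j m \<le> real j" by simp
qed

lemma pf_sum_bound:
  assumes "\<And>i j. i \<in> {1..s} \<Longrightarrow> j \<le> n \<Longrightarrow> \<bar>v i j\<bar> \<le> Y"
  shows "\<bar>\<Sum>i\<in>{1..s}. \<Sum>j\<le>n. c i j * v i j\<bar> \<le> pf_norm n s c * Y"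
proof -
  have "\<bar>\<Sum>i\<in>{1..s}. \<Sum>j\<le>n. c i j * v i j\<bar> \<le> (\<Sum>i\<in>{1..s}. \<Sum>j\<le>n. \<bar>c i j\<bar> * Y)"
    using assms by (intro order_trans[OF sum_abs] sum_mono order_trans[OF sum_abs]) (auto simp: abs_mult intro!: sum_mono mult_left_mono order_trans[OF sum_abs])
  then show ?thesis by (simp add: pf_norm_def sum_distrib_right)
qed

text \<open>
  The indices \<open>0\<close> and \<open>1\<close> stand for the generators \<open>1\<close> and \<open>\<lambda>\<close>; these are free since \<open>i \<ge> 3\<close> for the others.
\<close>

definition gen_index :: "nat \<Rightarrow> nat set" where
  "gen_index a = {0, 1} \<union> {i. odd i \<and> 3 \<le> i \<and> i \<le> a}"

definition gen_value :: "real \<Rightarrow> nat \<Rightarrow> real" where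
  "gen_value lam i = (if i = 0 then 1 else if i = 1 then lam else zeta i + real ((i + 1) choose 2) * lam * zeta (i + 2))"

lemma gen_image: "gen_value lam ` gen_index a = zeta_generators lam a"
proof
  show "gen_value lam ` gen_index a \<subseteq> zeta_generators lam a"
    by (auto simp: gen_value_def gen_index_def zeta_generators_def)
  show "zeta_generators lam a \<subseteq> gen_value lam ` gen_index a"
  proof
    fix x assume "x \<in> zeta_generators lam a"
    then consider "x = 1" | "x = lam" | i where "odd i" "3 \<le> i" "i \<le> a" "x = zeta i + real ((i + 1) choose 2) * lam * zeta (i + 2)"
      by (auto simp: zeta_generators_def)
    then show "x \<in> gen_value lam ` gen_index a"
    proof cases
      case 1 then show ?thesis by (intro image_eqI[of _ _ 0]) (auto simp: gen_value_def gen_index_def)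
    next
      case 2 then show ?thesis by (intro image_eqI[of _ _ 1]) (auto simp: gen_value_def gen_index_def)
    next
      case (3 i) then show ?thesis by (intro image_eqI[of _ _ i]) (auto simp: gen_value_def gen_index_def)
    qed
  qed
qed

lemma finite_gen_index: "finite (gen_index a)"
  unfolding gen_index_def by (auto intro: finite_subset[of _ "{..a}"])

lemma sum_gen_index:
  fixes f :: "nat \<Rightarrow> real"
  assumes "\<And>i. even i \<Longrightarrow> f i = 0" "f 1 = (0::real)"
  shows "(\<Sum>i\<in>{1..a}. f i) = (\<Sum>i\<in>{i. odd i \<and> 3 \<le> i \<and> i \<le> a}. f i)"
proof (rule sum.mono_neutral_right)
  show "\<forall>i\<in>{1..a} - {i. odd i \<and> 3 \<le> i \<and> i \<le> a}. f i = 0"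
  proof
    fix i assume i: "i \<in> {1..a} - {i. odd i \<and> 3 \<le> i \<and> i \<le> a}"
    show "f i = 0"
    proof (cases "even i")
      case False
      then have "i < 3" "i \<noteq> 0" "i \<noteq> 2" using i by auto
      then have "i = 1" by linarith
      then show ?thesis using assms by simp
    qed (rule assms)
  qed
qed auto

section \<open>The size of the sums\<close>

definition rsum :: "nat \<Rightarrow> nat \<Rightarrow> nat \<Rightarrow> real" where
  "rsum a r n = (\<Sum>k. rfun a r n (real (Suc k)))"

text \<open>The exponential rate of R beyond M n: M = r bounds the whole sum, and a large M bounds
  its tail.\<close>

definition decay :: "nat \<Rightarrow> nat \<Rightarrow> real \<Rightarrow> real" where
  "decay a r M = (1 / M) ^ (a - 6 * r) * 27 ^ r"

lemma power_times_geometric_tendsto_0: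
  fixes q :: real
  assumes "0 < q" "q < 1"
  shows "(\<lambda>n. real n ^ k * q ^ n) \<longlonglongrightarrow> 0"
proof -
  define L where "L = - ln q"
  have L: "L > 0" using assms by (simp add: L_def)
  have "filterlim (\<lambda>n. L * real n) at_top sequentially"
    using L by (intro filterlim_tendsto_pos_mult_at_top[OF tendsto_const] filterlim_real_sequentially)
  then have "(\<lambda>n. (L * real n) ^ k / exp (L * real n)) \<longlonglongrightarrow> 0"
    by (rule filterlim_compose[OF tendsto_power_div_exp_0])
  then have "(\<lambda>n. (1 / L ^ k) * ((L * real n) ^ k / exp (L * real n))) \<longlonglongrightarrow> (1 / L ^ k) * 0"
    by (rule tendsto_mult_left)
  moreover have "(1 / L ^ k) * ((L * real n) ^ k / exp (L * real n)) = real n ^ k * q ^ n" for n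
  proof -
    have "q ^ n = exp (real n * ln q)" using assms by (simp add: exp_of_nat_mult)
    then have "q ^ n = 1 / exp (L * real n)" by (simp add: L_def exp_minus' mult.commute)
    then show ?thesis using L by (simp add: power_mult_distrib)
  qed
  ultimately show ?thesis by simp
qed

context
  fixes a r :: nat
  assumes r: "r \<ge> 1" and ar: "6 * r < a"
begin

lemma ar': "6 * r \<le> a" and a2: "a \<ge> 2"
  using r ar by auto

definition Z2 :: real where "Z2 = (\<Sum>k. 1 / real (Suc k) ^ 2)"

lemma Z2: "(\<lambda>k. 1 / real (Suc k) ^ 2) sums Z2" and Z2_pos: "Z2 > 0"
proof -
  have "summable (\<lambda>n. inverse (real n ^ 2))"
    by (intro inverse_power_summable) auto
  then have "summable (\<lambda>n. 1 / real (Suc n) ^ 2)"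
    by (subst (asm) summable_Suc_iff [symmetric]) (simp add: inverse_eq_divide)
  then show "(\<lambda>k. 1 / real (Suc k) ^ 2) sums Z2" unfolding Z2_def by (rule summable_sums)
  show "Z2 > 0" unfolding Z2_def
    by (rule suminf_pos[OF \<open>summable (\<lambda>n. 1 / real (Suc n) ^ 2)\<close>]) simp
qed

lemma decay_pos: "M > 0 \<Longrightarrow> decay a r M > 0"
  by (simp add: decay_def)

lemma rfun_nonneg: "n \<ge> 1 \<Longrightarrow> 0 \<le> rfun a r n (real (Suc k))"
proof (cases "Suc k \<le> r * n")
  case True
  then show ?thesis using rfun_zeros[of "Suc k" r n a] by simp
next
  case False
  assume "n \<ge> 1"
  have "real (r * n) \<le> real (Suc k)" using False by (intro of_nat_mono) simp
  then show ?thesis by (intro rfun_upper(1)[OF ar' r \<open>n \<ge> 1\<close> order_refl]) simp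
qed

lemma rfun_le:
  assumes n: "n \<ge> 1" and M: "M \<ge> real r" and k: "real (Suc k) \<ge> M * real n"
  shows "rfun a r n (real (Suc k)) \<le> decay a r M ^ n * (1 / real (Suc k) ^ 2)"
proof -
  have M0: "M > 0" using M r by linarith
  have "rfun a r n (real (Suc k)) \<le> decay a r M ^ n / real (Suc k) ^ a"
    unfolding decay_def by (rule rfun_upper(2)[OF ar' r n M k])
  also have "\<dots> \<le> decay a r M ^ n / real (Suc k) ^ 2"
    using a2 decay_pos[OF M0] by (intro divide_left_mono power_increasing) auto
  finally show ?thesis by simp
qed

lemma rfun_le_r:
  assumes n: "n \<ge> 1"
  shows "rfun a r n (real (Suc k)) \<le> decay a r (real r) ^ n * (1 / real (Suc k) ^ 2)"
proof (cases "Suc k \<le> r * n")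
  case True
  then show ?thesis using rfun_zeros[of "Suc k" r n a] decay_pos[of "real r"] r by simp
next
  case False
  have "real (r * n) \<le> real (Suc k)" using False by (intro of_nat_mono) simp
  then show ?thesis by (intro rfun_le[OF n order_refl]) simp
qed

lemma summable_rfun: "n \<ge> 1 \<Longrightarrow> summable (\<lambda>k. rfun a r n (real (Suc k)))"
  by (rule summable_comparison_test'[OF summable_mult[OF sums_summable[OF Z2]], where N = 0])
    (use rfun_nonneg rfun_le_r in auto)

lemma rsum_le: "n \<ge> 1 \<Longrightarrow> rsum a r n \<le> decay a r (real r) ^ n * Z2"
proof -
  assume n: "n \<ge> 1"
  have "rsum a r n \<le> (\<Sum>k. decay a r (real r) ^ n * (1 / real (Suc k) ^ 2))"
    unfolding rsum_def by (intro suminf_le summable_rfun n summable_mult[OF sums_summable[OF Z2]] rfun_le_r)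
  also have "\<dots> = decay a r (real r) ^ n * Z2"
    using sums_unique[OF sums_mult[OF Z2]] by simp
  finally show ?thesis .
qed

lemma rfun_le_rsum: "n \<ge> 1 \<Longrightarrow> rfun a r n (real (Suc k)) \<le> rsum a r n"
  unfolding rsum_def using sum_le_suminf[OF summable_rfun, of n "{k}"] rfun_nonneg by simp

lemma tail_le:
  assumes n: "n \<ge> 1" and M: "M \<ge> real r"
  defines "h \<equiv> \<lambda>k. if real (Suc k) \<ge> M * real n then rfun a r n (real (Suc k)) else 0"
  shows "summable h" "suminf h \<le> decay a r M ^ n * Z2"
proof -
  have M0: "M > 0" using M r by linarith
  have h: "h k \<le> decay a r M ^ n * (1 / real (Suc k) ^ 2)" "0 \<le> h k" for k
    using rfun_le[OF n M, of k] rfun_nonneg[OF n, of k] decay_pos[OF M0] by (auto simp: h_def)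
  show s: "summable h"
    by (rule summable_comparison_test'[OF summable_mult[OF sums_summable[OF Z2]], where N = 0]) (use h in auto)
  have "suminf h \<le> (\<Sum>k. decay a r M ^ n * (1 / real (Suc k) ^ 2))"
    by (intro suminf_le s summable_mult[OF sums_summable[OF Z2]] h)
  also have "\<dots> = decay a r M ^ n * Z2"
    using sums_unique[OF sums_mult[OF Z2]] by simp
  finally show "suminf h \<le> decay a r M ^ n * Z2" .
qed

text \<open>The exponential rate of a lower bound for R at t = 2 r n: there t + n is at most 3 r n,
  n! is at least (n / e)^n, and all numerator factors are at least r n, a third of 3 r n.\<close>

definition low :: real where "low = (1 / (3 * real r * exp 1)) ^ (a - 6 * r) * (1 / 3) ^ (6 * r)"

lemma low_pos: "low > 0"
  unfolding low_def using r by simp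

lemma rsum_lower:
  assumes n: "n \<ge> 1"
  shows "rsum a r n \<ge> low ^ n / (3 * real r * real n) ^ a"
proof -
  define t where "t = 2 * real r * real n"
  define U where "U = 3 * real r * real n"
  have rn: "real r * real n \<ge> real n" "real n \<ge> 1" using r n by auto
  have t0: "t > 0" "U > 0" using r n by (auto simp: t_def U_def)
  have tU: "t + real n \<le> U" using rn by (simp add: t_def U_def)
  have Q: "0 < pochhammer t (Suc n)" "pochhammer t (Suc n) \<le> U * U ^ n"
  proof -
    show "0 < pochhammer t (Suc n)" by (rule pochhammer_pos[OF t0(1)])
    have "pochhammer t (Suc n) = (\<Prod>j\<le>n. t + real j)" by (rule pochhammer_eq_prod)
    also have "\<dots> \<le> (\<Prod>j\<le>n. U)" using t0 tU by (intro prod_mono) auto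
    finally show "pochhammer t (Suc n) \<le> U * U ^ n" by simp
  qed
  have lowb: "(y / U) ^ n / U \<le> x / pochhammer t (Suc n)" if "y ^ n \<le> x" "0 \<le> y" for x y
  proof -
    have "y ^ n / (U * U ^ n) \<le> x / pochhammer t (Suc n)"
      using that Q t0 by (intro frac_le) (auto intro: order_trans[OF zero_le_power])
    then show ?thesis by (simp add: power_divide mult.commute)
  qed
  have F: "(1 / (3 * real r * exp 1)) ^ n / U \<le> fact n / pochhammer t (Suc n)"
  proof -
    have "real n ^ n /\<^sub>R fact n \<le> exp (real n)"
      using sum_le_suminf[OF summable_exp_generic[of "real n"], of "{n}"] by (simp add: exp_def)
    then have "real n ^ n \<le> exp (real n) * fact n" by (simp add: field_simps)
    also have "exp (real n) = exp 1 ^ n" by (simp add: exp_of_nat_mult [symmetric])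
    finally have "(real n / exp 1) ^ n \<le> fact n" by (simp add: power_divide field_simps)
    from lowb[OF this] have "((real n / exp 1) / U) ^ n / U \<le> fact n / pochhammer t (Suc n)" by simp
    moreover have "(real n / exp 1) / U = 1 / (3 * real r * exp 1)" using n by (simp add: U_def)
    ultimately show ?thesis by simp
  qed
  have third: "real r * real n / U = 1 / 3" using r n by (simp add: U_def)
  have A: "(1 / 3) ^ n / U \<le> pochhammer (t - real (q * n)) n / pochhammer t (Suc n)" if q: "q \<in> {1..r}" for q
  proof -
    have "real (q * n) \<le> real (r * n)" using q by (intro of_nat_mono mult_le_mono) auto
    then have "real r * real n \<le> t - real (q * n)" unfolding t_def of_nat_mult by linarith
    then have "(real r * real n) ^ n \<le> (t - real (q * n)) ^ n" by (intro power_mono) auto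
    also have "\<dots> \<le> pochhammer (t - real (q * n)) n"
      using \<open>real r * real n \<le> t - real (q * n)\<close> rn by (intro pochhammer_ge_power) linarith
    finally show ?thesis using lowb[of "real r * real n" "pochhammer (t - real (q * n)) n"] third by simp
  qed
  have B: "(1 / 3) ^ n / U \<le> pochhammer (t + real (q * n) + 1) n / pochhammer t (Suc n)" if q: "q \<in> {1..r}" for q
  proof -
    have ge: "real r * real n \<le> t + real (q * n) + 1" by (simp add: t_def add_nonneg_nonneg)
    then have "(real r * real n) ^ n \<le> (t + real (q * n) + 1) ^ n" by (intro power_mono) auto
    also have "\<dots> \<le> pochhammer (t + real (q * n) + 1) n"
      using ge rn by (intro pochhammer_ge_power) linarith
    finally show ?thesis using lowb[of "real r * real n" "pochhammer (t + real (q * n) + 1) n"] third by simp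
  qed
  have tp: "t + real j \<noteq> 0" for j using t0 by linarith
  have "low ^ n / U ^ a = ((1 / (3 * real r * exp 1)) ^ n / U) ^ (a - 6 * r) * (\<Prod>q\<in>{1..r}. (1 / 3) ^ n / U) ^ 3 * (\<Prod>q\<in>{1..r}. (1 / 3) ^ n / U) ^ 3"
  proof -
    have "((1 / (3 * real r * exp 1)) ^ n / U) ^ (a - 6 * r) * (\<Prod>q\<in>{1..r}. (1 / 3) ^ n / U) ^ 3 * (\<Prod>q\<in>{1..r}. (1 / 3) ^ n / U) ^ 3
       = ((1 / (3 * real r * exp 1)) ^ n / U) ^ (a - 6 * r) * ((1 / 3) ^ n / U) ^ (6 * r)"
      by (simp add: power_mult [symmetric] power_add [symmetric] mult.assoc)
    also have "\<dots> = (((1 / (3 * real r * exp 1)) ^ n) ^ (a - 6 * r) * ((1 / 3) ^ n) ^ (6 * r)) / (U ^ (a - 6 * r) * U ^ (6 * r))"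
      unfolding power_divide[of "_ ^ n" U] by simp
    also have "U ^ (a - 6 * r) * U ^ (6 * r) = U ^ a"
      unfolding power_add [symmetric] using ar' by simp
    also have "((1 / (3 * real r * exp 1)) ^ n) ^ (a - 6 * r) * ((1 / 3) ^ n) ^ (6 * r) = low ^ n"
      by (simp only: low_def power_mult_distrib power_mult [symmetric] mult.commute)
    finally show ?thesis by simp
  qed
  also have "\<dots> \<le> rfun a r n t"
  proof -
    have XY: "0 \<le> (1 / (3 * real r * exp 1)) ^ n / U" "0 \<le> (1 / 3) ^ n / U" using t0 by simp_all
    note nn = order_trans[OF XY(1) F] order_trans[OF XY(2) A] order_trans[OF XY(2) B]
    show ?thesis
      unfolding rfun_bricks[OF tp ar']
      by (intro mult_mono power_mono prod_mono conjI mult_nonneg_nonneg zero_le_power prod_nonneg ballI F A B XY nn) assumption+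
  qed
  \<comment> \<open>The sum runs over \<open>Suc k\<close>, so the point 2 r n has the index 2 r n -
    1.\<close>
  also have "\<dots> = rfun a r n (real (Suc (2 * r * n - 1)))"
    using r n by (simp add: t_def)
  also have "\<dots> \<le> rsum a r n" by (rule rfun_le_rsum[OF n])
  finally show ?thesis by (simp add: U_def)
qed

lemma rsum_pos:
  assumes "n \<ge> 1"
  shows "rsum a r n > 0"
proof -
  have "0 < low ^ n / (3 * real r * real n) ^ a"
    using low_pos r assms by (intro divide_pos_pos zero_less_power mult_pos_pos) auto
  then show ?thesis using rsum_lower[OF assms] by (rule less_le_trans)
qed

text \<open>The exponent a - 6r is at least 1, so \<open>decay\<close> tends to 0 as M grows. With
  half the rate of the lower bound, the tail beyond M n is negligible against the sum.\<close>

lemma exists_cutoff: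
  obtains M where "M \<ge> real r" "decay a r M \<le> low / 2"
proof -
  define M where "M = max (real r) (27 ^ r * 2 / low)"
  have M: "M \<ge> real r" "M \<ge> 27 ^ r * 2 / low" "M \<ge> 1" using r by (auto simp: M_def)
  have "(1 / M) ^ (a - 6 * r) \<le> (1 / M) ^ 1" using M ar by (intro power_decreasing) auto
  then have "decay a r M \<le> (1 / M) ^ 1 * 27 ^ r" unfolding decay_def by (intro mult_right_mono) auto
  then have "decay a r M \<le> 27 ^ r / M" by simp
  also have "\<dots> \<le> low / 2" using M low_pos by (simp add: field_simps)
  finally show ?thesis using that M by blast
qed

text \<open>Passing from (n, k) to (n + 2, k + 2r) preserves k - r n, so the numerators only grow
  and each denominator grows by a factor polynomial in n and k. The step is 2 because linear forms
  are built for even n only.\<close>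

lemma rfun_step:
  assumes n: "n \<ge> 1" and k: "k > r * n"
  shows "rfun a r n (real k) \<le> ((real k + real n + 2 * real r + 3) ^ (2 * r + 2)) ^ a * rfun a r (n + 2) (real (k + 2 * r))"
proof -
  define x where "x = real k - real (r * n)"
  have kr: "real k \<ge> real (r * n) + 1" using k by (simp flip: of_nat_mult)
  have k1: "real k \<ge> 1" using kr of_nat_0_le_iff[of "r * n", where ?'a = real] by linarith
  have x: "x > 0" using kr by (simp add: x_def)
  define Y where "Y = (real k + real n + 2 * real r + 3) ^ (2 * r + 2)"
  have ext: "pochhammer y m \<le> pochhammer y (m + l)" if "y > 0" "y + real m \<ge> 1" for y :: real and m l
  proof -
    have "pochhammer (y + real m) l \<ge> 1"
      using pochhammer_ge_power[of "y + real m" l] that by (meson one_le_power order_trans zero_le_one)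
    then have "pochhammer y m * 1 \<le> pochhammer y m * pochhammer (y + real m) l"
      using pochhammer_pos[OF that(1), of m] by (intro mult_left_mono) auto
    then show ?thesis by (simp add: pochhammer_product')
  qed
  have e1: "real (k + 2 * r) - real (r * (n + 2)) = x" by (simp add: x_def algebra_simps)
  have p1: "pochhammer x (r * n) \<le> pochhammer x (r * (n + 2))"
  proof -
    have "pochhammer x (r * n) \<le> pochhammer x (r * n + r * 2)"
      using x k1 by (intro ext) (auto simp: x_def)
    then show ?thesis by (simp only: distrib_left)
  qed
  have p2: "pochhammer (real k + real n + 1) (r * n) \<le> pochhammer (real (k + 2 * r) + real (n + 2) + 1) (r * (n + 2))"
  proof -
    have "pochhammer (real k + real n + 1) (r * n) \<le> pochhammer (real k + real n + 1) (r * n + r * 2)"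
      using k1 by (intro ext) auto
    also have "\<dots> \<le> pochhammer (real (k + 2 * r) + real (n + 2) + 1) (r * n + r * 2)"
      using k1 by (intro pochhammer_mono_real) auto
    finally show ?thesis by (simp only: distrib_left)
  qed
  have p3: "(fact n :: real) \<le> fact (n + 2)" by (intro fact_mono) auto
  have p4: "pochhammer (real (k + 2 * r)) (Suc (n + 2)) \<le> Y * pochhammer (real k) (Suc n)"
  proof -
    have "1 \<le> pochhammer (real k) (2 * r)"
      using pochhammer_ge_power[of "real k" "2 * r"] k1 by (meson one_le_power order_trans zero_le_one)
    then have "1 * pochhammer (real (k + 2 * r)) (Suc (n + 2)) \<le> pochhammer (real k) (2 * r) * pochhammer (real (k + 2 * r)) (Suc (n + 2))"
      using k1 by (intro mult_right_mono pochhammer_nonneg) auto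
    also have "\<dots> = pochhammer (real k) (2 * r + Suc (n + 2))" by (simp only: pochhammer_product' of_nat_add)
    also have "2 * r + Suc (n + 2) = Suc n + (2 * r + 2)" by simp
    also have "pochhammer (real k) (Suc n + (2 * r + 2)) = pochhammer (real k) (Suc n) * pochhammer (real k + real (Suc n)) (2 * r + 2)"
      by (rule pochhammer_product')
    also have "\<dots> \<le> pochhammer (real k) (Suc n) * Y"
    proof (intro mult_left_mono)
      have "pochhammer (real k + real (Suc n)) (2 * r + 2) \<le> (real k + real (Suc n) + real (2 * r + 2)) ^ (2 * r + 2)"
        by (rule pochhammer_le_power) simp
      then show "pochhammer (real k + real (Suc n)) (2 * r + 2) \<le> Y" by (simp add: Y_def algebra_simps)
      show "0 \<le> pochhammer (real k) (Suc n)" using k1 by (intro pochhammer_nonneg) auto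
    qed
    finally show ?thesis by (simp add: mult.commute)
  qed
  have pos: "0 < pochhammer x (r * n)" "0 < pochhammer (real k + real n + 1) (r * n)"
      "0 < pochhammer (real k) (Suc n)" "0 < pochhammer (real (k + 2 * r)) (Suc (n + 2))"
    using x k1 by (auto intro!: pochhammer_pos simp del: pochhammer_Suc)
  have Y0: "Y > 0" unfolding Y_def using k1 by (intro zero_less_power) auto
  define N1 where "N1 = fact n ^ (a - 6 * r) * pochhammer x (r * n) ^ 3 * pochhammer (real k + real n + 1) (r * n) ^ 3"
  define N2 where "N2 = fact (n + 2) ^ (a - 6 * r) * pochhammer x (r * (n + 2)) ^ 3 * pochhammer (real (k + 2 * r) + real (n + 2) + 1) (r * (n + 2)) ^ 3"
  define D1 where "D1 = pochhammer (real k) (Suc n)"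
  define D2 where "D2 = pochhammer (real (k + 2 * r)) (Suc (n + 2))"
  have N: "N1 \<le> N2" "0 \<le> N1"
    unfolding N1_def N2_def using p1 p2 p3 pos
    by (auto intro!: mult_mono power_mono mult_nonneg_nonneg simp del: fact_Suc add_2_eq_Suc')
  have D: "0 < D1" "0 < D2" "D2 \<le> Y * D1" using pos p4 by (auto simp: D1_def D2_def)
  have "N1 / D1 ^ a \<le> N2 / D1 ^ a" using N D by (intro divide_right_mono) auto
  also have "\<dots> = Y ^ a * (N2 / (Y * D1) ^ a)" using Y0 D by (simp add: power_mult_distrib)
  also have "\<dots> \<le> Y ^ a * (N2 / D2 ^ a)"
    using N D Y0 by (intro mult_left_mono divide_left_mono power_mono) auto
  finally show ?thesis
    unfolding rfun_def e1 x_def[symmetric] N1_def[symmetric] N2_def[symmetric] D1_def[symmetric] D2_def[symmetric] Y_def[symmetric] .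
qed

text \<open>At least half of the sum comes from k < M n, where the factor of
  \<open>rfun_step\<close> is polynomial in n. This supplies the lower bound on consecutive forms in
  the criterion.\<close>

lemma rsum_regular:
  "\<exists>M\<ge>0. \<forall>\<^sub>F n in sequentially.
     rsum a r n \<le> 2 * (((M * real n + real n + 2 * real r + 3) ^ (2 * r + 2)) ^ a) * rsum a r (n + 2)"
proof -
  obtain M where M: "M \<ge> real r" "decay a r M \<le> low / 2" using exists_cutoff .
  have M0: "M > 0" using M r by linarith
  have "(\<lambda>n. 2 * Z2 * (3 * real r) ^ a * (real n ^ a * (1 / 2) ^ n)) \<longlonglongrightarrow> 2 * Z2 * (3 * real r) ^ a * 0"
    by (intro tendsto_mult_left power_times_geometric_tendsto_0) auto
  then have "(\<lambda>n. 2 * Z2 * (3 * real r * real n) ^ a * (1 / 2) ^ n) \<longlonglongrightarrow> 0"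
    by (simp add: power_mult_distrib mult_ac)
  then have "\<forall>\<^sub>F n in sequentially. 2 * Z2 * (3 * real r * real n) ^ a * (1 / 2) ^ n < 1"
    by (rule order_tendstoD) simp
  then have "\<forall>\<^sub>F n in sequentially.
     rsum a r n \<le> 2 * (((M * real n + real n + 2 * real r + 3) ^ (2 * r + 2)) ^ a) * rsum a r (n + 2)"
    using eventually_ge_at_top[of 1]
  proof eventually_elim
    case (elim n)
    note n = elim(2)
    define f where "f = (\<lambda>k. rfun a r n (real (Suc k)))"
    define h where "h = (\<lambda>k. if real (Suc k) \<ge> M * real n then rfun a r n (real (Suc k)) else 0)"
    define Y where "Y = ((M * real n + real n + 2 * real r + 3) ^ (2 * r + 2)) ^ a"
    note hs = tail_le[OF n M(1), folded h_def]
    have fs: "summable f" unfolding f_def by (rule summable_rfun[OF n])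
    have U: "(3 * real r * real n) ^ a > 0" using r n by simp
    have "suminf h \<le> (low / 2) ^ n * Z2"
      using hs(2) M(2) Z2_pos decay_pos[OF M0] by (intro order_trans[OF hs(2)] mult_right_mono power_mono) auto
    also have "\<dots> = (low ^ n / (3 * real r * real n) ^ a) * (2 * Z2 * (3 * real r * real n) ^ a * (1 / 2) ^ n) / 2"
    proof -
      have "(low / 2) ^ n * Z2 = (low ^ n / u) * (2 * Z2 * u * (1 / 2) ^ n) / 2" if "u > 0" for u
        using that by (simp add: power_divide)
      from this[OF U] show ?thesis .
    qed
    also have "\<dots> \<le> (low ^ n / (3 * real r * real n) ^ a) * 1 / 2"
      using elim(1) low_pos U by (intro divide_right_mono mult_left_mono) auto
    also have "\<dots> \<le> rsum a r n / 2" using rsum_lower[OF n] by simp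
    finally have half: "suminf h \<le> rsum a r n / 2" .
    have s2: "summable (\<lambda>k. rfun a r (n + 2) (real (Suc k)))" by (rule summable_rfun) simp
    have s2': "summable (\<lambda>k. Y * rfun a r (n + 2) (real (Suc (k + 2 * r))))"
      using summable_ignore_initial_segment[OF s2, of "2 * r"] by (intro summable_mult) simp
    have le: "f k - h k \<le> Y * rfun a r (n + 2) (real (Suc (k + 2 * r)))" for k
    proof -
      have Y0: "Y \<ge> 0" unfolding Y_def using M0 by (intro zero_le_power) auto
      have nn: "0 \<le> rfun a r (n + 2) (real (Suc (k + 2 * r)))" by (rule rfun_nonneg) simp
      consider "real (Suc k) \<ge> M * real n" | "Suc k \<le> r * n" | "real (Suc k) < M * real n" "Suc k > r * n" by linarith
      then show ?thesis
      proof cases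
        case 3
        have "f k \<le> ((real (Suc k) + real n + 2 * real r + 3) ^ (2 * r + 2)) ^ a * rfun a r (n + 2) (real (Suc k + 2 * r))"
          unfolding f_def by (rule rfun_step[OF n 3(2)])
        also have "\<dots> \<le> Y * rfun a r (n + 2) (real (Suc k + 2 * r))"
          unfolding Y_def using 3(1) nn by (intro mult_right_mono power_mono) auto
        finally show ?thesis using 3 by (simp add: h_def)
      qed (use Y0 nn rfun_zeros[of "Suc k" r n a] in \<open>auto simp: f_def h_def\<close>)
    qed
    have "rsum a r n - suminf h = (\<Sum>k. f k - h k)"
      unfolding rsum_def f_def[symmetric] by (rule suminf_diff[OF fs hs(1)])
    also have "\<dots> \<le> (\<Sum>k. Y * rfun a r (n + 2) (real (Suc (k + 2 * r))))"
      by (intro suminf_le le summable_diff fs hs(1) s2')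
    also have "\<dots> = Y * (\<Sum>k. rfun a r (n + 2) (real (Suc (k + 2 * r))))"
      using summable_ignore_initial_segment[OF s2, of "2 * r"] by (intro suminf_mult) simp
    also have "\<dots> \<le> Y * rsum a r (n + 2)"
    proof (rule mult_left_mono)
      have "rsum a r (n + 2) = (\<Sum>k. rfun a r (n + 2) (real (Suc (k + 2 * r)))) + (\<Sum>k<2 * r. rfun a r (n + 2) (real (Suc k)))"
        unfolding rsum_def by (rule suminf_split_initial_segment[OF s2])
      moreover have "(\<Sum>k<2 * r. rfun a r (n + 2) (real (Suc k))) \<ge> 0"
        by (intro sum_nonneg rfun_nonneg) simp
      ultimately show "(\<Sum>k. rfun a r (n + 2) (real (Suc (k + 2 * r)))) \<le> rsum a r (n + 2)" by linarith
      show "Y \<ge> 0" unfolding Y_def using M0 by (intro zero_le_power) auto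
    qed
    finally show ?case using half unfolding Y_def by linarith
  qed
  then show ?thesis using M0 by (intro exI[of _ M]) auto
qed

text \<open>Each term is charged to R at the same point, or with the tiny weight W to R at distance
  J to the right or left. The shifted copies of R sum to at most \<open>rsum\<close>, whence 2
  W.\<close>

lemma second_deriv_sum:
  assumes n: "n \<ge> 1" and c: "\<And>t. t > 0 \<Longrightarrow> 2 * rfun a r n t = pf_eval n s c t"
    and \<epsilon>: "\<epsilon> > 0" and big: "3 * ln (1 + real r / (2 * \<epsilon>)) \<ge> 2 * real a / real r + 1"
    and \<delta>: "0 < \<delta>" "\<delta> \<le> 1"
    and C: "C = 3 * real r / \<epsilon> ^ 2 + 3 * real r + 2 * real a"
    and J: "real J \<le> \<epsilon> * real n" "real J \<le> \<delta> / (2 * C) * real n"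
  defines "E \<equiv> real ((6 * r + 2 * a) * n)"
  defines "W \<equiv> (E\<^sup>2 + E) * exp (- (\<delta> / 2) * real J)"
  defines "V \<equiv> \<lambda>k. pf_eval2 n s c (real (Suc k))"
  shows "summable V" "\<bar>suminf V\<bar> \<le> (\<delta>\<^sup>2 + C / real n + 2 * W) * rsum a r n"
proof -
  define f where "f = (\<lambda>k. rfun a r n (real (Suc k)))"
  \<comment> \<open>The shift of \<open>f\<close> to the right by J, padded with zeros, so that it
    has the same sum as \<open>f\<close>.\<close>
  define g where "g = (\<lambda>k. if k < J then 0 else f (k - J))"
  note growth = rfun_local_growth[OF n r ar' \<epsilon> big \<delta> C J]
  have f0: "f k \<ge> 0" for k unfolding f_def by (rule rfun_nonneg[OF n])
  have g0: "g k \<ge> 0" for k using f0 by (simp add: g_def)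
  have E0: "E \<ge> 0" by (simp add: E_def)
  have W0: "W \<ge> 0" using E0 by (simp add: W_def)
  have C0: "C \<ge> 0" unfolding C by simp
  define X where "X = \<delta>\<^sup>2 + C / real n"
  have X0: "X \<ge> 0" using C0 by (simp add: X_def)
  have Vle: "\<bar>V k\<bar> \<le> X * f k + W * (f (k + J) + g k)" for k
  proof (cases "Suc k \<le> r * n")
    case True
    then have "V k = 0" unfolding V_def by (intro rfun_second_deriv_zeros[OF c]) auto
    then show ?thesis using f0 g0 W0 X0 by simp
  next
    case False
    then have K: "Suc k > r * n" by simp
    define u where "u = rlog a r n (real (Suc k))"
    define u' where "u' = rlog' a r n (real (Suc k))"
    have "real (r * n) < real (Suc k)" using K by (intro of_nat_less_iff[THEN iffD2])
    then have V: "V k = f k * (u\<^sup>2 + u')"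
      unfolding V_def f_def u_def u'_def by (intro rfun_second_deriv[OF c])
    have crude: "\<bar>u\<bar> \<le> E" "\<bar>u'\<bar> \<le> E"
      using rlog_crude[OF n K, of a] by (simp_all add: u_def u'_def E_def)
    have "u\<^sup>2 \<le> E\<^sup>2" using crude(1) E0 by (metis abs_le_square_iff abs_of_nonneg)
    then have "\<bar>u\<^sup>2 + u'\<bar> \<le> E\<^sup>2 + E"
      unfolding abs_le_iff using crude(2) zero_le_power2[of u] zero_le_power2[of E] by linarith
    then have V1: "\<bar>V k\<bar> \<le> f k * (E\<^sup>2 + E)"
      unfolding V abs_mult using f0[of k] by (simp add: mult_left_mono)
    consider "u \<ge> \<delta>" | "u \<le> - \<delta>" | "\<bar>u\<bar> < \<delta>" by linarith
    then show ?thesis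
    proof cases
      case 1
      then have "f k \<le> exp (- (\<delta> / 2) * real J) * f (k + J)"
        using growth(1)[OF K] by (simp add: u_def f_def)
      then have "f k * (E\<^sup>2 + E) \<le> (exp (- (\<delta> / 2) * real J) * f (k + J)) * (E\<^sup>2 + E)"
        using E0 by (intro mult_right_mono) auto
      also have "\<dots> = W * f (k + J)" by (simp add: W_def)
      finally show ?thesis using V1 f0[of k] g0[of k] W0 X0 by (simp add: distrib_left add_increasing add_increasing2)
    next
      case 2
      then have *: "Suc k - J > r * n" "f k \<le> exp (- (\<delta> / 2) * real J) * rfun a r n (real (Suc k - J))"
        using growth(2)[OF K] unfolding u_def f_def by blast+
      then have "J \<le> k" by linarith
      then have "rfun a r n (real (Suc k - J)) = g k" by (simp add: g_def f_def Suc_diff_le)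
      then have "f k * (E\<^sup>2 + E) \<le> (exp (- (\<delta> / 2) * real J) * g k) * (E\<^sup>2 + E)"
        using E0 *(2) by (intro mult_right_mono) auto
      also have "\<dots> = W * g k" by (simp add: W_def)
      finally show ?thesis using V1 f0[of k] f0[of "k + J"] W0 X0 by (simp add: distrib_left add_increasing)
    next
      case 3
      then have "\<bar>u'\<bar> \<le> C / real n" using growth(3)[OF K] by (simp add: u_def u'_def)
      moreover have "u\<^sup>2 \<le> \<delta>\<^sup>2" using 3 \<delta> by (metis abs_le_square_iff abs_of_pos less_imp_le)
      ultimately have "\<bar>u\<^sup>2 + u'\<bar> \<le> X"
        unfolding X_def abs_le_iff using zero_le_power2[of u] zero_le_power2[of \<delta>] by linarith
      then have "\<bar>V k\<bar> \<le> X * f k" unfolding V abs_mult 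
        using mult_left_mono[OF \<open>\<bar>u\<^sup>2 + u'\<bar> \<le> X\<close> f0[of k]] f0[of k] by (simp add: mult.commute)
      then show ?thesis using f0[of "k + J"] g0[of k] W0 by (simp add: add_increasing2)
    qed
  qed
  have fs: "f sums rsum a r n" unfolding f_def rsum_def by (intro summable_sums summable_rfun n)
  have fJ: "(\<lambda>k. f (k + J)) sums (rsum a r n - (\<Sum>i<J. f i))"
    using fs by (simp add: sums_iff_shift)
  have gs: "g sums rsum a r n"
    by (subst sums_iff_shift'[of g J, symmetric]) (use fs in \<open>simp add: g_def\<close>)
  have bs: "(\<lambda>k. X * f k + W * (f (k + J) + g k)) sums (X * rsum a r n + W * ((rsum a r n - (\<Sum>i<J. f i)) + rsum a r n))"
    by (intro sums_add sums_mult fs fJ gs)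
  show Vs: "summable V"
    by (rule summable_comparison_test'[OF sums_summable[OF bs], where N = 0]) (use Vle in auto)
  have Va: "summable (\<lambda>k. \<bar>V k\<bar>)"
    by (rule summable_comparison_test'[OF sums_summable[OF bs], where N = 0]) (use Vle in auto)
  have "\<bar>suminf V\<bar> \<le> (\<Sum>k. \<bar>V k\<bar>)" by (rule summable_rabs[OF Va])
  also have "\<dots> \<le> (\<Sum>k. X * f k + W * (f (k + J) + g k))"
    by (intro suminf_le Vle Va sums_summable[OF bs])
  also have "\<dots> = X * rsum a r n + W * ((rsum a r n - (\<Sum>i<J. f i)) + rsum a r n)"
    using bs by (rule sums_unique[symmetric])
  also have "\<dots> \<le> X * rsum a r n + W * (rsum a r n + rsum a r n)"
    using W0 sum_nonneg[of "{..<J}" f] f0 by (intro add_left_mono mult_left_mono) auto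
  also have "\<dots> = (X + 2 * W) * rsum a r n" by (simp add: algebra_simps)
  finally show "\<bar>suminf V\<bar> \<le> (\<delta>\<^sup>2 + C / real n + 2 * W) * rsum a r n" by (simp add: X_def)
qed

text \<open>All expansions are treated at once, since one is chosen anew for every n. First
  \<delta>^2 \<le> \<eta> / 2 is fixed; what remains is of the form O(1 / n) plus a polynomial times
  a geometric factor.\<close>

lemma second_deriv_small:
  assumes \<eta>: "\<eta> > 0"
  shows "\<forall>\<^sub>F n in sequentially. \<forall>s c. (\<forall>t>0. 2 * rfun a r n t = pf_eval n s c t) \<longrightarrow>
    summable (\<lambda>k. pf_eval2 n s c (real (Suc k))) \<and> \<bar>\<Sum>k. pf_eval2 n s c (real (Suc k))\<bar> \<le> \<eta> * rsum a r n"
proof -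
  obtain \<epsilon> where \<epsilon>: "\<epsilon> > 0" "3 * ln (1 + real r / (2 * \<epsilon>)) \<ge> 2 * real a / real r + 1"
    using exists_left_margin[OF r, of a] by blast
  define C where "C = 3 * real r / \<epsilon> ^ 2 + 3 * real r + 2 * real a"
  have C0: "C > 0" unfolding C_def using r by (intro add_pos_nonneg add_nonneg_pos) auto
  define \<delta> where "\<delta> = min 1 (\<eta> / 2)"
  have \<delta>: "0 < \<delta>" "\<delta> \<le> 1" "\<delta> \<le> \<eta> / 2" using \<eta> by (auto simp: \<delta>_def)
  have d2: "\<delta>\<^sup>2 \<le> \<eta> / 2"
  proof -
    have "\<delta>\<^sup>2 \<le> \<delta> * 1" unfolding power2_eq_square using \<delta> by (intro mult_left_mono) auto
    then show ?thesis using \<delta> by simp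
  qed
  define p where "p = min \<epsilon> (\<delta> / (2 * C))"
  have p: "p > 0" "p \<le> \<epsilon>" "p \<le> \<delta> / (2 * C)" using \<epsilon> \<delta> C0 by (auto simp: p_def)
  define D where "D = real (6 * r + 2 * a)"
  define q where "q = exp (- (\<delta> / 2) * p)"
  have q: "0 < q" "q < 1" using \<delta> p by (auto simp: q_def)
  \<comment> \<open>A majorant of C / n + 2 W; the factor exp (\<delta> / 2) pays for rounding J
    down to an integer.\<close>
  define w where "w = (\<lambda>n. C * (1 / real n) + 2 * exp (\<delta> / 2) * (D\<^sup>2 * (real n ^ 2 * q ^ n) + D * (real n ^ 1 * q ^ n)))"
  have "w \<longlonglongrightarrow> C * 0 + 2 * exp (\<delta> / 2) * (D\<^sup>2 * 0 + D * 0)"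
    unfolding w_def by (intro tendsto_add tendsto_mult_left power_times_geometric_tendsto_0 q lim_1_over_n)
  then have "\<forall>\<^sub>F n in sequentially. w n < \<eta> / 2"
    using \<eta> by (intro order_tendstoD(2)) auto
  then show ?thesis
    using eventually_ge_at_top[of 1]
  proof eventually_elim
    case (elim n)
    note n = elim(2)
    define J where "J = nat \<lfloor>p * real n\<rfloor>"
    have pn: "p * real n \<ge> 0" using p by simp
    have J: "real J \<le> p * real n" "real J \<ge> p * real n - 1"
    proof -
      have "real J = of_int \<lfloor>p * real n\<rfloor>" using pn by (simp add: J_def)
      then show "real J \<le> p * real n" "real J \<ge> p * real n - 1" by linarith+
    qed
    have J1: "real J \<le> \<epsilon> * real n" "real J \<le> \<delta> / (2 * C) * real n"
      using J(1) p mult_right_mono[OF p(2), of "real n"] mult_right_mono[OF p(3), of "real n"] by linarith+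
    define E where "E = real ((6 * r + 2 * a) * n)"
    have E: "E = D * real n" by (simp add: E_def D_def)
    define W where "W = (E\<^sup>2 + E) * exp (- (\<delta> / 2) * real J)"
    have "- (\<delta> / 2) * real J \<le> - (\<delta> / 2) * (p * real n - 1)"
      using J(2) \<delta> by (intro mult_left_mono_neg) auto
    then have "exp (- (\<delta> / 2) * real J) \<le> exp (\<delta> / 2 + real n * (- (\<delta> / 2) * p))"
      by (simp add: algebra_simps)
    also have "\<dots> = exp (\<delta> / 2) * q ^ n" unfolding exp_add q_def exp_of_nat_mult ..
    finally have "W \<le> (E\<^sup>2 + E) * (exp (\<delta> / 2) * q ^ n)"
      unfolding W_def by (intro mult_left_mono) (auto simp: E_def)
    then have "C / real n + 2 * W \<le> w n"
      unfolding w_def E by (simp add: power_mult_distrib algebra_simps)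
    then have small: "\<delta>\<^sup>2 + C / real n + 2 * W \<le> \<eta>" using d2 elim(1) by simp
    show ?case
    proof (intro allI impI)
      fix s c assume c: "\<forall>t>0. 2 * rfun a r n t = pf_eval n s c t"
      have c': "2 * rfun a r n t = pf_eval n s c t" if "t > 0" for t using c that by blast
      note res = second_deriv_sum[OF n c' \<epsilon> \<delta>(1,2) C_def J1, folded E_def, folded W_def]
      have "\<bar>\<Sum>k. pf_eval2 n s c (real (Suc k))\<bar> \<le> \<eta> * rsum a r n"
        using res(2) small rsum_pos[OF n] by (meson less_imp_le mult_right_mono order_trans)
      with res(1) show "summable (\<lambda>k. pf_eval2 n s c (real (Suc k))) \<and> \<bar>\<Sum>k. pf_eval2 n s c (real (Suc k))\<bar> \<le> \<eta> * rsum a r n"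
        by blast
    qed
  qed
qed

text \<open>Since R(t) = O(1 / t^2) at the integers, t R(t) tends to 0, whereas t times the
  expansion tends to the sum of the coefficients of order 1.\<close>

lemma residue_sum_zero:
  assumes n: "n \<ge> 1" and c: "\<And>t. t > 0 \<Longrightarrow> 2 * rfun a r n t = pf_eval n s c t" and s: "s \<ge> 1"
  shows "(\<Sum>j\<le>n. c 1 j) = 0"
proof -
  have lim1: "(\<lambda>m. real (Suc m) * (c i j / (real (Suc m) + real j) ^ i)) \<longlonglongrightarrow> (if i = 1 then c i j else 0)"
    if "i \<ge> 1" for i j
  proof -
    have inv: "(\<lambda>m. 1 / (real (Suc m) + real j)) \<longlonglongrightarrow> 0" by real_asymp
    have q: "(\<lambda>m. real (Suc m) / (real (Suc m) + real j)) \<longlonglongrightarrow> 1" by real_asymp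
    have "(\<lambda>m. c i j * (real (Suc m) / (real (Suc m) + real j)) * (1 / (real (Suc m) + real j)) ^ (i - 1)) \<longlonglongrightarrow> c i j * 1 * 0 ^ (i - 1)"
      by (intro tendsto_mult tendsto_power inv q tendsto_const)
    moreover have "c i j * (real (Suc m) / (real (Suc m) + real j)) * (1 / (real (Suc m) + real j)) ^ (i - 1) =
        real (Suc m) * (c i j / (real (Suc m) + real j) ^ i)" for m
      using that by (cases i) (simp_all add: power_divide)
    ultimately have "(\<lambda>m. real (Suc m) * (c i j / (real (Suc m) + real j) ^ i)) \<longlonglongrightarrow> c i j * 1 * 0 ^ (i - 1)"
      by (simp only:)
    also have "c i j * 1 * 0 ^ (i - 1) = (if i = 1 then c i j else 0)"
      using that by (auto simp: power_0_left)
    finally show ?thesis .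
  qed
  have "(\<lambda>m. \<Sum>i\<in>{1..s}. \<Sum>j\<le>n. real (Suc m) * (c i j / (real (Suc m) + real j) ^ i)) \<longlonglongrightarrow>
        (\<Sum>i\<in>{1..s}. \<Sum>j\<le>n. if i = 1 then c i j else 0)"
    by (intro tendsto_sum lim1) auto
  moreover have "(\<Sum>i\<in>{1..s}. \<Sum>j\<le>n. if i = 1 then c i j else 0) = (\<Sum>i\<in>{1..s}. if i = 1 then \<Sum>j\<le>n. c 1 j else 0)"
    by (intro sum.cong refl) auto
  moreover have "\<dots> = (\<Sum>j\<le>n. c 1 j)" using s by simp
  moreover have "(\<Sum>i\<in>{1..s}. \<Sum>j\<le>n. real (Suc m) * (c i j / (real (Suc m) + real j) ^ i)) = real (Suc m) * (2 * rfun a r n (real (Suc m)))" for m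
  proof -
    have "2 * rfun a r n (real (Suc m)) = pf_eval n s c (real (Suc m))" by (rule c) simp
    then show ?thesis by (simp only: pf_eval_def sum_distrib_left)
  qed
  ultimately have lim: "(\<lambda>m. real (Suc m) * (2 * rfun a r n (real (Suc m)))) \<longlonglongrightarrow> (\<Sum>j\<le>n. c 1 j)" by simp
  have "(\<lambda>m. real (Suc m) * (2 * rfun a r n (real (Suc m)))) \<longlonglongrightarrow> 0"
  proof (rule Lim_null_comparison)
    show "(\<lambda>m. 2 * decay a r (real r) ^ n * (1 / real (Suc m))) \<longlonglongrightarrow> 0"
      by (intro tendsto_mult_right_zero LIMSEQ_Suc[OF lim_1_over_n])
    show "\<forall>\<^sub>F m in sequentially. norm (real (Suc m) * (2 * rfun a r n (real (Suc m)))) \<le> 2 * decay a r (real r) ^ n * (1 / real (Suc m))"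
    proof (intro always_eventually allI)
      fix m
      have "real (Suc m) * (2 * rfun a r n (real (Suc m))) \<le> real (Suc m) * (2 * (decay a r (real r) ^ n * (1 / real (Suc m) ^ 2)))"
        using rfun_le_r[OF n, of m] by (intro mult_left_mono) auto
      also have "\<dots> = 2 * decay a r (real r) ^ n * (1 / real (Suc m))"
        by (simp add: power2_eq_square del: of_nat_Suc)
      finally show "norm (real (Suc m) * (2 * rfun a r n (real (Suc m)))) \<le> 2 * decay a r (real r) ^ n * (1 / real (Suc m))"
        using rfun_nonneg[OF n, of m] by (simp add: abs_mult)
    qed
  qed
  then show ?thesis using lim LIMSEQ_unique by blast
qed

section \<open>The linear forms\<close>

text \<open>The constant 1 / (|lam| + 1) makes |lam V| at most \<open>rsum\<close>, so 2
  \<open>rsum\<close> + lam V lies between \<open>rsum\<close> and 3 \<open>rsum\<close> for every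
  real lam; in particular the form is positive.\<close>

lemma linear_form:
  fixes lam :: real
  assumes oa: "odd a" and en: "even n" and n: "n \<ge> 1"
    and small: "\<forall>s c. (\<forall>t>0. 2 * rfun a r n t = pf_eval n s c t) \<longrightarrow>
      summable (\<lambda>k. pf_eval2 n s c (real (Suc k))) \<and> \<bar>\<Sum>k. pf_eval2 n s c (real (Suc k))\<bar> \<le> (1 / (\<bar>lam\<bar> + 1)) * rsum a r n"
  shows "\<exists>P :: nat \<Rightarrow> int. 
     (\<forall>k\<in>gen_index a. \<bar>of_int (P k)\<bar> \<le> real (common_denom n) ^ (a + 2) * (2 * (fact a * coeff_growth a r ^ n) * ((real a + 1)\<^sup>2 * (real n + 1)))) \<and>
     real (common_denom n) ^ (a + 2) * rsum a r n \<le> (\<Sum>k\<in>gen_index a. of_int (P k) * gen_value lam k) \<and>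
     (\<Sum>k\<in>gen_index a. of_int (P k) * gen_value lam k) \<le> 3 * real (common_denom n) ^ (a + 2) * rsum a r n"
proof -
  have a1: "a > 0" using ar by simp
  obtain c where c: "pf_int n a c" "pf_norm n a c \<le> 2 * (fact a * coeff_growth a r ^ n)"
    "\<And>t. (\<And>j. j \<le> n \<Longrightarrow> t + real j \<noteq> 0) \<Longrightarrow> 2 * rfun a r n t = pf_eval n a c t"
    "\<And>i. even i \<Longrightarrow> (\<Sum>j\<le>n. c i j) = 0"
    using pf_rep_antisym[OF pf_rep_rfun[OF ar' a1, of n]] rfun_antisym[OF en oa, of r] by blast
  have c3: "2 * rfun a r n t = pf_eval n a c t" if "t > 0" for t
    by (rule c(3)) (use that in \<open>metis add_pos_nonneg of_nat_0_le_iff less_irrefl\<close>)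
  define \<rho> where "\<rho> = (\<lambda>i. \<Sum>j\<le>n. c i j)"
  have \<rho>1: "\<rho> 1 = 0" unfolding \<rho>_def using a1 by (intro residue_sum_zero[OF n c3]) auto
  have \<rho>e: "\<rho> i = 0" if "even i" for i using c(4)[OF that] by (simp add: \<rho>_def)
  define V where "V = (\<Sum>k. pf_eval2 n a c (real (Suc k)))"
  have V: "summable (\<lambda>k. pf_eval2 n a c (real (Suc k)))" "\<bar>V\<bar> \<le> (1 / (\<bar>lam\<bar> + 1)) * rsum a r n"
    using small c3 unfolding V_def by blast+
  define b where "b = (\<lambda>i. real (Suc i choose 2))"
  define H0 where "H0 = (\<Sum>i\<in>{1..a}. \<Sum>j\<le>n. c i j * harm_sum j i)"
  define H2 where "H2 = (\<Sum>i\<in>{1..a}. \<Sum>j\<le>n. c i j * (b i * harm_sum j (i + 2)))"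
  have sumR: "2 * rsum a r n = (\<Sum>i\<in>{1..a}. \<rho> i * zeta i) - H0"
  proof -
    have "(\<lambda>m. \<Sum>i\<in>{1..a}. \<Sum>j\<le>n. c i j / (real (Suc m) + real j) ^ (i + 0)) sums
       ((\<Sum>i\<in>{1..a}. \<rho> i * zeta (i + 0)) - (\<Sum>i\<in>{1..a}. \<Sum>j\<le>n. c i j * harm_sum j (i + 0)))"
      unfolding \<rho>_def by (rule pf_zeta_sums) (use \<rho>1 in \<open>simp add: \<rho>_def\<close>)
    moreover have "(\<Sum>i\<in>{1..a}. \<Sum>j\<le>n. c i j / (real (Suc m) + real j) ^ (i + 0)) = 2 * rfun a r n (real (Suc m))" for m
      by (subst c3) (simp_all add: pf_eval_def)
    moreover have "(\<lambda>m. 2 * rfun a r n (real (Suc m))) sums (2 * rsum a r n)"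
      unfolding rsum_def by (intro sums_mult summable_sums summable_rfun n)
    ultimately show ?thesis using sums_unique2 by (simp only: H0_def add_0_right) blast
  qed
  have sumV: "V = (\<Sum>i\<in>{1..a}. b i * \<rho> i * zeta (i + 2)) - H2"
  proof -
    have "(\<lambda>m. \<Sum>i\<in>{1..a}. \<Sum>j\<le>n. (b i * c i j) / (real (Suc m) + real j) ^ (i + 2)) sums
       ((\<Sum>i\<in>{1..a}. (\<Sum>j\<le>n. b i * c i j) * zeta (i + 2)) - (\<Sum>i\<in>{1..a}. \<Sum>j\<le>n. (b i * c i j) * harm_sum j (i + 2)))"
      by (rule pf_zeta_sums) simp
    moreover have "(\<lambda>m. \<Sum>i\<in>{1..a}. \<Sum>j\<le>n. (b i * c i j) / (real (Suc m) + real j) ^ (i + 2)) sums V"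
      using summable_sums[OF V(1)] by (simp only: V_def pf_eval2_def b_def)
    ultimately have "V = (\<Sum>i\<in>{1..a}. (\<Sum>j\<le>n. b i * c i j) * zeta (i + 2)) - (\<Sum>i\<in>{1..a}. \<Sum>j\<le>n. (b i * c i j) * harm_sum j (i + 2))"
      using sums_unique2 by blast
    then show ?thesis unfolding H2_def \<rho>_def by (simp only: sum_distrib_left mult_ac)
  qed
  define D where "D = real (common_denom n)"
  have D1: "D \<ge> 1" using common_denom_pos[of n] by (simp add: D_def)
  have cI: "D ^ (a - i) * c i j \<in> \<int>" if "i \<in> {1..a}" "j \<le> n" for i j
    using c(1) that by (simp add: pf_int_def D_def)
  have DI: "D ^ k \<in> \<int>" for k by (simp add: D_def)
  have \<rho>I: "D ^ (a + 2) * \<rho> i \<in> \<int>" if "i \<in> {1..a}" for i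
    unfolding \<rho>_def sum_distrib_left
  proof (intro Ints_sum)
    fix j assume "j \<in> {..n}"
    then have "D ^ (i + 2) * (D ^ (a - i) * c i j) \<in> \<int>" using that by (intro Ints_mult[OF DI cI]) auto
    moreover have "D ^ (i + 2) * D ^ (a - i) = D ^ (a + 2)"
      unfolding power_add [symmetric] by (rule arg_cong[of _ _ "\<lambda>k. D ^ k"]) (use that in simp)
    then have "D ^ (i + 2) * (D ^ (a - i) * c i j) = D ^ (a + 2) * c i j"
      by (simp only: mult.assoc [symmetric])
    ultimately show "D ^ (a + 2) * c i j \<in> \<int>" by (simp only:)
  qed
  have H0I: "D ^ (a + 2) * H0 \<in> \<int>"
    unfolding H0_def sum_distrib_left
  proof (intro Ints_sum)
    fix i j assume ij: "i \<in> {1..a}" "j \<in> {..n}"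
    have "D ^ 2 * (D ^ (a - i) * c i j) * (D ^ i * harm_sum j i) \<in> \<int>"
      using ij harm_sum_Ints[of j n i] by (intro Ints_mult[OF Ints_mult[OF DI cI]]) (auto simp: D_def)
    moreover have "D ^ 2 * D ^ (a - i) * D ^ i = D ^ (a + 2)" using ij by (simp add: power_add [symmetric])
    ultimately show "D ^ (a + 2) * (c i j * harm_sum j i) \<in> \<int>" by (metis mult.assoc mult.commute mult.left_commute)
  qed
  \<comment> \<open>Coefficients of order i need the power a - i of the denominator and the harmonic
    sums of the second derivative the power i + 2: this fixes the exponent a + 2.\<close>
  have H2I: "D ^ (a + 2) * H2 \<in> \<int>"
    unfolding H2_def sum_distrib_left
  proof (intro Ints_sum)
    fix i j assume ij: "i \<in> {1..a}" "j \<in> {..n}"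
    have "b i * (D ^ (a - i) * c i j) * (D ^ (i + 2) * harm_sum j (i + 2)) \<in> \<int>"
      using ij harm_sum_Ints[of j n "i + 2"] by (intro Ints_mult[OF Ints_mult[OF _ cI]]) (auto simp: D_def b_def)
    moreover have "D ^ (a - i) * D ^ (i + 2) = D ^ (a + 2)" using ij by (simp add: power_add [symmetric])
    then have "D ^ (a + 2) * (c i j * (b i * harm_sum j (i + 2))) = b i * (D ^ (a - i) * c i j) * (D ^ (i + 2) * harm_sum j (i + 2))"
      by (metis mult.assoc mult.commute mult.left_commute)
    ultimately show "D ^ (a + 2) * (c i j * (b i * harm_sum j (i + 2))) \<in> \<int>" by (simp only:)
  qed
  \<comment> \<open>The rational parts of the two sums become the coefficients of 1 and of lam; the
    coefficient sum of order k belongs to both zeta(k) and zeta(k + 2), hence to a single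
    generator.\<close>
  define Pr where "Pr = (\<lambda>k. if k = 0 then - (D ^ (a + 2) * H0) else if k = 1 then - (D ^ (a + 2) * H2) else D ^ (a + 2) * \<rho> k)"
  have "\<exists>z::int. of_int z = Pr k" if "k \<in> gen_index a" for k
  proof -
    have "Pr k \<in> \<int>" using that H0I H2I \<rho>I by (auto simp: Pr_def gen_index_def)
    then show ?thesis by (metis Ints_cases)
  qed
  then obtain P :: "nat \<Rightarrow> int" where P: "\<And>k. k \<in> gen_index a \<Longrightarrow> of_int (P k) = Pr k" by metis
  have L: "(\<Sum>k\<in>gen_index a. of_int (P k) * gen_value lam k) = D ^ (a + 2) * (2 * rsum a r n + lam * V)"
  proof -
    define O' where "O' = {i. odd i \<and> 3 \<le> i \<and> i \<le> a}"
    have O': "finite O'" "0 \<notin> O'" "1 \<notin> O'" "gen_index a = insert 0 (insert 1 O')"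
      using finite_gen_index[of a] by (auto simp: O'_def gen_index_def)
    have O'2: "k \<noteq> 0" "k \<noteq> 1" if "k \<in> O'" for k using that O'(2,3) by metis+
    have "(\<Sum>k\<in>gen_index a. of_int (P k) * gen_value lam k) = (\<Sum>k\<in>gen_index a. Pr k * gen_value lam k)"
      by (intro sum.cong) (auto simp: P)
    also have "\<dots> = - (D ^ (a + 2) * H0) + (- (D ^ (a + 2) * H2) * lam + (\<Sum>k\<in>O'. Pr k * gen_value lam k))"
      unfolding O'(4) using O'(1-3) by (simp add: Pr_def gen_value_def)
    also have "(\<Sum>k\<in>O'. Pr k * gen_value lam k) = (\<Sum>k\<in>O'. D ^ (a + 2) * (\<rho> k * zeta k + lam * (b k * \<rho> k * zeta (k + 2))))"
    proof (intro sum.cong refl)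
      fix k assume "k \<in> O'"
      note k = O'2[OF this]
      show "Pr k * gen_value lam k = D ^ (a + 2) * (\<rho> k * zeta k + lam * (b k * \<rho> k * zeta (k + 2)))"
        using k by (simp add: Pr_def gen_value_def b_def algebra_simps)
    qed
    also have "\<dots> = D ^ (a + 2) * ((\<Sum>k\<in>O'. \<rho> k * zeta k) + lam * (\<Sum>k\<in>O'. b k * \<rho> k * zeta (k + 2)))"
      by (simp only: sum_distrib_left sum.distrib distrib_left)
    also have "(\<Sum>k\<in>O'. \<rho> k * zeta k) = (\<Sum>k\<in>{1..a}. \<rho> k * zeta k)"
      unfolding O'_def by (rule sum_gen_index[symmetric]) (use \<rho>1 \<rho>e in auto)
    also have "(\<Sum>k\<in>O'. b k * \<rho> k * zeta (k + 2)) = (\<Sum>k\<in>{1..a}. b k * \<rho> k * zeta (k + 2))"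
      unfolding O'_def by (rule sum_gen_index[symmetric]) (use \<rho>1 \<rho>e in auto)
    finally show ?thesis unfolding sumR sumV by (simp only: ring_distribs mult_ac) simp
  qed
  have "\<bar>lam * V\<bar> \<le> rsum a r n"
  proof -
    have "\<bar>lam * V\<bar> \<le> \<bar>lam\<bar> * ((1 / (\<bar>lam\<bar> + 1)) * rsum a r n)"
      unfolding abs_mult using V(2) by (intro mult_left_mono) auto
    also have "\<dots> = (\<bar>lam\<bar> / (\<bar>lam\<bar> + 1)) * rsum a r n" by simp
    also have "\<dots> \<le> 1 * rsum a r n" using rsum_pos[OF n] by (intro mult_right_mono) auto
    finally show ?thesis by simp
  qed
  then have two: "rsum a r n \<le> 2 * rsum a r n + lam * V" "2 * rsum a r n + lam * V \<le> 3 * rsum a r n" by linarith+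
  have D0: "D ^ (a + 2) \<ge> 0" using D1 by simp
  define Y where "Y = (real a + 1)\<^sup>2 * (real n + 1)"
  have Y: "1 \<le> Y" "real n \<le> Y" "(real a + 1)\<^sup>2 * real n \<le> Y"
  proof -
    have "1 \<le> (real a + 1)\<^sup>2" by (intro one_le_power) simp
    then have "1 * (real n + 1) \<le> Y" unfolding Y_def by (intro mult_right_mono) auto
    then show "1 \<le> Y" "real n \<le> Y" by auto
    show "(real a + 1)\<^sup>2 * real n \<le> Y" unfolding Y_def by (intro mult_left_mono) auto
  qed
  have bb: "0 \<le> b i" "b i \<le> (real a + 1)\<^sup>2" if "i \<in> {1..a}" for i
  proof -
    have "Suc i choose 2 \<le> (Suc i) ^ 2" using that by (intro binomial_le_pow) auto
    also have "\<dots> \<le> (a + 1) ^ 2" using that by (intro power_mono) auto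
    finally have "real (Suc i choose 2) \<le> real ((a + 1) ^ 2)" by (rule of_nat_mono)
    then show "b i \<le> (real a + 1)\<^sup>2" by (simp add: b_def add.commute)
  qed (simp add: b_def)
  have nrm: "pf_norm n a c \<ge> 0" by (simp add: pf_norm_def sum_nonneg)
  have PB: "\<bar>Pr k\<bar> \<le> D ^ (a + 2) * (pf_norm n a c * Y)" if k: "k \<in> gen_index a" for k
  proof -
    have h: "\<bar>harm_sum j m\<bar> \<le> real n" if "j \<le> n" for j m
      using harm_sum_bounds[of j m] that by (simp add: order_trans[of _ "real j"])
    have 0: "\<bar>H0\<bar> \<le> pf_norm n a c * Y"
      unfolding H0_def using h Y(2) by (intro pf_sum_bound) (meson order_trans)
    have 2: "\<bar>H2\<bar> \<le> pf_norm n a c * Y"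
      unfolding H2_def
    proof (rule pf_sum_bound)
      fix i j assume ij: "i \<in> {1..a}" "j \<le> n"
      have "\<bar>b i * harm_sum j (i + 2)\<bar> \<le> (real a + 1)\<^sup>2 * real n"
        unfolding abs_mult using bb[OF ij(1)] h[OF ij(2)] by (intro mult_mono) auto
      then show "\<bar>b i * harm_sum j (i + 2)\<bar> \<le> Y" using Y(3) by linarith
    qed
    have 3: "\<bar>\<rho> i\<bar> \<le> pf_norm n a c * Y" if "i \<in> {1..a}" for i
    proof -
      have "\<bar>\<rho> i\<bar> \<le> (\<Sum>j\<le>n. \<bar>c i j\<bar>)" unfolding \<rho>_def by (rule sum_abs)
      also have "\<dots> \<le> pf_norm n a c"
        unfolding pf_norm_def using that by (intro member_le_sum[of i "{1..a}" "\<lambda>i. \<Sum>j\<le>n. \<bar>c i j\<bar>"]) (auto intro: sum_nonneg)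
      also have "\<dots> \<le> pf_norm n a c * Y" using nrm Y(1) by (simp add: mult_le_cancel_left1)
      finally show ?thesis .
    qed
    consider "k = 0" | "k = 1" | "k \<noteq> 0" "k \<noteq> 1" "k \<in> {1..a}" using k by (auto simp: gen_index_def)
    then obtain v where v: "\<bar>Pr k\<bar> = \<bar>D ^ (a + 2) * v\<bar>" "\<bar>v\<bar> \<le> pf_norm n a c * Y"
    proof cases
      case 1 then show ?thesis using 0 by (intro that[of H0]) (simp_all add: Pr_def)
    next
      case 2 then show ?thesis using \<open>\<bar>H2\<bar> \<le> _\<close> by (intro that[of H2]) (simp_all add: Pr_def)
    next
      case 3 then show ?thesis using \<open>\<And>i. i \<in> {1..a} \<Longrightarrow> \<bar>\<rho> i\<bar> \<le> _\<close> by (intro that[of "\<rho> k"]) (simp_all add: Pr_def)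
    qed
    then show ?thesis
      using D0 by (simp only: abs_mult abs_of_nonneg mult_left_mono)
  qed
  show ?thesis
  proof (intro exI[of _ P] conjI ballI)
    fix k assume k: "k \<in> gen_index a"
    have "\<bar>real_of_int (P k)\<bar> \<le> D ^ (a + 2) * (pf_norm n a c * Y)" using PB[OF k] P[OF k] by simp
    also have "\<dots> \<le> D ^ (a + 2) * (2 * (fact a * coeff_growth a r ^ n) * Y)"
      using c(2) D0 Y(1) by (intro mult_left_mono mult_right_mono) auto
    finally show "\<bar>real_of_int (P k)\<bar> \<le> real (common_denom n) ^ (a + 2) * (2 * (fact a * coeff_growth a r ^ n) * ((real a + 1)\<^sup>2 * (real n + 1)))"
      by (simp add: D_def Y_def)
  next
    show "real (common_denom n) ^ (a + 2) * rsum a r n \<le> (\<Sum>k\<in>gen_index a. of_int (P k) * gen_value lam k)"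
      unfolding L D_def[symmetric] using two(1) D0 by (intro mult_left_mono)
    have "(\<Sum>k\<in>gen_index a. of_int (P k) * gen_value lam k) \<le> D ^ (a + 2) * (3 * rsum a r n)"
      unfolding L using two(2) D0 by (intro mult_left_mono)
    then show "(\<Sum>k\<in>gen_index a. of_int (P k) * gen_value lam k) \<le> 3 * real (common_denom n) ^ (a + 2) * rsum a r n"
      by (simp add: D_def mult_ac)
  qed
qed

section \<open>The dimension bound\<close>

lemma ln_coeff_growth: "ln (coeff_growth a r) = real a * ln 2 + 6 * real r * (1 + ln (real (Suc r)))"
  unfolding coeff_growth_def by (simp add: ln_mult ln_realpow)

lemma coeff_growth_ge_1: "coeff_growth a r \<ge> 1"
proof -
  have "exp 1 * real (Suc r) \<ge> 1 * 1" by (intro mult_mono) auto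
  then have "1 * 1 \<le> 2 ^ a * (exp 1 * real (Suc r)) ^ (6 * r)"
    by (intro mult_mono one_le_power) auto
  then show ?thesis by (simp add: coeff_growth_def)
qed

lemma ln_decay: "ln (decay a r (real r)) = real r * ln 27 - (real a - 6 * real r) * ln (real r)"
proof -
  have "ln (decay a r (real r)) = real (a - 6 * r) * ln (1 / real r) + real r * ln 27"
    unfolding decay_def using r by (subst ln_mult) (simp_all add: ln_realpow)
  then show ?thesis using r ar by (simp add: ln_div of_nat_diff)
qed

text \<open>Contraposition of the criterion: if the product were below 1, its geometric powers would
  beat all polynomial factors in n, and the smallness hypothesis would hold.\<close>

lemma growth_times_decay_ge_1:
  fixes lam \<eta> :: real
  assumes oa: "odd a" and \<eta>: "\<eta> > 0"
  defines "e \<equiv> rat_real.dim (rat_real.span (zeta_generators lam a)) - 1"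
  defines "Q \<equiv> exp ((1 + \<eta>) * real (a + 2))"
  shows "1 \<le> (Q * coeff_growth a r) ^ e * (Q * decay a r (real r))"
proof (rule ccontr)
  define \<beta> where "\<beta> = Q * coeff_growth a r"
  define \<alpha> where "\<alpha> = Q * decay a r (real r)"
  assume "\<not> ?thesis"
  then have lt: "\<beta> ^ e * \<alpha> < 1" by (simp add: \<beta>_def \<alpha>_def)
  have Q1: "Q \<ge> 1" using \<eta> by (simp add: Q_def)
  have "1 * 1 \<le> Q * coeff_growth a r" using Q1 coeff_growth_ge_1 by (intro mult_mono) auto
  then have \<beta>1: "\<beta> \<ge> 1" by (simp add: \<beta>_def)
  have \<alpha>0: "\<alpha> > 0" using Q1 decay_pos[of "real r"] r by (simp add: \<alpha>_def)
  have "1 * \<alpha> \<le> \<beta> ^ e * \<alpha>" using \<beta>1 \<alpha>0 by (intro mult_right_mono one_le_power) auto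
  then have \<alpha>1: "\<alpha> < 1" using lt by simp
  obtain M where M: "M \<ge> 0" "\<forall>\<^sub>F n in sequentially.
     rsum a r n \<le> 2 * (((M * real n + real n + 2 * real r + 3) ^ (2 * r + 2)) ^ a) * rsum a r (n + 2)"
    using rsum_regular by blast
  define small where "small n \<longleftrightarrow> (\<forall>s c. (\<forall>t>0. 2 * rfun a r n t = pf_eval n s c t) \<longrightarrow>
      summable (\<lambda>k. pf_eval2 n s c (real (Suc k))) \<and> \<bar>\<Sum>k. pf_eval2 n s c (real (Suc k))\<bar> \<le> (1 / (\<bar>lam\<bar> + 1)) * rsum a r n)" for n
  define reg where "reg n \<longleftrightarrow> rsum a r n \<le> 2 * (((M * real n + real n + 2 * real r + 3) ^ (2 * r + 2)) ^ a) * rsum a r (n + 2)" for n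
  have "1 / (\<bar>lam\<bar> + 1) > 0" by simp
  from second_deriv_small[OF this] have "\<forall>\<^sub>F n in sequentially. small n" unfolding small_def .
  moreover have "\<forall>\<^sub>F n in sequentially. reg n" unfolding reg_def by (rule M(2))
  ultimately have "\<forall>\<^sub>F n in sequentially. real (common_denom n) \<le> exp ((1 + \<eta>) * real n) \<and> small n \<and> reg n"
    using common_denom_upper[OF \<eta>] by eventually_elim blast
  then obtain n0 where n0: "\<And>n. n \<ge> n0 \<Longrightarrow> real (common_denom n) \<le> exp ((1 + \<eta>) * real n)"
    "\<And>n. n \<ge> n0 \<Longrightarrow> small n" "\<And>n. n \<ge> n0 \<Longrightarrow> reg n"
    unfolding eventually_sequentially by blast
  note n0 = n0(1) n0(2)[unfolded small_def] n0(3)[unfolded reg_def]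
  \<comment> \<open>Even, as the antisymmetry demands, positive, and past all thresholds hidden in
    "eventually".\<close>
  define \<nu> where "\<nu> = (\<lambda>m. 2 * (m + n0 + 1))"
  have \<nu>: "even (\<nu> m)" "\<nu> m \<ge> 1" "\<nu> m \<ge> n0" "\<nu> (Suc m) = \<nu> m + 2" for m by (auto simp: \<nu>_def)
  define d where "d = (\<lambda>n. real (common_denom n) ^ (a + 2))"
  define good where "good m P \<longleftrightarrow>
     (\<forall>k\<in>gen_index a. \<bar>of_int (P k)\<bar> \<le> d (\<nu> m) * (2 * (fact a * coeff_growth a r ^ \<nu> m) * ((real a + 1)\<^sup>2 * (real (\<nu> m) + 1)))) \<and>
     d (\<nu> m) * rsum a r (\<nu> m) \<le> (\<Sum>k\<in>gen_index a. of_int (P k) * gen_value lam k) \<and>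
     (\<Sum>k\<in>gen_index a. of_int (P k) * gen_value lam k) \<le> 3 * d (\<nu> m) * rsum a r (\<nu> m)"
    for m and P :: "nat \<Rightarrow> int"
  have "\<exists>P. good m P" for m
    unfolding good_def d_def by (rule linear_form[OF oa \<nu>(1,2) n0(2)[OF \<nu>(3)]])
  then obtain P where "\<And>m. good m (P m)" by metis
  note P = this[unfolded good_def, THEN conjunct1, rule_format]
    this[unfolded good_def, THEN conjunct2, THEN conjunct1]
    this[unfolded good_def, THEN conjunct2, THEN conjunct2]
  define L where "L = (\<lambda>m. \<Sum>k\<in>gen_index a. of_int (P m k) * gen_value lam k)"
  have d0: "d n > 0" for n using common_denom_pos[of n] by (simp add: d_def)
  have dQ: "d (\<nu> m) \<le> Q ^ \<nu> m" for m
  proof -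
    have "d (\<nu> m) \<le> exp ((1 + \<eta>) * real (\<nu> m)) ^ (a + 2)"
      unfolding d_def by (intro power_mono n0(1) \<nu>(3)) auto
    also have "\<dots> = Q ^ \<nu> m" unfolding Q_def by (simp only: exp_of_nat_mult [symmetric] mult_ac)
    finally show ?thesis .
  qed
  have Lpos: "L m > 0" for m
    using P(2)[of m] mult_pos_pos[OF d0 rsum_pos[OF \<nu>(2)], of "\<nu> m" m] by (simp add: L_def)
  define c1 where "c1 = 2 * fact a * (real a + 1)\<^sup>2"
  have c1: "c1 > 0" by (simp add: c1_def)
  define B where "B = (\<lambda>m. \<beta> ^ \<nu> m * (c1 * (real (\<nu> m) + 1)))"
  define A where "A = (\<lambda>m. 3 * Z2 * \<alpha> ^ \<nu> m)"
  define Y where "Y = (\<lambda>m. ((M * real (\<nu> m) + real (\<nu> m) + 2 * real r + 3) ^ (2 * r + 2)) ^ a)"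
  have Y0: "Y m > 0" for m unfolding Y_def using M(1) by (intro zero_less_power add_nonneg_pos add_nonneg_nonneg) auto
  \<comment> \<open>The 6 is 3 times 2: the ratio of the upper to the lower bound for a form, and
    the factor lost in \<open>rsum_regular\<close>. The denominators increase with n, so they do not
    spoil the comparison.\<close>
  define \<kappa> where "\<kappa> = (\<lambda>m. 1 / (6 * Y m))"
  have sub: "filterlim \<nu> at_top sequentially"
    by (rule filterlim_subseq) (auto simp: strict_mono_def \<nu>_def)
  show False
  proof (rule nesterenko_criterion[where I = "gen_index a" and g = "gen_value lam" and P = P and B = B and A = A and \<kappa> = \<kappa>])
    show "finite (gen_index a)" by (rule finite_gen_index)
    show "1 \<in> gen_value lam ` gen_index a" unfolding gen_image by (simp add: zeta_generators_def)
    show "(\<Sum>k\<in>gen_index a. of_int (P m k) * gen_value lam k) \<noteq> 0" for m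
      using Lpos[of m] by (simp add: L_def)
    show "\<bar>of_int (P m k)\<bar> \<le> B m" if "k \<in> gen_index a" for m k
    proof -
      have "\<bar>real_of_int (P m k)\<bar> \<le> d (\<nu> m) * (2 * (fact a * coeff_growth a r ^ \<nu> m) * ((real a + 1)\<^sup>2 * (real (\<nu> m) + 1)))"
        by (rule P(1)[OF that])
      also have "\<dots> \<le> Q ^ \<nu> m * (2 * (fact a * coeff_growth a r ^ \<nu> m) * ((real a + 1)\<^sup>2 * (real (\<nu> m) + 1)))"
        using coeff_growth_ge_1 by (intro mult_right_mono dQ) auto
      also have "\<dots> = B m" by (simp add: B_def c1_def \<beta>_def power_mult_distrib)
      finally show ?thesis .
    qed
    show "\<bar>\<Sum>k\<in>gen_index a. of_int (P m k) * gen_value lam k\<bar> \<le> A m" for m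
    proof -
      have "L m \<le> 3 * d (\<nu> m) * rsum a r (\<nu> m)" using P(3)[of m] by (simp add: L_def)
      also have "\<dots> \<le> 3 * Q ^ \<nu> m * (decay a r (real r) ^ \<nu> m * Z2)"
        using dQ[of m] d0[of "\<nu> m"] rsum_le[OF \<nu>(2)[of m]] rsum_pos[OF \<nu>(2)[of m]] Q1
        by (intro mult_mono) auto
      also have "\<dots> = A m" by (simp add: A_def \<alpha>_def power_mult_distrib)
      finally show ?thesis using Lpos[of m] by (simp add: L_def)
    qed
    have "(\<lambda>n. 3 * Z2 * \<alpha> ^ n) \<longlonglongrightarrow> 3 * Z2 * 0"
      using \<alpha>0 \<alpha>1 by (intro tendsto_mult_left LIMSEQ_power_zero) auto
    then show "A \<longlonglongrightarrow> 0" unfolding A_def using filterlim_compose[OF _ sub] by fastforce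
    show "\<kappa> m > 0" for m using Y0 by (simp add: \<kappa>_def)
    show "\<kappa> m * \<bar>\<Sum>k\<in>gen_index a. of_int (P m k) * gen_value lam k\<bar> \<le> \<bar>\<Sum>k\<in>gen_index a. of_int (P (Suc m) k) * gen_value lam k\<bar>" for m
    proof -
      have "L m \<le> 3 * d (\<nu> m) * rsum a r (\<nu> m)" using P(3)[of m] by (simp add: L_def)
      also have "\<dots> \<le> 3 * d (\<nu> m) * (2 * Y m * rsum a r (\<nu> (Suc m)))"
        using n0(3)[OF \<nu>(3)[of m]] d0[of "\<nu> m"] by (intro mult_left_mono) (auto simp: Y_def \<nu>(4))
      also have "\<dots> = 6 * Y m * (d (\<nu> m) * rsum a r (\<nu> (Suc m)))" by simp
      also have "\<dots> \<le> 6 * Y m * (d (\<nu> (Suc m)) * rsum a r (\<nu> (Suc m)))"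
      proof (intro mult_left_mono mult_right_mono)
        show "d (\<nu> m) \<le> d (\<nu> (Suc m))"
          unfolding d_def using common_denom_mono[of "\<nu> m" "\<nu> (Suc m)"] by (intro power_mono) (auto simp: \<nu>(4))
      qed (use Y0[of m] rsum_pos[OF \<nu>(2)[of "Suc m"]] in auto)
      also have "\<dots> \<le> 6 * Y m * L (Suc m)"
        using P(2)[of "Suc m"] Y0[of m] by (intro mult_left_mono) (auto simp: L_def)
      finally have "\<kappa> m * L m \<le> L (Suc m)" using Y0[of m] by (simp add: \<kappa>_def field_simps)
      then show ?thesis using Lpos[of m] Lpos[of "Suc m"] by (simp add: L_def)
    qed
    fix K :: real assume K: "K > 0"
    define p where "p = (2 * r + 2) * a"
    define G where "G = M + 2 * real r + 4"
    have G0: "G > 0" using M(1) by (simp add: G_def)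
    \<comment> \<open>Everything independent of n: \<beta>^2 because the bound is taken at n + 2, 4
      from n + 3 \<le> 4n, and 6 G^p from 1 / \<kappa>.\<close>
    define X where "X = K * \<beta>\<^sup>2 * (c1 * 4) * (6 * G ^ p)"
    have bound: "(K * B (Suc m) / \<kappa> m) ^ e * (K * A m) \<le> (X ^ e * (K * 3 * Z2)) * (real (\<nu> m) ^ ((p + 1) * e) * (\<beta> ^ e * \<alpha>) ^ \<nu> m)" for m
    proof -
      define n where "n = \<nu> m"
      have n: "n \<ge> 1" using \<nu>(2) by (simp add: n_def)
      have "Y m = (M * real n + real n + 2 * real r + 3) ^ p" by (simp only: Y_def n_def p_def power_mult)
      also have "\<dots> \<le> (G * real n) ^ p"
      proof (rule power_mono)
        have "2 * real r + 3 \<le> (2 * real r + 3) * real n" using n by (simp add: mult_le_cancel_left1)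
        then show "M * real n + real n + 2 * real r + 3 \<le> G * real n" by (simp add: G_def algebra_simps)
      qed (use M(1) in auto)
      finally have Yle: "Y m \<le> G ^ p * real n ^ p" by (simp add: power_mult_distrib)
      have "K * B (Suc m) / \<kappa> m = K * (\<beta> ^ (n + 2) * (c1 * (real n + 3))) * (6 * Y m)"
        by (simp add: B_def \<kappa>_def \<nu>(4) n_def)
      also have "\<dots> \<le> K * (\<beta> ^ (n + 2) * (c1 * (4 * real n))) * (6 * (G ^ p * real n ^ p))"
        using n K \<beta>1 c1 Yle Y0[of m] by (intro mult_mono mult_left_mono) auto
      also have "\<dots> = X * real n ^ (p + 1) * \<beta> ^ n"
        by (simp add: X_def power_add power2_eq_square)
      finally have "(K * B (Suc m) / \<kappa> m) ^ e \<le> (X * real n ^ (p + 1) * \<beta> ^ n) ^ e"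
        using K Y0[of m] \<beta>1 c1 by (intro power_mono) (auto simp: B_def \<kappa>_def)
      then have "(K * B (Suc m) / \<kappa> m) ^ e * (K * A m) \<le> (X * real n ^ (p + 1) * \<beta> ^ n) ^ e * (K * A m)"
        using K \<alpha>0 Z2_pos by (intro mult_right_mono) (auto simp: A_def)
      also have "\<dots> = (X ^ e * (K * 3 * Z2)) * (real n ^ ((p + 1) * e) * (\<beta> ^ e * \<alpha>) ^ n)"
        by (simp only: A_def n_def[symmetric] power_mult_distrib power_mult [symmetric] mult_ac)
      finally show ?thesis by (simp only: n_def)
    qed
    have "(\<lambda>n. (X ^ e * (K * 3 * Z2)) * (real n ^ ((p + 1) * e) * (\<beta> ^ e * \<alpha>) ^ n)) \<longlonglongrightarrow> (X ^ e * (K * 3 * Z2)) * 0"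
      using \<beta>1 \<alpha>0 lt by (intro tendsto_mult_left power_times_geometric_tendsto_0) auto
    from filterlim_compose[OF this sub]
    have "\<forall>\<^sub>F m in sequentially. (X ^ e * (K * 3 * Z2)) * (real (\<nu> m) ^ ((p + 1) * e) * (\<beta> ^ e * \<alpha>) ^ \<nu> m) < 1"
      by (rule order_tendstoD(2)) simp
    then have "\<forall>\<^sub>F m in sequentially. (K * B (Suc m) / \<kappa> m) ^ e * (K * A m) < 1"
      by eventually_elim (rule le_less_trans[OF bound])
    then show "\<forall>\<^sub>F m in sequentially. (K * B (Suc m) / \<kappa> m) ^ (rat_real.dim (rat_real.span (gen_value lam ` gen_index a)) - 1) * (K * A m) < 1"
      by (simp only: e_def gen_image)
  qed
qed

lemma dim_inequality:
  fixes lam :: real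
  assumes oa: "odd a"
  shows "(real a - 6 * real r) * ln (real r) - real r * ln 27 - (real a + 4) \<le>
    real (zeta_span_dim lam a) * (real a + 4 + real a * ln 2 + 6 * real r * (1 + ln (real r + 1)))"
proof -
  define e where "e = rat_real.dim (rat_real.span (zeta_generators lam a)) - 1"
  \<comment> \<open>With \<eta> = 1 / a the exponent is a + 3 + 2 / a, at most a + 4, so \<eta> does
    not affect the leading term.\<close>
  define Q where "Q = exp ((1 + 1 / real a) * real (a + 2))"
  have pos: "Q > 0" "coeff_growth a r > 0" "decay a r (real r) > 0"
    using coeff_growth_ge_1 decay_pos[of "real r"] r by (auto simp: Q_def)
  have a0: "real a > 0" using ar by simp
  have "1 \<le> (Q * coeff_growth a r) ^ e * (Q * decay a r (real r))"
    unfolding Q_def e_def using a0 by (intro growth_times_decay_ge_1 oa) auto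
  then have "0 \<le> ln ((Q * coeff_growth a r) ^ e * (Q * decay a r (real r)))"
    by (rule ln_ge_zero)
  also have "\<dots> = real e * (ln Q + ln (coeff_growth a r)) + (ln Q + ln (decay a r (real r)))"
    using pos by (simp add: ln_mult ln_realpow)
  finally have 1: "0 \<le> real e * (ln Q + ln (coeff_growth a r)) + (ln Q + ln (decay a r (real r)))" .
  have "ln Q = real a + 3 + 2 / real a" using a0 by (simp add: Q_def field_simps)
  also have "2 / real a \<le> 1" using a2 by simp
  finally have lnQ: "ln Q \<le> real a + 4" by simp
  define W where "W = real a + 4 + real a * ln 2 + 6 * real r * (1 + ln (real r + 1))"
  have W: "ln Q + ln (coeff_growth a r) \<le> W"
    unfolding ln_coeff_growth W_def using lnQ by (simp add: add.commute)
  have W0: "W \<ge> 0" unfolding W_def by (intro add_nonneg_nonneg mult_nonneg_nonneg ln_ge_zero) auto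
  have "real e * (ln Q + ln (coeff_growth a r)) \<le> real e * W" using W by (intro mult_left_mono) auto
  also have "\<dots> \<le> real (zeta_span_dim lam a) * W"
    using W0 by (intro mult_right_mono) (auto simp: e_def zeta_span_dim_def)
  finally show ?thesis using 1 lnQ unfolding ln_decay W_def by linarith
qed

end

theorem theorem2:
  fixes lam :: real
  shows "\<exists>\<epsilon> :: nat \<Rightarrow> real. \<epsilon> \<longlonglongrightarrow> 0 \<and>
           (\<forall>a. odd a \<and> a \<ge> 3 \<longrightarrow>
              real (zeta_span_dim lam a) \<ge> ln (real a) / (1 + ln 2) * (1 + \<epsilon> a))"
proof -
  \<comment> \<open>The order of r: ln x is asymptotic to ln t, so the gain keeps its full size t ln
    t, while x ln x = o(t) leaves t (1 + ln 2) as the cost.\<close>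
  define x where "x = (\<lambda>t::real. t / (ln t)\<^sup>2)"
  \<comment> \<open>\<open>N\<close> and \<open>W\<close> are the two sides of
    \<open>dim_inequality\<close> with r, which lies between x - 1 and x, replaced at each place by
    the less favourable end.\<close>
  define N where "N = (\<lambda>t::real. (t - 6 * x t) * ln (x t - 1) - x t * ln 27 - (t + 4))"
  define W where "W = (\<lambda>t::real. t + 4 + t * ln 2 + 6 * x t * (1 + ln (x t + 1)))"
  define F where "F = (\<lambda>t::real. N t / W t * ((1 + ln 2) / ln t))"
  have N: "((\<lambda>t. N t / (t * ln t)) \<longlongrightarrow> 1) at_top"
    unfolding N_def x_def by real_asymp
  have "((\<lambda>t. (t + 4 + t * c + 6 * x t * (1 + ln (x t + 1))) / t) \<longlongrightarrow> 1 + c) at_top" for c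
    unfolding x_def by real_asymp
  from this[of "ln 2"] have W: "((\<lambda>t. W t / t) \<longlongrightarrow> 1 + ln 2) at_top"
    unfolding W_def .
  have l2: "1 + ln 2 > (0::real)" by (simp add: add_pos_pos)
  have "((\<lambda>t. N t / (t * ln t) * ((1 + ln 2) / (W t / t))) \<longlongrightarrow> 1 * ((1 + ln 2) / (1 + ln 2))) at_top"
    using l2 by (intro tendsto_mult tendsto_divide N W tendsto_const) simp
  then have "((\<lambda>t. N t / (t * ln t) * ((1 + ln 2) / (W t / t))) \<longlongrightarrow> 1) at_top"
    using l2 by simp
  then have "(F \<longlongrightarrow> 1) at_top"
    by (rule Lim_transform_eventually)
      (use eventually_gt_at_top[of 0] in \<open>auto elim!: eventually_mono simp: F_def\<close>)
  then have F: "(\<lambda>a. F (real a)) \<longlonglongrightarrow> 1"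
    by (rule filterlim_compose[OF _ filterlim_real_sequentially])
  have "\<forall>\<^sub>F t in at_top. x t \<ge> 2 \<and> 6 * x t < t \<and> ln t > 0"
    unfolding x_def by (intro eventually_conj; real_asymp)
  then have "\<forall>\<^sub>F a in sequentially. x (real a) \<ge> 2 \<and> 6 * x (real a) < real a \<and> ln (real a) > 0"
    using filterlim_real_sequentially by (rule eventually_compose_filterlim)
  then obtain A0 where A0: "\<And>a. a \<ge> A0 \<Longrightarrow> x (real a) \<ge> 2" "\<And>a. a \<ge> A0 \<Longrightarrow> 6 * x (real a) < real a" "\<And>a. a \<ge> A0 \<Longrightarrow> ln (real a) > 0"
    unfolding eventually_sequentially by blast
  have bound: "ln (real a) / (1 + ln 2) * F (real a) \<le> real (zeta_span_dim lam a)" if a: "a \<ge> A0" "odd a" for a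
  proof -
    define r where "r = nat \<lfloor>x (real a)\<rfloor>"
    have "real r = of_int \<lfloor>x (real a)\<rfloor>" using A0(1)[OF a(1)] by (simp add: r_def)
    then have rx: "real r \<le> x (real a)" "x (real a) - 1 \<le> real r" by linarith+
    have r1: "real r \<ge> 1" using rx A0(1)[OF a(1)] by linarith
    have ra: "6 * real r < real a" using rx A0(2)[OF a(1)] by linarith
    have rn: "r \<ge> 1" "6 * r < a" using r1 ra by linarith+
    have W0: "W (real a) > 0"
      unfolding W_def using A0(1)[OF a(1)] ra by (intro add_pos_nonneg mult_nonneg_nonneg add_nonneg_nonneg ln_ge_zero) auto
    have "N (real a) \<le> (real a - 6 * real r) * ln (real r) - real r * ln 27 - (real a + 4)"
    proof -
      have "(real a - 6 * x (real a)) * ln (x (real a) - 1) \<le> (real a - 6 * real r) * ln (real r)"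
        using rx ra A0(1,2)[OF a(1)] by (intro mult_mono ln_mono ln_ge_zero) auto
      moreover have "real r * ln 27 \<le> x (real a) * ln 27" using rx by (intro mult_right_mono) auto
      ultimately show ?thesis unfolding N_def by linarith
    qed
    also have "\<dots> \<le> real (zeta_span_dim lam a) * (real a + 4 + real a * ln 2 + 6 * real r * (1 + ln (real r + 1)))"
      by (rule dim_inequality[OF rn a(2)])
    also have "\<dots> \<le> real (zeta_span_dim lam a) * W (real a)"
      unfolding W_def using rx r1 by (intro mult_left_mono add_mono mult_mono ln_mono add_nonneg_nonneg ln_ge_zero) auto
    finally have "N (real a) / W (real a) \<le> real (zeta_span_dim lam a)"
      using W0 by (simp add: pos_divide_le_eq)
    moreover have "ln (real a) / (1 + ln 2) * F (real a) = N (real a) / W (real a)"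
      using A0(3)[OF a(1)] l2 by (simp add: F_def)
    ultimately show ?thesis by simp
  qed
  \<comment> \<open>The value -1 makes the claimed lower bound 0 for the finitely many small
    a.\<close>
  define \<epsilon> where "\<epsilon> = (\<lambda>a. if a \<ge> A0 then F (real a) - 1 else - 1)"
  show ?thesis
  proof (intro exI[of _ \<epsilon>] conjI allI impI)
    have "(\<lambda>a. F (real a) - 1) \<longlonglongrightarrow> 1 - 1" by (intro tendsto_diff F tendsto_const)
    then have "(\<lambda>a. F (real a) - 1) \<longlonglongrightarrow> 0" by simp
    then show "\<epsilon> \<longlonglongrightarrow> 0"
    proof (rule Lim_transform_eventually)
      show "\<forall>\<^sub>F a in sequentially. F (real a) - 1 = \<epsilon> a"
        using eventually_ge_at_top[of A0] by eventually_elim (simp add: \<epsilon>_def)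
    qed
    fix a :: nat assume "odd a \<and> 3 \<le> a"
    then show "ln (real a) / (1 + ln 2) * (1 + \<epsilon> a) \<le> real (zeta_span_dim lam a)"
      using bound[of a] by (auto simp: \<epsilon>_def)
  qed
qed

end
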